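(* Let $\mathfrak{A},\mathfrak{B},\mathfrak{C},\mathfrak{H}$ be 2-categories, let $\mathcal{L}_{\mathcal{A}}:\mathfrak{B}\to\mathfrak{A}$, $\mathcal{L}_{\mathcal{B}}:\mathfrak{C}\to\mathfrak{B}$, $\mathcal{L}_{\mathcal{C}}:\mathfrak{C}\to\mathfrak{H}$ and $\mathtt{E}:\mathfrak{H}\to\mathfrak{A}$ be pseudofunctors, and assume that there is a pseudonatural equivalence $\mathtt{E}\circ\mathcal{L}_{\mathcal{C}}\simeq\mathcal{L}_{\mathcal{A}}\circ\mathcal{L}_{\mathcal{B}}$. Assume that $\mathcal{L}_{\mathcal{A}}\dashv\mathcal{A}$, $\mathcal{L}_{\mathcal{B}}\dashv\mathcal{B}$ and $\mathcal{L}_{\mathcal{C}}\dashv\mathcal{C}$ are pseudomonadic biadjunctions inducing idempotent pseudomonads $\mathcal{T}_{\mathcal{A}}$ (on $\mathfrak{B}$), $\mathcal{T}_{\mathcal{B}}$ and $\mathcal{T}_{\mathcal{C}}$ (on $\mathfrak{C}$). Then there is a pseudofunctor $\mathtt{R}:\mathfrak{A}\to\mathfrak{H}$ right biadjoint to $\mathtt{E}$, and $\mathtt{R}$ is a local equivalence. In particular, if $(X,a)$ is a $\mathcal{T}_{\mathcal{B}}$-pseudoalgebra that can be endowed with a $\mathcal{T}_{\mathcal{A}}$-pseudoalgebra structure, then $X$ can be endowed with a $\mathcal{T}_{\mathcal{C}}$-pseudoalgebra structure as well.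
   Context: A biadjunction $(\mathcal{L}\dashv\mathcal{U},\eta,\varepsilon)$ between 2-categories consists of pseudofunctors, pseudonatural transformations $\eta:\mathrm{Id}\to\mathcal{U}\mathcal{L}$, $\varepsilon:\mathcal{L}\mathcal{U}\to\mathrm{Id}$ and invertible modifications replacing the triangle identities, subject to coherence equations; it induces a pseudomonad $\mathcal{T}=\mathcal{U}\mathcal{L}$ with unit $\eta$. A pseudofunctor is a local equivalence if it induces equivalences between the hom-categories. A pseudomonad $\mathcal{T}$ with unit $\eta$ is idempotent if there is an invertible modification $\eta\mathcal{T}\cong\mathcal{T}\eta$. For such a pseudomonad on $\mathfrak{K}$, an object $X$ can be endowed with a $\mathcal{T}$-pseudoalgebra structure if $\eta_X:X\to\mathcal{T}(X)$ is an equivalence (a pseudoalgebra structure being a left adjoint $a:\mathcal{T}(X)\to X$ to $\eta_X$), and $\mathsf{Ps}\text{-}\mathcal{T}\text{-}\mathsf{Alg}$ is the full sub-2-category of $\mathfrak{K}$ on these objects. A biadjunction $\mathcal{L}\dashv\mathcal{U}$ inducing an idempotent pseudomonad $\mathcal{T}$ is pseudomonadic if the comparison pseudofunctor $Y\mapsto\mathcal{U}(Y)$ from the domain of $\mathcal{U}$ to $\mathsf{Ps}\text{-}\mathcal{T}\text{-}\mathsf{Alg}$ is a biequivalence. Since $\mathcal{L}_{\mathcal{B}}\dashv\mathcal{B}$ is pseudomonadic, a $\mathcal{T}_{\mathcal{B}}$-pseudoalgebra $(X,a)$ corresponds, up to equivalence, to an object of $\mathfrak{B}$ (namely $\mathcal{L}_{\mathcal{B}}(X)$,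 for which $\mathcal{B}\mathcal{L}_{\mathcal{B}}(X)\simeq X$); saying that $(X,a)$ can be endowed with a $\mathcal{T}_{\mathcal{A}}$-pseudoalgebra structure means that this object of $\mathfrak{B}$ can. *)

theory Defs
  imports Main
begin

section \<open>Categories and equivalences of categories\<close>

record ('o, 'a) cat =
  cobj :: "'o set"
  carr :: "'a set"
  csrc :: "'a \<Rightarrow> 'o"
  ctrg :: "'a \<Rightarrow> 'o"
  cid :: "'o \<Rightarrow> 'a"
  ccomp :: "'a \<Rightarrow> 'a \<Rightarrow> 'a"

definition chom :: "('o, 'a) cat \<Rightarrow> 'o \<Rightarrow> 'o \<Rightarrow> 'a set" where
  "chom C x y = {f \<in> carr C. csrc C f = x \<and> ctrg C f = y}"

locale category =
  fixes C :: "('o, 'a) cat"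
  assumes src_trg: "f \<in> carr C \<Longrightarrow> csrc C f \<in> cobj C \<and> ctrg C f \<in> cobj C"
    and id_hom: "x \<in> cobj C \<Longrightarrow> cid C x \<in> chom C x x"
    and comp_hom: "f \<in> chom C x y \<Longrightarrow> g \<in> chom C y z \<Longrightarrow> ccomp C g f \<in> chom C x z"
    and id_left: "f \<in> chom C x y \<Longrightarrow> ccomp C (cid C y) f = f"
    and id_right: "f \<in> chom C x y \<Longrightarrow> ccomp C f (cid C x) = f"
    and assoc: "f \<in> chom C w x \<Longrightarrow> g \<in> chom C x y \<Longrightarrow> h \<in> chom C y z \<Longrightarrow>
      ccomp C h (ccomp C g f) = ccomp C (ccomp C h g) f"

locale cfunctor =
  fixes C :: "('o, 'a) cat" and D :: "('p, 'b) cat"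
    and Fo :: "'o \<Rightarrow> 'p" and Fa :: "'a \<Rightarrow> 'b"
  assumes obj: "x \<in> cobj C \<Longrightarrow> Fo x \<in> cobj D"
    and arr: "f \<in> chom C x y \<Longrightarrow> Fa f \<in> chom D (Fo x) (Fo y)"
    and ident: "x \<in> cobj C \<Longrightarrow> Fa (cid C x) = cid D (Fo x)"
    and comp: "f \<in> chom C x y \<Longrightarrow> g \<in> chom C y z \<Longrightarrow>
      Fa (ccomp C g f) = ccomp D (Fa g) (Fa f)"

definition iso_arr :: "('o, 'a) cat \<Rightarrow> 'a \<Rightarrow> bool" where
  "iso_arr C f \<longleftrightarrow> f \<in> carr C \<and>
     (\<exists>g \<in> chom C (ctrg C f) (csrc C f).
        ccomp C g f = cid C (csrc C f) \<and> ccomp C f g = cid C (ctrg C f))"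

definition nat_iso ::
  "('o, 'a) cat \<Rightarrow> ('p, 'b) cat \<Rightarrow> ('o \<Rightarrow> 'p) \<Rightarrow> ('a \<Rightarrow> 'b) \<Rightarrow> ('o \<Rightarrow> 'p) \<Rightarrow> ('a \<Rightarrow> 'b) \<Rightarrow>
   ('o \<Rightarrow> 'b) \<Rightarrow> bool" where
  "nat_iso C D Fo Fa Go Ga \<theta> \<longleftrightarrow>
     (\<forall>x \<in> cobj C. \<theta> x \<in> chom D (Fo x) (Go x) \<and> iso_arr D (\<theta> x)) \<and>
     (\<forall>x \<in> cobj C. \<forall>y \<in> cobj C. \<forall>f \<in> chom C x y.
        ccomp D (\<theta> y) (Fa f) = ccomp D (Ga f) (\<theta> x))"

definition cat_equivalence ::
  "('o, 'a) cat \<Rightarrow> ('p, 'b) cat \<Rightarrow> ('o \<Rightarrow> 'p) \<Rightarrow> ('a \<Rightarrow> 'b) \<Rightarrow> bool" where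
  "cat_equivalence C D Fo Fa \<longleftrightarrow> cfunctor C D Fo Fa \<and>
     (\<exists>Go Ga. cfunctor D C Go Ga \<and>
        (\<exists>\<theta>. nat_iso C C (Go \<circ> Fo) (Ga \<circ> Fa) id id \<theta>) \<and>
        (\<exists>\<theta>. nat_iso D D (Fo \<circ> Go) (Fa \<circ> Ga) id id \<theta>))"


section \<open>2-categories\<close>

text \<open>
  The 2-categories are strict.  Compositions are written in the applicative order:
  \<open>g \<odot> f\<close> for 1-cells, \<open>\<beta> \<bullet> \<alpha>\<close> (vertical) and \<open>\<beta> \<star> \<alpha>\<close> (horizontal) for 2-cells.
  The operations are total HOL functions, unconstrained outside the carriers.
\<close>

record ('o, 'a, 'c) two_cat =
  obj :: "'o set"
  arr :: "'a set"
  cell :: "'c set"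
  src1 :: "'a \<Rightarrow> 'o"
  trg1 :: "'a \<Rightarrow> 'o"
  src2 :: "'c \<Rightarrow> 'a"
  trg2 :: "'c \<Rightarrow> 'a"
  id1 :: "'o \<Rightarrow> 'a"
  id2 :: "'a \<Rightarrow> 'c"
  comp1 :: "'a \<Rightarrow> 'a \<Rightarrow> 'a"  (infixr \<open>\<odot>\<index>\<close> 70)
  vcomp :: "'c \<Rightarrow> 'c \<Rightarrow> 'c"  (infixr \<open>\<bullet>\<index>\<close> 55)
  hcomp :: "'c \<Rightarrow> 'c \<Rightarrow> 'c"  (infixr \<open>\<star>\<index>\<close> 65)

definition hom :: "('o, 'a, 'c) two_cat \<Rightarrow> 'o \<Rightarrow> 'o \<Rightarrow> 'a set" where
  "hom K x y = {f \<in> arr K. src1 K f = x \<and> trg1 K f = y}"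

definition cells :: "('o, 'a, 'c) two_cat \<Rightarrow> 'a \<Rightarrow> 'a \<Rightarrow> 'c set" where
  "cells K f g = {\<alpha> \<in> cell K. src2 K \<alpha> = f \<and> trg2 K \<alpha> = g}"

definition hom_cat :: "('o, 'a, 'c) two_cat \<Rightarrow> 'o \<Rightarrow> 'o \<Rightarrow> ('a, 'c) cat" where
  "hom_cat K x y =
     \<lparr> cobj = hom K x y,
       carr = {\<alpha> \<in> cell K. src2 K \<alpha> \<in> hom K x y},
       csrc = src2 K, ctrg = trg2 K, cid = id2 K, ccomp = vcomp K \<rparr>"

locale two_category =
  fixes K :: "('o, 'a, 'c) two_cat" (structure)
  assumes arr_src_trg: "f \<in> arr K \<Longrightarrow> src1 K f \<in> obj K \<and> trg1 K f \<in> obj K"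
    and cell_src: "\<alpha> \<in> cell K \<Longrightarrow> src2 K \<alpha> \<in> arr K"
    and hom_category: "x \<in> obj K \<Longrightarrow> y \<in> obj K \<Longrightarrow> category (hom_cat K x y)"
    and id1_hom: "x \<in> obj K \<Longrightarrow> id1 K x \<in> hom K x x"
    and comp1_hom: "f \<in> hom K x y \<Longrightarrow> g \<in> hom K y z \<Longrightarrow> g \<odot> f \<in> hom K x z"
    and id1_left: "f \<in> hom K x y \<Longrightarrow> id1 K y \<odot> f = f"
    and id1_right: "f \<in> hom K x y \<Longrightarrow> f \<odot> id1 K x = f"
    and comp1_assoc: "f \<in> hom K w x \<Longrightarrow> g \<in> hom K x y \<Longrightarrow> h \<in> hom K y z \<Longrightarrow>
      h \<odot> (g \<odot> f) = (h \<odot> g) \<odot> f"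
    and hcomp_cells: "f \<in> hom K x y \<Longrightarrow> g \<in> hom K y z \<Longrightarrow>
      \<alpha> \<in> cells K f f' \<Longrightarrow> \<beta> \<in> cells K g g' \<Longrightarrow> \<beta> \<star> \<alpha> \<in> cells K (g \<odot> f) (g' \<odot> f')"
    and hcomp_id2: "f \<in> hom K x y \<Longrightarrow> g \<in> hom K y z \<Longrightarrow>
      id2 K g \<star> id2 K f = id2 K (g \<odot> f)"
    and interchange: "f \<in> hom K x y \<Longrightarrow> g \<in> hom K y z \<Longrightarrow>
      \<alpha> \<in> cells K f f' \<Longrightarrow> \<alpha>' \<in> cells K f' f'' \<Longrightarrow>
      \<beta> \<in> cells K g g' \<Longrightarrow> \<beta>' \<in> cells K g' g'' \<Longrightarrow>
      (\<beta>' \<bullet> \<beta>) \<star> (\<alpha>' \<bullet> \<alpha>) = (\<beta>' \<star> \<alpha>') \<bullet> (\<beta> \<star> \<alpha>)"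
    and hcomp_unit_left: "f \<in> hom K x y \<Longrightarrow> \<alpha> \<in> cells K f f' \<Longrightarrow>
      id2 K (id1 K y) \<star> \<alpha> = \<alpha>"
    and hcomp_unit_right: "f \<in> hom K x y \<Longrightarrow> \<alpha> \<in> cells K f f' \<Longrightarrow>
      \<alpha> \<star> id2 K (id1 K x) = \<alpha>"
    and hcomp_assoc: "f \<in> hom K w x \<Longrightarrow> g \<in> hom K x y \<Longrightarrow> h \<in> hom K y z \<Longrightarrow>
      \<alpha> \<in> cells K f f' \<Longrightarrow> \<beta> \<in> cells K g g' \<Longrightarrow> \<gamma> \<in> cells K h h' \<Longrightarrow>
      \<gamma> \<star> (\<beta> \<star> \<alpha>) = (\<gamma> \<star> \<beta>) \<star> \<alpha>"

definition inverse_cells :: "('o, 'a, 'c) two_cat \<Rightarrow> 'c \<Rightarrow> 'c \<Rightarrow> bool" where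
  "inverse_cells K \<alpha> \<beta> \<longleftrightarrow> \<alpha> \<in> cell K \<and> \<beta> \<in> cells K (trg2 K \<alpha>) (src2 K \<alpha>) \<and>
     \<beta> \<bullet>\<^bsub>K\<^esub> \<alpha> = id2 K (src2 K \<alpha>) \<and> \<alpha> \<bullet>\<^bsub>K\<^esub> \<beta> = id2 K (trg2 K \<alpha>)"

definition iso_cell :: "('o, 'a, 'c) two_cat \<Rightarrow> 'c \<Rightarrow> bool" where
  "iso_cell K \<alpha> \<longleftrightarrow> (\<exists>\<beta>. inverse_cells K \<alpha> \<beta>)"

definition vinv :: "('o, 'a, 'c) two_cat \<Rightarrow> 'c \<Rightarrow> 'c" where
  "vinv K \<alpha> = (THE \<beta>. inverse_cells K \<alpha> \<beta>)"

definition isocells :: "('o, 'a, 'c) two_cat \<Rightarrow> 'a \<Rightarrow> 'a \<Rightarrow> 'c set" where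
  "isocells K f g = {\<alpha> \<in> cells K f g. iso_cell K \<alpha>}"

definition equivalence_1cell :: "('o, 'a, 'c) two_cat \<Rightarrow> 'a \<Rightarrow> bool" where
  "equivalence_1cell K f \<longleftrightarrow> f \<in> arr K \<and>
     (\<exists>g \<in> hom K (trg1 K f) (src1 K f).
        isocells K (id1 K (src1 K f)) (g \<odot>\<^bsub>K\<^esub> f) \<noteq> {} \<and>
        isocells K (f \<odot>\<^bsub>K\<^esub> g) (id1 K (trg1 K f)) \<noteq> {})"

definition left_adjoint_1cell :: "('o, 'a, 'c) two_cat \<Rightarrow> 'a \<Rightarrow> 'a \<Rightarrow> bool" where
  "left_adjoint_1cell K l r \<longleftrightarrow> r \<in> arr K \<and> l \<in> hom K (trg1 K r) (src1 K r) \<and>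
     (\<exists>u \<in> cells K (id1 K (src1 K l)) (r \<odot>\<^bsub>K\<^esub> l).
      \<exists>c \<in> cells K (l \<odot>\<^bsub>K\<^esub> r) (id1 K (src1 K r)).
        (c \<star>\<^bsub>K\<^esub> id2 K l) \<bullet>\<^bsub>K\<^esub> (id2 K l \<star>\<^bsub>K\<^esub> u) = id2 K l \<and>
        (id2 K r \<star>\<^bsub>K\<^esub> c) \<bullet>\<^bsub>K\<^esub> (u \<star>\<^bsub>K\<^esub> id2 K r) = id2 K r)"

definition full_sub :: "('o, 'a, 'c) two_cat \<Rightarrow> 'o set \<Rightarrow> ('o, 'a, 'c) two_cat" where
  "full_sub K S = K \<lparr>
     obj := obj K \<inter> S,
     arr := {f \<in> arr K. src1 K f \<in> S \<and> trg1 K f \<in> S},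
     cell := {\<alpha> \<in> cell K. src1 K (src2 K \<alpha>) \<in> S \<and> trg1 K (src2 K \<alpha>) \<in> S} \<rparr>"


section \<open>Pseudofunctors\<close>

text \<open>
  \<open>fc F g f : F g \<odot> F f \<Rightarrow> F (g \<odot> f)\<close> and \<open>fu F x : id1 (F x) \<Rightarrow> F (id1 x)\<close> are the
  invertible compositor and unitor of \<open>F\<close>.
\<close>

record ('o, 'a, 'c, 'p, 'b, 'd) psfun =
  f0 :: "'o \<Rightarrow> 'p"
  f1 :: "'a \<Rightarrow> 'b"
  f2 :: "'c \<Rightarrow> 'd"
  fc :: "'a \<Rightarrow> 'a \<Rightarrow> 'd"
  fu :: "'o \<Rightarrow> 'd"

locale pseudofunctor =
  fixes K :: "('o, 'a, 'c) two_cat" and M :: "('p, 'b, 'd) two_cat"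
    and F :: "('o, 'a, 'c, 'p, 'b, 'd) psfun"
  assumes f0_obj: "x \<in> obj K \<Longrightarrow> f0 F x \<in> obj M"
    and local_functor: "x \<in> obj K \<Longrightarrow> y \<in> obj K \<Longrightarrow>
      cfunctor (hom_cat K x y) (hom_cat M (f0 F x) (f0 F y)) (f1 F) (f2 F)"
    and fc_iso: "f \<in> hom K x y \<Longrightarrow> g \<in> hom K y z \<Longrightarrow>
      fc F g f \<in> isocells M (f1 F g \<odot>\<^bsub>M\<^esub> f1 F f) (f1 F (g \<odot>\<^bsub>K\<^esub> f))"
    and fu_iso: "x \<in> obj K \<Longrightarrow> fu F x \<in> isocells M (id1 M (f0 F x)) (f1 F (id1 K x))"
    and fc_natural: "f \<in> hom K x y \<Longrightarrow> g \<in> hom K y z \<Longrightarrow>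
      \<alpha> \<in> cells K f f' \<Longrightarrow> \<beta> \<in> cells K g g' \<Longrightarrow>
      f2 F (\<beta> \<star>\<^bsub>K\<^esub> \<alpha>) \<bullet>\<^bsub>M\<^esub> fc F g f = fc F g' f' \<bullet>\<^bsub>M\<^esub> (f2 F \<beta> \<star>\<^bsub>M\<^esub> f2 F \<alpha>)"
    and fc_assoc: "f \<in> hom K w x \<Longrightarrow> g \<in> hom K x y \<Longrightarrow> h \<in> hom K y z \<Longrightarrow>
      fc F (h \<odot>\<^bsub>K\<^esub> g) f \<bullet>\<^bsub>M\<^esub> (fc F h g \<star>\<^bsub>M\<^esub> id2 M (f1 F f)) =
      fc F h (g \<odot>\<^bsub>K\<^esub> f) \<bullet>\<^bsub>M\<^esub> (id2 M (f1 F h) \<star>\<^bsub>M\<^esub> fc F g f)"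
    and fu_right: "f \<in> hom K x y \<Longrightarrow>
      fc F f (id1 K x) \<bullet>\<^bsub>M\<^esub> (id2 M (f1 F f) \<star>\<^bsub>M\<^esub> fu F x) = id2 M (f1 F f)"
    and fu_left: "f \<in> hom K x y \<Longrightarrow>
      fc F (id1 K y) f \<bullet>\<^bsub>M\<^esub> (fu F y \<star>\<^bsub>M\<^esub> id2 M (f1 F f)) = id2 M (f1 F f)"

definition id_psf :: "('o, 'a, 'c) two_cat \<Rightarrow> ('o, 'a, 'c, 'o, 'a, 'c) psfun" where
  "id_psf K = \<lparr> f0 = (\<lambda>x. x), f1 = (\<lambda>f. f), f2 = (\<lambda>\<alpha>. \<alpha>),
     fc = (\<lambda>g f. id2 K (g \<odot>\<^bsub>K\<^esub> f)), fu = (\<lambda>x. id2 K (id1 K x)) \<rparr>"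

text \<open>
  \<open>comp_psf P G F\<close> is \<open>G \<circ> F\<close>, where \<open>P\<close> is the codomain of \<open>G\<close>.
\<close>

definition comp_psf ::
  "('q, 'e, 'g) two_cat \<Rightarrow> ('p, 'b, 'd, 'q, 'e, 'g) psfun \<Rightarrow> ('o, 'a, 'c, 'p, 'b, 'd) psfun \<Rightarrow>
   ('o, 'a, 'c, 'q, 'e, 'g) psfun" where
  "comp_psf P G F =
     \<lparr> f0 = (\<lambda>x. f0 G (f0 F x)), f1 = (\<lambda>f. f1 G (f1 F f)), f2 = (\<lambda>\<alpha>. f2 G (f2 F \<alpha>)),
       fc = (\<lambda>g f. f2 G (fc F g f) \<bullet>\<^bsub>P\<^esub> fc G (f1 F g) (f1 F f)),
       fu = (\<lambda>x. f2 G (fu F x) \<bullet>\<^bsub>P\<^esub> fu G (f0 F x)) \<rparr>"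

definition local_equivalence ::
  "('o, 'a, 'c) two_cat \<Rightarrow> ('p, 'b, 'd) two_cat \<Rightarrow> ('o, 'a, 'c, 'p, 'b, 'd) psfun \<Rightarrow> bool" where
  "local_equivalence K M F \<longleftrightarrow> pseudofunctor K M F \<and>
     (\<forall>x \<in> obj K. \<forall>y \<in> obj K.
        cat_equivalence (hom_cat K x y) (hom_cat M (f0 F x) (f0 F y)) (f1 F) (f2 F))"


section \<open>Pseudonatural transformations and modifications\<close>

text \<open>
  For \<open>f : x \<rightarrow> y\<close>, the 2-cell component of \<open>\<sigma> : F \<rightarrow> G\<close> is
  \<open>tc \<sigma> f : G f \<odot> tr \<sigma> x \<Rightarrow> tr \<sigma> y \<odot> F f\<close>.
\<close>

record ('o, 'a, 'b, 'd) psnat =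
  tr :: "'o \<Rightarrow> 'b"
  tc :: "'a \<Rightarrow> 'd"

locale pseudonatural =
  fixes K :: "('o, 'a, 'c) two_cat" and M :: "('p, 'b, 'd) two_cat"
    and F G :: "('o, 'a, 'c, 'p, 'b, 'd) psfun"
    and \<sigma> :: "('o, 'a, 'b, 'd) psnat"
  assumes tr_hom: "x \<in> obj K \<Longrightarrow> tr \<sigma> x \<in> hom M (f0 F x) (f0 G x)"
    and tc_iso: "f \<in> hom K x y \<Longrightarrow>
      tc \<sigma> f \<in> isocells M (f1 G f \<odot>\<^bsub>M\<^esub> tr \<sigma> x) (tr \<sigma> y \<odot>\<^bsub>M\<^esub> f1 F f)"
    and tc_natural: "f \<in> hom K x y \<Longrightarrow> \<alpha> \<in> cells K f g \<Longrightarrow>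
      (id2 M (tr \<sigma> y) \<star>\<^bsub>M\<^esub> f2 F \<alpha>) \<bullet>\<^bsub>M\<^esub> tc \<sigma> f = tc \<sigma> g \<bullet>\<^bsub>M\<^esub> (f2 G \<alpha> \<star>\<^bsub>M\<^esub> id2 M (tr \<sigma> x))"
    and tc_comp: "f \<in> hom K x y \<Longrightarrow> g \<in> hom K y z \<Longrightarrow>
      tc \<sigma> (g \<odot>\<^bsub>K\<^esub> f) \<bullet>\<^bsub>M\<^esub> (fc G g f \<star>\<^bsub>M\<^esub> id2 M (tr \<sigma> x)) =
      (id2 M (tr \<sigma> z) \<star>\<^bsub>M\<^esub> fc F g f) \<bullet>\<^bsub>M\<^esub> (tc \<sigma> g \<star>\<^bsub>M\<^esub> id2 M (f1 F f)) \<bullet>\<^bsub>M\<^esub>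
      (id2 M (f1 G g) \<star>\<^bsub>M\<^esub> tc \<sigma> f)"
    and tc_id: "x \<in> obj K \<Longrightarrow>
      tc \<sigma> (id1 K x) \<bullet>\<^bsub>M\<^esub> (fu G x \<star>\<^bsub>M\<^esub> id2 M (tr \<sigma> x)) = id2 M (tr \<sigma> x) \<star>\<^bsub>M\<^esub> fu F x"

definition id_psn ::
  "('p, 'b, 'd) two_cat \<Rightarrow> ('o, 'a, 'c, 'p, 'b, 'd) psfun \<Rightarrow> ('o, 'a, 'b, 'd) psnat" where
  "id_psn M F = \<lparr> tr = (\<lambda>x. id1 M (f0 F x)), tc = (\<lambda>f. id2 M (f1 F f)) \<rparr>"

text \<open>
  Vertical composite \<open>\<tau> \<cdot> \<sigma>\<close>; the endpoints of each 1-cell are read off with \<open>src1\<close>, \<open>trg1\<close>.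
\<close>

definition vcomp_psn ::
  "('o, 'a, 'c) two_cat \<Rightarrow> ('p, 'b, 'd) two_cat \<Rightarrow>
   ('o, 'a, 'b, 'd) psnat \<Rightarrow> ('o, 'a, 'b, 'd) psnat \<Rightarrow> ('o, 'a, 'b, 'd) psnat" where
  "vcomp_psn K M \<tau> \<sigma> =
     \<lparr> tr = (\<lambda>x. tr \<tau> x \<odot>\<^bsub>M\<^esub> tr \<sigma> x),
       tc = (\<lambda>f. (id2 M (tr \<tau> (trg1 K f)) \<star>\<^bsub>M\<^esub> tc \<sigma> f) \<bullet>\<^bsub>M\<^esub>
                 (tc \<tau> f \<star>\<^bsub>M\<^esub> id2 M (tr \<sigma> (src1 K f)))) \<rparr>"

text \<open>
  \<open>psn_right \<sigma> H\<close> is \<open>\<sigma> H\<close> (\<open>H\<close> is applied first).  \<open>psn_left K P H F G \<sigma>\<close> is \<open>H \<sigma>\<close>, for \<open>\<sigma> : F \<rightarrow> G\<close>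
  between pseudofunctors on \<open>K\<close> and \<open>H\<close> with values in \<open>P\<close>.
\<close>

definition psn_right ::
  "('p, 'b, 'e, 'g) psnat \<Rightarrow> ('o, 'a, 'c, 'p, 'b, 'd) psfun \<Rightarrow> ('o, 'a, 'e, 'g) psnat" where
  "psn_right \<sigma> H = \<lparr> tr = (\<lambda>x. tr \<sigma> (f0 H x)), tc = (\<lambda>f. tc \<sigma> (f1 H f)) \<rparr>"

definition psn_left ::
  "('o, 'a, 'c) two_cat \<Rightarrow> ('q, 'e, 'g) two_cat \<Rightarrow> ('p, 'b, 'd, 'q, 'e, 'g) psfun \<Rightarrow>
   ('o, 'a, 'c, 'p, 'b, 'd) psfun \<Rightarrow> ('o, 'a, 'c, 'p, 'b, 'd) psfun \<Rightarrow>
   ('o, 'a, 'b, 'd) psnat \<Rightarrow> ('o, 'a, 'e, 'g) psnat" where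
  "psn_left K P H F G \<sigma> =
     \<lparr> tr = (\<lambda>x. f1 H (tr \<sigma> x)),
       tc = (\<lambda>f. vinv P (fc H (tr \<sigma> (trg1 K f)) (f1 F f)) \<bullet>\<^bsub>P\<^esub> f2 H (tc \<sigma> f) \<bullet>\<^bsub>P\<^esub>
                 fc H (f1 G f) (tr \<sigma> (src1 K f))) \<rparr>"

locale invertible_modification =
  fixes K :: "('o, 'a, 'c) two_cat" and M :: "('p, 'b, 'd) two_cat"
    and F G :: "('o, 'a, 'c, 'p, 'b, 'd) psfun"
    and \<sigma> \<tau> :: "('o, 'a, 'b, 'd) psnat" and \<Gamma> :: "'o \<Rightarrow> 'd"
  assumes component: "x \<in> obj K \<Longrightarrow> \<Gamma> x \<in> isocells M (tr \<sigma> x) (tr \<tau> x)"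
    and modification: "f \<in> hom K x y \<Longrightarrow>
      (\<Gamma> y \<star>\<^bsub>M\<^esub> id2 M (f1 F f)) \<bullet>\<^bsub>M\<^esub> tc \<sigma> f = tc \<tau> f \<bullet>\<^bsub>M\<^esub> (id2 M (f1 G f) \<star>\<^bsub>M\<^esub> \<Gamma> x)"

text \<open>
  A pseudonatural equivalence is an equivalence in the 2-category of pseudofunctors,
  pseudonatural transformations and modifications.
\<close>

definition pseudonatural_equivalence ::
  "('o, 'a, 'c) two_cat \<Rightarrow> ('p, 'b, 'd) two_cat \<Rightarrow> ('o, 'a, 'c, 'p, 'b, 'd) psfun \<Rightarrow>
   ('o, 'a, 'c, 'p, 'b, 'd) psfun \<Rightarrow> ('o, 'a, 'b, 'd) psnat \<Rightarrow> bool" where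
  "pseudonatural_equivalence K M F G \<sigma> \<longleftrightarrow> pseudonatural K M F G \<sigma> \<and>
     (\<exists>\<tau>. pseudonatural K M G F \<tau> \<and>
        (\<exists>\<Gamma>. invertible_modification K M F F (id_psn M F) (vcomp_psn K M \<tau> \<sigma>) \<Gamma>) \<and>
        (\<exists>\<Gamma>. invertible_modification K M G G (vcomp_psn K M \<sigma> \<tau>) (id_psn M G) \<Gamma>))"

definition pseudonaturally_equivalent ::
  "('o, 'a, 'c) two_cat \<Rightarrow> ('p, 'b, 'd) two_cat \<Rightarrow> ('o, 'a, 'c, 'p, 'b, 'd) psfun \<Rightarrow>
   ('o, 'a, 'c, 'p, 'b, 'd) psfun \<Rightarrow> bool" where
  "pseudonaturally_equivalent K M F G \<longleftrightarrow> (\<exists>\<sigma>. pseudonatural_equivalence K M F G \<sigma>)"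

definition biequivalence ::
  "('o, 'a, 'c) two_cat \<Rightarrow> ('p, 'b, 'd) two_cat \<Rightarrow> ('o, 'a, 'c, 'p, 'b, 'd) psfun \<Rightarrow> bool" where
  "biequivalence K M F \<longleftrightarrow> pseudofunctor K M F \<and>
     (\<exists>G. pseudofunctor M K G \<and>
        pseudonaturally_equivalent K K (comp_psf K G F) (id_psf K) \<and>
        pseudonaturally_equivalent M M (comp_psf M F G) (id_psf M))"


section \<open>Biadjunctions\<close>

text \<open>
  The data of \<open>L \<stileturn> U\<close> are \<open>\<eta> : Id \<rightarrow> U L\<close>, \<open>\<epsilon> : L U \<rightarrow> Id\<close> and the invertible modifications
  \<open>s : Id\<^bsub>L\<^esub> \<Rightarrow> (\<epsilon> L) \<cdot> (L \<eta>)\<close> and \<open>t : (U \<epsilon>) \<cdot> (\<eta> U) \<Rightarrow> Id\<^bsub>U\<^esub>\<close>.  The two coherence equations say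
  that, with \<open>e = \<epsilon>\<^bsub>Y\<^esub>\<close> and \<open>h = \<eta>\<^bsub>X\<^esub>\<close>, the composites
  \<open>e \<Rightarrow> e \<odot> \<epsilon>\<^bsub>LUY\<^esub> \<odot> L \<eta>\<^bsub>UY\<^esub> \<Rightarrow> e \<odot> LU e \<odot> L \<eta>\<^bsub>UY\<^esub> \<Rightarrow> e \<odot> L (U e \<odot> \<eta>\<^bsub>UY\<^esub>) \<Rightarrow> e \<odot> L id \<Rightarrow> e\<close> and
  \<open>h \<Rightarrow> U id \<odot> h \<Rightarrow> U (\<epsilon>\<^bsub>LX\<^esub> \<odot> L h) \<odot> h \<Rightarrow> U \<epsilon>\<^bsub>LX\<^esub> \<odot> UL h \<odot> h \<Rightarrow> U \<epsilon>\<^bsub>LX\<^esub> \<odot> \<eta>\<^bsub>ULX\<^esub> \<odot> h \<Rightarrow> h\<close>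
  are identities.
\<close>

locale biadjunction =
  fixes K :: "('o, 'a, 'c) two_cat" and M :: "('p, 'b, 'd) two_cat"
    and L :: "('o, 'a, 'c, 'p, 'b, 'd) psfun" and U :: "('p, 'b, 'd, 'o, 'a, 'c) psfun"
    and \<eta> :: "('o, 'a, 'a, 'c) psnat" and \<epsilon> :: "('p, 'b, 'b, 'd) psnat"
    and s :: "'o \<Rightarrow> 'd" and t :: "'p \<Rightarrow> 'c"
  assumes L: "pseudofunctor K M L"
    and U: "pseudofunctor M K U"
    and \<eta>: "pseudonatural K K (id_psf K) (comp_psf K U L) \<eta>"
    and \<epsilon>: "pseudonatural M M (comp_psf M L U) (id_psf M) \<epsilon>"
    and s: "invertible_modification K M L L (id_psn M L)
      (vcomp_psn K M (psn_right \<epsilon> L) (psn_left K M L (id_psf K) (comp_psf K U L) \<eta>)) s"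
    and t: "invertible_modification M K U U
      (vcomp_psn M K (psn_left M K U (comp_psf M L U) (id_psf M) \<epsilon>) (psn_right \<eta> U))
      (id_psn K U) t"
    and counit_coherence: "Y \<in> obj M \<Longrightarrow> e = tr \<epsilon> Y \<Longrightarrow> n = tr \<eta> (f0 U Y) \<Longrightarrow>
      (id2 M e \<star>\<^bsub>M\<^esub> vinv M (fu L (f0 U Y))) \<bullet>\<^bsub>M\<^esub>
      (id2 M e \<star>\<^bsub>M\<^esub> f2 L (t Y)) \<bullet>\<^bsub>M\<^esub>
      (id2 M e \<star>\<^bsub>M\<^esub> fc L (f1 U e) n) \<bullet>\<^bsub>M\<^esub>
      (tc \<epsilon> e \<star>\<^bsub>M\<^esub> id2 M (f1 L n)) \<bullet>\<^bsub>M\<^esub>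
      (id2 M e \<star>\<^bsub>M\<^esub> s (f0 U Y)) = id2 M e"
    and unit_coherence: "X \<in> obj K \<Longrightarrow> h = tr \<eta> X \<Longrightarrow> e = tr \<epsilon> (f0 L X) \<Longrightarrow>
      (t (f0 L X) \<star>\<^bsub>K\<^esub> id2 K h) \<bullet>\<^bsub>K\<^esub>
      (id2 K (f1 U e) \<star>\<^bsub>K\<^esub> tc \<eta> h) \<bullet>\<^bsub>K\<^esub>
      (vinv K (fc U e (f1 L h)) \<star>\<^bsub>K\<^esub> id2 K h) \<bullet>\<^bsub>K\<^esub>
      (f2 U (s X) \<star>\<^bsub>K\<^esub> id2 K h) \<bullet>\<^bsub>K\<^esub>
      (fu U (f0 L X) \<star>\<^bsub>K\<^esub> id2 K h) = id2 K h"

definition right_biadjoint ::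
  "('o, 'a, 'c) two_cat \<Rightarrow> ('p, 'b, 'd) two_cat \<Rightarrow> ('o, 'a, 'c, 'p, 'b, 'd) psfun \<Rightarrow>
   ('p, 'b, 'd, 'o, 'a, 'c) psfun \<Rightarrow> bool" where
  "right_biadjoint K M L U \<longleftrightarrow> (\<exists>\<eta> \<epsilon> s t. biadjunction K M L U \<eta> \<epsilon> s t)"


section \<open>Idempotent pseudomonads and pseudoalgebras\<close>

text \<open>
  Idempotency and pseudoalgebras of an idempotent pseudomonad only involve its underlying
  pseudofunctor \<open>T\<close> and its unit \<open>\<eta> : Id \<rightarrow> T\<close>, not its multiplication; for the pseudomonad induced by a biadjunction,
  \<open>T = U L\<close> and \<open>\<eta>\<close> is the unit of the biadjunction.
\<close>

definition idempotent_pseudomonad ::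
  "('o, 'a, 'c) two_cat \<Rightarrow> ('o, 'a, 'c, 'o, 'a, 'c) psfun \<Rightarrow> ('o, 'a, 'a, 'c) psnat \<Rightarrow> bool" where
  "idempotent_pseudomonad K T \<eta> \<longleftrightarrow>
     (\<exists>\<Gamma>. invertible_modification K K T (comp_psf K T T)
        (psn_right \<eta> T) (psn_left K K T (id_psf K) T \<eta>) \<Gamma>)"

definition admits_pseudoalgebra ::
  "('o, 'a, 'c) two_cat \<Rightarrow> ('o, 'a, 'a, 'c) psnat \<Rightarrow> 'o \<Rightarrow> bool" where
  "admits_pseudoalgebra K \<eta> X \<longleftrightarrow> X \<in> obj K \<and> equivalence_1cell K (tr \<eta> X)"

definition pseudoalgebra ::
  "('o, 'a, 'c) two_cat \<Rightarrow> ('o, 'a, 'a, 'c) psnat \<Rightarrow> 'o \<Rightarrow> 'a \<Rightarrow> bool" where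
  "pseudoalgebra K \<eta> X a \<longleftrightarrow> admits_pseudoalgebra K \<eta> X \<and> left_adjoint_1cell K a (tr \<eta> X)"

definition Ps_Alg ::
  "('o, 'a, 'c) two_cat \<Rightarrow> ('o, 'a, 'a, 'c) psnat \<Rightarrow> ('o, 'a, 'c) two_cat" where
  "Ps_Alg K \<eta> = full_sub K {X. admits_pseudoalgebra K \<eta> X}"

text \<open>
  The comparison \<open>Y \<mapsto> U Y\<close> is \<open>U\<close> itself, regarded as a pseudofunctor into the full
  sub-2-category \<open>Ps_Alg K \<eta>\<close> of \<open>K\<close>.
\<close>

definition pseudomonadic ::
  "('o, 'a, 'c) two_cat \<Rightarrow> ('p, 'b, 'd) two_cat \<Rightarrow> ('p, 'b, 'd, 'o, 'a, 'c) psfun \<Rightarrow>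
   ('o, 'a, 'a, 'c) psnat \<Rightarrow> bool" where
  "pseudomonadic K M U \<eta> \<longleftrightarrow> biequivalence M (Ps_Alg K \<eta>) U"

end

theory Submission
  imports Defs
begin

text \<open>
  The object part of \<open>R\<close> is \<open>a \<mapsto> LC (B (A a))\<close>.  For \<open>X = B (A a)\<close> the pseudofunctor \<open>LA \<circ> LB\<close>, hence also
  \<open>E \<circ> LC\<close>, is an equivalence on all hom-categories with target \<open>X\<close>.  Since \<open>LC\<close> inverts the unit
  \<open>\<eta>C\<close>, this forces \<open>\<eta>C X\<close> to be an equivalence; the same argument settles the statement about
  pseudoalgebras.  It follows that \<open>LC\<close> is an equivalence on the hom-categories
  with target \<open>X\<close>, and then \<open>E\<close> on those with target \<open>LC X\<close>.  Hence the equivalence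
  \<open>e a : E (LC X) \<simeq> LA (LB X) \<rightarrow> LA (A a) \<rightarrow> a\<close> is a biuniversal arrow from \<open>E\<close> to \<open>a\<close>, and
  \<open>R\<close> is a local equivalence because every \<open>e a\<close> is an equivalence.

  To pass from biuniversal arrows to a coherent biadjunction, all data on the side of \<open>R\<close> are obtained by lifting
  along the projection of the pseudo comma 2-category of \<open>E\<close> to the codomain of \<open>E\<close>.  Lifts of 2-cells
  into a biuniversal arrow are unique, so each coherence equation reduces to an equality
  of 2-cells in the base that already holds strictly.
\<close>

section \<open>2-categories and equivalences\<close>

text \<open>The counits carry the argument. Pseudomonadicity provides \<open>G\<close> with
  \<open>G \<circ> U\<close> pseudonaturally equivalent to the identity, so an equivalence
  \<open>U \<epsilon>\<close> forces \<open>\<epsilon>\<close> to be one. With the triangle for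
  \<open>LC\<close> this is why \<open>LC\<close> inverts its unit. It also gives that
  \<open>LB (B b)\<close> is equivalent to \<open>b\<close> and \<open>LC (C k)\<close> to
  \<open>k\<close>; through the latter, control of \<open>E\<close> on sources of the form
  \<open>LC z\<close> extends to every source \<open>k\<close>.

  The obstacle is coherence: \<open>R f\<close> is determined only up to isomorphism, and checking
  the axioms of a biadjunction directly would carry the compositors of \<open>E\<close> through
  every equation. Squares confine them to the fill. Pasting is then strictly associative and unital,
  and the projection to the codomain of \<open>E\<close> preserves all compositions strictly, so
  base 2-cells can be compared by simplification.

  Local equivalence is handled one hom-category at a time, since \<open>LC\<close> and
  \<open>E\<close> are controlled through the properties of the target object.\<close>

lemma hom_iff [simp]: "f \<in> hom K x y \<longleftrightarrow> f \<in> arr K \<and> src1 K f = x \<and> trg1 K f = y"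
  by (auto simp: hom_def)

lemma cells_iff [simp]: "\<alpha> \<in> cells K f g \<longleftrightarrow> \<alpha> \<in> cell K \<and> src2 K \<alpha> = f \<and> trg2 K \<alpha> = g"
  by (auto simp: cells_def)

lemma isocells_iff [simp]: "\<alpha> \<in> isocells K f g \<longleftrightarrow>
    \<alpha> \<in> cell K \<and> src2 K \<alpha> = f \<and> trg2 K \<alpha> = g \<and> iso_cell K \<alpha>"
  by (auto simp: isocells_def)

text \<open>Only the existence of an invertible 2-cell is recorded: arguments about equivalences of
  1-cells become calculations with a congruence, and no 2-cell has to be named.\<close>

definition isom :: "('o, 'a, 'c) two_cat \<Rightarrow> 'a \<Rightarrow> 'a \<Rightarrow> bool" where
  "isom K f g \<longleftrightarrow> isocells K f g \<noteq> {}"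

section \<open>Calculus of 2-cells in a strict 2-category\<close>

context two_category
begin

lemma arr_obj [simp]:
  assumes "f \<in> arr K"
  shows "src1 K f \<in> obj K" and "trg1 K f \<in> obj K"
  using arr_src_trg[OF assms] by auto

text \<open>The locale speaks directly only of the source of a 2-cell. That its target is a parallel
  1-cell comes from the axiom \<open>src_trg\<close> of the hom-category containing it.\<close>

lemma cell_arr [simp]:
  assumes "\<alpha> \<in> cell K"
  shows "src2 K \<alpha> \<in> arr K" and "trg2 K \<alpha> \<in> arr K"
    and "src1 K (trg2 K \<alpha>) = src1 K (src2 K \<alpha>)" and "trg1 K (trg2 K \<alpha>) = trg1 K (src2 K \<alpha>)"
  using cell_src[OF assms] assms
    category.src_trg[OF hom_category[of "src1 K (src2 K \<alpha>)" "trg1 K (src2 K \<alpha>)"], of \<alpha>]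
  by (auto simp: hom_cat_def)

lemma id1_simps [simp]:
  assumes "x \<in> obj K"
  shows "id1 K x \<in> arr K" and "src1 K (id1 K x) = x" and "trg1 K (id1 K x) = x"
  using id1_hom[OF assms] by auto

lemma comp1_simps [simp]:
  assumes "f \<in> arr K" "g \<in> arr K" "trg1 K f = src1 K g"
  shows "g \<odot> f \<in> arr K" and "src1 K (g \<odot> f) = src1 K f" and "trg1 K (g \<odot> f) = trg1 K g"
  using comp1_hom[of f "src1 K f" "trg1 K f" g "trg1 K g"] assms by auto

lemma id1_comp [simp]: "f \<in> arr K \<Longrightarrow> trg1 K f = y \<Longrightarrow> id1 K y \<odot> f = f"
  and comp_id1 [simp]: "f \<in> arr K \<Longrightarrow> src1 K f = x \<Longrightarrow> f \<odot> id1 K x = f"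
  using id1_left id1_right by auto

lemma comp1_assoc' [simp]:
  assumes "f \<in> arr K" "g \<in> arr K" "h \<in> arr K" "trg1 K f = src1 K g" "trg1 K g = src1 K h"
  shows "(h \<odot> g) \<odot> f = h \<odot> (g \<odot> f)"
  using comp1_assoc[of f "src1 K f" "trg1 K f" g "trg1 K g" h "trg1 K h"] assms by auto

lemma hom_cat_category [simp]: "f \<in> arr K \<Longrightarrow> category (hom_cat K (src1 K f) (trg1 K f))"
  by (rule hom_category) auto

lemma chom_hom_cat: "\<alpha> \<in> chom (hom_cat K x y) f g \<longleftrightarrow>
    \<alpha> \<in> cell K \<and> src2 K \<alpha> = f \<and> trg2 K \<alpha> = g \<and> f \<in> arr K \<and> src1 K f = x \<and> trg1 K f = y"
  by (auto simp: chom_def hom_cat_def)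

lemma id2_simps [simp]:
  assumes "f \<in> arr K"
  shows "id2 K f \<in> cell K" and "src2 K (id2 K f) = f" and "trg2 K (id2 K f) = f"
  using category.id_hom[OF hom_cat_category[OF assms], of f] assms
  by (auto simp: hom_cat_def chom_def)

lemma vcomp_simps [simp]:
  assumes "\<alpha> \<in> cell K" "\<beta> \<in> cell K" "trg2 K \<alpha> = src2 K \<beta>"
  shows "\<beta> \<bullet> \<alpha> \<in> cell K" and "src2 K (\<beta> \<bullet> \<alpha>) = src2 K \<alpha>" and "trg2 K (\<beta> \<bullet> \<alpha>) = trg2 K \<beta>"
proof -
  have "src1 K (src2 K \<beta>) = src1 K (src2 K \<alpha>)" "trg1 K (src2 K \<beta>) = trg1 K (src2 K \<alpha>)"
    using assms cell_arr(3,4)[of \<alpha>] by auto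
  then show "\<beta> \<bullet> \<alpha> \<in> cell K" and "src2 K (\<beta> \<bullet> \<alpha>) = src2 K \<alpha>" and "trg2 K (\<beta> \<bullet> \<alpha>) = trg2 K \<beta>"
    using category.comp_hom[OF hom_cat_category[of "src2 K \<alpha>"], of \<alpha> "src2 K \<alpha>" "trg2 K \<alpha>" \<beta> "trg2 K \<beta>"]
      assms by (auto simp: hom_cat_def chom_def)
qed

lemma id2_vcomp [simp]:
  assumes "\<alpha> \<in> cell K" "trg2 K \<alpha> = f" shows "id2 K f \<bullet> \<alpha> = \<alpha>"
  using category.id_left[OF hom_cat_category[of "src2 K \<alpha>"], of \<alpha> "src2 K \<alpha>" "trg2 K \<alpha>"] assms
  by (auto simp: hom_cat_def chom_def)

lemma vcomp_id2 [simp]: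
  assumes "\<alpha> \<in> cell K" "src2 K \<alpha> = f" shows "\<alpha> \<bullet> id2 K f = \<alpha>"
  using category.id_right[OF hom_cat_category[of "src2 K \<alpha>"], of \<alpha> "src2 K \<alpha>" "trg2 K \<alpha>"] assms
  by (auto simp: hom_cat_def chom_def)

lemma vcomp_assoc [simp]:
  assumes "\<alpha> \<in> cell K" "\<beta> \<in> cell K" "\<gamma> \<in> cell K" "trg2 K \<alpha> = src2 K \<beta>" "trg2 K \<beta> = src2 K \<gamma>"
  shows "(\<gamma> \<bullet> \<beta>) \<bullet> \<alpha> = \<gamma> \<bullet> \<beta> \<bullet> \<alpha>"
proof -
  have "src1 K (src2 K \<beta>) = src1 K (src2 K \<alpha>)" "trg1 K (src2 K \<beta>) = trg1 K (src2 K \<alpha>)"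
    "src1 K (src2 K \<gamma>) = src1 K (src2 K \<beta>)" "trg1 K (src2 K \<gamma>) = trg1 K (src2 K \<beta>)"
    using assms cell_arr(3,4)[of \<alpha>] cell_arr(3,4)[of \<beta>] by auto
  then show ?thesis
    using category.assoc[OF hom_cat_category[of "src2 K \<alpha>"], of \<alpha> "src2 K \<alpha>" "trg2 K \<alpha>"
        \<beta> "trg2 K \<beta>" \<gamma> "trg2 K \<gamma>"] assms
    by (auto simp: hom_cat_def chom_def)
qed

lemma hcomp_simps [simp]:
  assumes "\<alpha> \<in> cell K" "\<beta> \<in> cell K" "trg1 K (src2 K \<alpha>) = src1 K (src2 K \<beta>)"
  shows "\<beta> \<star> \<alpha> \<in> cell K" and "src2 K (\<beta> \<star> \<alpha>) = src2 K \<beta> \<odot> src2 K \<alpha>"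
    and "trg2 K (\<beta> \<star> \<alpha>) = trg2 K \<beta> \<odot> trg2 K \<alpha>"
  using hcomp_cells[of "src2 K \<alpha>" "src1 K (src2 K \<alpha>)" "trg1 K (src2 K \<alpha>)" "src2 K \<beta>"
      "trg1 K (src2 K \<beta>)" \<alpha> "trg2 K \<alpha>" \<beta> "trg2 K \<beta>"] assms by auto

lemma hcomp_id2_id2 [simp]:
  assumes "f \<in> arr K" "g \<in> arr K" "trg1 K f = src1 K g"
  shows "id2 K g \<star> id2 K f = id2 K (g \<odot> f)"
  using hcomp_id2[of f "src1 K f" "trg1 K f" g "trg1 K g"] assms by auto

lemma interchange':
  assumes "\<alpha> \<in> cell K" "\<alpha>' \<in> cell K" "\<beta> \<in> cell K" "\<beta>' \<in> cell K"
    "trg2 K \<alpha> = src2 K \<alpha>'" "trg2 K \<beta> = src2 K \<beta>'" "trg1 K (src2 K \<alpha>) = src1 K (src2 K \<beta>)"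
  shows "(\<beta>' \<bullet> \<beta>) \<star> (\<alpha>' \<bullet> \<alpha>) = (\<beta>' \<star> \<alpha>') \<bullet> (\<beta> \<star> \<alpha>)"
  using interchange[of "src2 K \<alpha>" "src1 K (src2 K \<alpha>)" "trg1 K (src2 K \<alpha>)" "src2 K \<beta>"
      "trg1 K (src2 K \<beta>)" \<alpha> "trg2 K \<alpha>" \<alpha>' "trg2 K \<alpha>'" \<beta> "trg2 K \<beta>" \<beta>' "trg2 K \<beta>'"] assms by auto

lemma hcomp_units [simp]:
  assumes "\<alpha> \<in> cell K"
  shows "trg1 K (src2 K \<alpha>) = y \<Longrightarrow> id2 K (id1 K y) \<star> \<alpha> = \<alpha>"
    and "src1 K (src2 K \<alpha>) = x \<Longrightarrow> \<alpha> \<star> id2 K (id1 K x) = \<alpha>"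
  using hcomp_unit_left[of "src2 K \<alpha>" x y \<alpha> "trg2 K \<alpha>"] hcomp_unit_left[of "src2 K \<alpha>" "src1 K (src2 K \<alpha>)" y \<alpha> "trg2 K \<alpha>"]
    hcomp_unit_right[of "src2 K \<alpha>" x "trg1 K (src2 K \<alpha>)" \<alpha> "trg2 K \<alpha>"] assms by auto

lemma hcomp_assoc' [simp]:
  assumes "\<alpha> \<in> cell K" "\<beta> \<in> cell K" "\<gamma> \<in> cell K"
    "trg1 K (src2 K \<alpha>) = src1 K (src2 K \<beta>)" "trg1 K (src2 K \<beta>) = src1 K (src2 K \<gamma>)"
  shows "(\<gamma> \<star> \<beta>) \<star> \<alpha> = \<gamma> \<star> \<beta> \<star> \<alpha>"
  using hcomp_assoc[of "src2 K \<alpha>" "src1 K (src2 K \<alpha>)" "trg1 K (src2 K \<alpha>)" "src2 K \<beta>"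
      "trg1 K (src2 K \<beta>)" "src2 K \<gamma>" "trg1 K (src2 K \<gamma>)" \<alpha> "trg2 K \<alpha>" \<beta> "trg2 K \<beta>" \<gamma> "trg2 K \<gamma>"]
    assms by auto

text \<open>Part of the simplifier's normal form for pasting diagrams: composites are associated to
  the right, successive whiskerings are merged into one, and whiskering is distributed over vertical
  composites.\<close>

lemma whisker_fuse [simp]:
  assumes "\<alpha> \<in> cell K" "f \<in> arr K" "g \<in> arr K" "trg1 K (src2 K \<alpha>) = src1 K f" "trg1 K f = src1 K g"
  shows "id2 K g \<star> id2 K f \<star> \<alpha> = id2 K (g \<odot> f) \<star> \<alpha>"
  using hcomp_assoc'[of \<alpha> "id2 K f" "id2 K g"] assms by (simp del: hcomp_assoc')

lemma whisker_left [simp]: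
  assumes "\<alpha> \<in> cell K" "\<beta> \<in> cell K" "trg2 K \<alpha> = src2 K \<beta>" "g \<in> arr K" "src1 K g = trg1 K (src2 K \<alpha>)"
  shows "id2 K g \<star> (\<beta> \<bullet> \<alpha>) = (id2 K g \<star> \<beta>) \<bullet> (id2 K g \<star> \<alpha>)"
  using interchange'[of \<alpha> \<beta> "id2 K g" "id2 K g"] assms by simp

lemma whisker_right [simp]:
  assumes "\<alpha> \<in> cell K" "\<beta> \<in> cell K" "trg2 K \<alpha> = src2 K \<beta>" "f \<in> arr K" "trg1 K f = src1 K (src2 K \<alpha>)"
  shows "(\<beta> \<bullet> \<alpha>) \<star> id2 K f = (\<beta> \<star> id2 K f) \<bullet> (\<alpha> \<star> id2 K f)"
  using interchange'[of "id2 K f" "id2 K f" \<alpha> \<beta>] assms by simp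

lemma hcomp_split:
  assumes "\<alpha> \<in> cell K" "\<beta> \<in> cell K" "trg1 K (src2 K \<alpha>) = src1 K (src2 K \<beta>)"
    "src2 K \<beta> = g" "trg2 K \<alpha> = f"
  shows "\<beta> \<star> \<alpha> = (\<beta> \<star> id2 K f) \<bullet> (id2 K g \<star> \<alpha>)"
  using interchange'[of \<alpha> "id2 K (trg2 K \<alpha>)" "id2 K (src2 K \<beta>)" \<beta>] assms(1-3)
  unfolding assms(4,5)[symmetric] by simp

lemma hcomp_split':
  assumes "\<alpha> \<in> cell K" "\<beta> \<in> cell K" "trg1 K (src2 K \<alpha>) = src1 K (src2 K \<beta>)"
    "trg2 K \<beta> = g" "src2 K \<alpha> = f"
  shows "\<beta> \<star> \<alpha> = (id2 K g \<star> \<alpha>) \<bullet> (\<beta> \<star> id2 K f)"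
  using interchange'[of "id2 K (src2 K \<alpha>)" \<alpha> \<beta> "id2 K (trg2 K \<beta>)"] assms(1-3)
  unfolding assms(4,5)[symmetric] by simp

lemma whisker_swap:
  assumes "\<alpha> \<in> cell K" "\<beta> \<in> cell K" "trg1 K (src2 K \<alpha>) = src1 K (src2 K \<beta>)"
    "src2 K \<beta> = g" "trg2 K \<alpha> = f" "trg2 K \<beta> = g'" "src2 K \<alpha> = f'"
  shows "(\<beta> \<star> id2 K f) \<bullet> (id2 K g \<star> \<alpha>) = (id2 K g' \<star> \<alpha>) \<bullet> (\<beta> \<star> id2 K f')"
  using hcomp_split[OF assms(1-5)] hcomp_split'[OF assms(1-3,6,7)] by simp

lemma inverse_cells_unique:
  assumes "inverse_cells K \<alpha> \<beta>" "inverse_cells K \<alpha> \<gamma>" shows "\<beta> = \<gamma>"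
proof -
  have "\<beta> = (\<gamma> \<bullet> \<alpha>) \<bullet> \<beta>" using assms by (simp add: inverse_cells_def del: vcomp_assoc)
  also have "\<dots> = \<gamma> \<bullet> (\<alpha> \<bullet> \<beta>)" using assms by (intro vcomp_assoc) (auto simp: inverse_cells_def)
  also have "\<dots> = \<gamma>" using assms by (simp add: inverse_cells_def)
  finally show ?thesis .
qed

lemma vinv_inverse: "iso_cell K \<alpha> \<Longrightarrow> inverse_cells K \<alpha> (vinv K \<alpha>)"
  unfolding vinv_def iso_cell_def by (rule theI') (auto intro: inverse_cells_unique)

lemma vinv_simps [simp]:
  assumes "iso_cell K \<alpha>"
  shows "vinv K \<alpha> \<in> cell K" and "src2 K (vinv K \<alpha>) = trg2 K \<alpha>" and "trg2 K (vinv K \<alpha>) = src2 K \<alpha>"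
    and "vinv K \<alpha> \<bullet> \<alpha> = id2 K (src2 K \<alpha>)" and "\<alpha> \<bullet> vinv K \<alpha> = id2 K (trg2 K \<alpha>)"
    and "iso_cell K (vinv K \<alpha>)"
  using vinv_inverse[OF assms] assms by (auto simp: inverse_cells_def iso_cell_def)

lemma iso_cell_cell: "iso_cell K \<alpha> \<Longrightarrow> \<alpha> \<in> cell K"
  by (auto simp: iso_cell_def inverse_cells_def)

lemma iso_cellI:
  assumes "\<alpha> \<in> cell K" "\<beta> \<in> cell K" "src2 K \<beta> = trg2 K \<alpha>" "trg2 K \<beta> = src2 K \<alpha>"
    "\<beta> \<bullet> \<alpha> = id2 K (src2 K \<alpha>)" "\<alpha> \<bullet> \<beta> = id2 K (trg2 K \<alpha>)"
  shows "iso_cell K \<alpha>" "vinv K \<alpha> = \<beta>"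
proof -
  have i: "inverse_cells K \<alpha> \<beta>" using assms by (auto simp: inverse_cells_def)
  then show "iso_cell K \<alpha>" by (auto simp: iso_cell_def)
  then show "vinv K \<alpha> = \<beta>" using i inverse_cells_unique vinv_inverse by blast
qed

lemma vinv_cancel [simp]:
  assumes "iso_cell K \<alpha>" "\<beta> \<in> cell K"
  shows "trg2 K \<beta> = src2 K \<alpha> \<Longrightarrow> vinv K \<alpha> \<bullet> \<alpha> \<bullet> \<beta> = \<beta>"
    and "trg2 K \<beta> = trg2 K \<alpha> \<Longrightarrow> \<alpha> \<bullet> vinv K \<alpha> \<bullet> \<beta> = \<beta>"
proof -
  note c = iso_cell_cell[OF assms(1)]
  show "vinv K \<alpha> \<bullet> \<alpha> \<bullet> \<beta> = \<beta>" if "trg2 K \<beta> = src2 K \<alpha>"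
    by (subst vcomp_assoc[symmetric]) (use c assms that in \<open>simp_all del: vcomp_assoc\<close>)
  show "\<alpha> \<bullet> vinv K \<alpha> \<bullet> \<beta> = \<beta>" if "trg2 K \<beta> = trg2 K \<alpha>"
    by (subst vcomp_assoc[symmetric]) (use c assms that in \<open>simp_all del: vcomp_assoc\<close>)
qed

lemma iso_id2 [simp]: "f \<in> arr K \<Longrightarrow> iso_cell K (id2 K f)"
  by (rule iso_cellI(1)[of _ "id2 K f"]) auto

lemma vinv_id2 [simp]: "f \<in> arr K \<Longrightarrow> vinv K (id2 K f) = id2 K f"
  by (rule iso_cellI(2)) auto

lemma iso_vcomp [simp]:
  assumes "iso_cell K \<alpha>" "iso_cell K \<beta>" "trg2 K \<alpha> = src2 K \<beta>"
  shows "iso_cell K (\<beta> \<bullet> \<alpha>)"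
  using assms by (intro iso_cellI(1)[of _ "vinv K \<alpha> \<bullet> vinv K \<beta>"]) (auto simp: iso_cell_cell)

lemma hcomp_inverse:
  assumes "iso_cell K \<alpha>" "iso_cell K \<beta>" "trg1 K (src2 K \<alpha>) = src1 K (src2 K \<beta>)"
  shows "iso_cell K (\<beta> \<star> \<alpha>)" "vinv K (\<beta> \<star> \<alpha>) = vinv K \<beta> \<star> vinv K \<alpha>"
  using assms interchange'[of \<alpha> "vinv K \<alpha>" \<beta> "vinv K \<beta>"] interchange'[of "vinv K \<alpha>" \<alpha> "vinv K \<beta>" \<beta>]
  by (intro iso_cellI[of _ "vinv K \<beta> \<star> vinv K \<alpha>"]; simp add: iso_cell_cell)+

lemma iso_hcomp [simp]:
  "iso_cell K \<alpha> \<Longrightarrow> iso_cell K \<beta> \<Longrightarrow> trg1 K (src2 K \<alpha>) = src1 K (src2 K \<beta>) \<Longrightarrow> iso_cell K (\<beta> \<star> \<alpha>)"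
  by (rule hcomp_inverse)

lemma vcomp_cancel_left:
  assumes "iso_cell K \<gamma>" "\<alpha> \<in> cell K" "\<beta> \<in> cell K" "trg2 K \<alpha> = src2 K \<gamma>" "trg2 K \<beta> = src2 K \<gamma>"
    "\<gamma> \<bullet> \<alpha> = \<gamma> \<bullet> \<beta>"
  shows "\<alpha> = \<beta>"
  using vinv_cancel(1)[OF assms(1,2)] vinv_cancel(1)[OF assms(1,3)] assms by metis

lemma vcomp_cancel_right:
  assumes "iso_cell K \<gamma>" "\<alpha> \<in> cell K" "\<beta> \<in> cell K" "src2 K \<alpha> = trg2 K \<gamma>" "src2 K \<beta> = trg2 K \<gamma>"
    "\<alpha> \<bullet> \<gamma> = \<beta> \<bullet> \<gamma>"
  shows "\<alpha> = \<beta>"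
proof -
  have "(\<alpha> \<bullet> \<gamma>) \<bullet> vinv K \<gamma> = (\<beta> \<bullet> \<gamma>) \<bullet> vinv K \<gamma>" using assms by simp
  then show ?thesis using assms(1-5) by (simp add: iso_cell_cell)
qed

section \<open>Isomorphic 1-cells, equivalences, and whiskering with equivalences\<close>

lemma isomI: "iso_cell K \<alpha> \<Longrightarrow> src2 K \<alpha> = f \<Longrightarrow> trg2 K \<alpha> = g \<Longrightarrow> isom K f g"
  using iso_cell_cell[of \<alpha>] isocells_iff[of \<alpha> K f g] unfolding isom_def by blast

lemma isomE:
  assumes "isom K f g"
  obtains \<alpha> where "\<alpha> \<in> cell K" "iso_cell K \<alpha>" "src2 K \<alpha> = f" "trg2 K \<alpha> = g"
proof -
  obtain \<alpha> where \<alpha>: "\<alpha> \<in> isocells K f g" using assms unfolding isom_def by blast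
  show thesis by (rule that[of \<alpha>]) (use \<alpha> in auto)
qed

lemma isom_arr:
  assumes "isom K f g"
  shows "f \<in> arr K" "g \<in> arr K" "src1 K f = src1 K g" "trg1 K f = trg1 K g"
  using assms by (auto elim!: isomE)

lemma isom_refl: "f \<in> arr K \<Longrightarrow> isom K f f"
  by (rule isomI[of "id2 K f"]) auto

lemma isom_sym: "isom K f g \<Longrightarrow> isom K g f"
  by (metis isomE isomI vinv_simps(2,3,6))

lemma isom_trans [trans]: "isom K f g \<Longrightarrow> isom K g h \<Longrightarrow> isom K f h"
  by (smt (verit) isomE isomI iso_vcomp vcomp_simps(2,3))

lemma isom_comp1:
  assumes "isom K f f'" "isom K g g'" "trg1 K f = src1 K g"
  shows "isom K (g \<odot> f) (g' \<odot> f')"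
proof -
  obtain \<alpha> \<beta> where "\<alpha> \<in> cell K" "iso_cell K \<alpha>" "src2 K \<alpha> = f" "trg2 K \<alpha> = f'"
    "\<beta> \<in> cell K" "iso_cell K \<beta>" "src2 K \<beta> = g" "trg2 K \<beta> = g'"
    using assms by (auto elim!: isomE)
  then show ?thesis using assms(3) by (intro isomI[of "\<beta> \<star> \<alpha>"]) auto
qed

lemma isom_left: "isom K f f' \<Longrightarrow> g \<in> arr K \<Longrightarrow> trg1 K f = src1 K g \<Longrightarrow> isom K (g \<odot> f) (g \<odot> f')"
  by (rule isom_comp1) (auto intro: isom_refl)

lemma isom_right: "isom K g g' \<Longrightarrow> f \<in> arr K \<Longrightarrow> trg1 K f = src1 K g \<Longrightarrow> isom K (g \<odot> f) (g' \<odot> f)"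
  by (rule isom_comp1) (auto intro: isom_refl)

lemma equivalenceI:
  assumes "f \<in> arr K" "g \<in> arr K" "src1 K g = trg1 K f" "trg1 K g = src1 K f"
    "isom K (g \<odot> f) (id1 K (src1 K f))" "isom K (f \<odot> g) (id1 K (trg1 K f))"
  shows "equivalence_1cell K f"
  unfolding equivalence_1cell_def isom_def[symmetric]
  using assms isom_sym[OF assms(5)] by (intro conjI bexI[of _ g]) auto

lemma equivalenceE:
  assumes "equivalence_1cell K f"
  obtains g where "f \<in> arr K" "g \<in> arr K" "src1 K g = trg1 K f" "trg1 K g = src1 K f"
    "isom K (g \<odot> f) (id1 K (src1 K f))" "isom K (f \<odot> g) (id1 K (trg1 K f))" "equivalence_1cell K g"
proof -
  obtain g where "f \<in> arr K" "g \<in> hom K (trg1 K f) (src1 K f)"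
    "isom K (id1 K (src1 K f)) (g \<odot> f)" "isom K (f \<odot> g) (id1 K (trg1 K f))"
    using assms unfolding equivalence_1cell_def isom_def[symmetric] by blast
  then have g: "f \<in> arr K" "g \<in> arr K" "src1 K g = trg1 K f" "trg1 K g = src1 K f"
    "isom K (g \<odot> f) (id1 K (src1 K f))" "isom K (f \<odot> g) (id1 K (trg1 K f))"
    using isom_sym by auto
  then have "equivalence_1cell K g" by (intro equivalenceI[of g f]) auto
  then show thesis by (rule that[OF g])
qed

text \<open>\<open>g\<close> and \<open>h\<close> are both isomorphic to
  \<open>g \<odot> f \<odot> h\<close>, hence to each other, so \<open>g\<close> is a two-sided
  pseudoinverse.\<close>

lemma equivalence_two_sided:
  assumes f: "f \<in> arr K" and g: "g \<in> arr K" "src1 K g = trg1 K f" "trg1 K g = src1 K f"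
    "isom K (g \<odot> f) (id1 K (src1 K f))"
    and h: "h \<in> arr K" "src1 K h = trg1 K f" "trg1 K h = src1 K f" "isom K (f \<odot> h) (id1 K (trg1 K f))"
  shows "equivalence_1cell K f"
proof -
  have "isom K (g \<odot> f \<odot> h) g" using isom_left[OF h(4), of g] f g h by simp
  moreover have "isom K (g \<odot> f \<odot> h) h" using isom_right[OF g(4), of h] f g h by simp
  ultimately have "isom K g h" using isom_sym[of "g \<odot> f \<odot> h" g] isom_trans[of g "g \<odot> f \<odot> h" h] by simp
  then have "isom K (f \<odot> g) (f \<odot> h)" by (rule isom_left) (use f g in auto)
  then have "isom K (f \<odot> g) (id1 K (trg1 K f))" using isom_trans[OF _ h(4)] by simp
  then show ?thesis using f g by (intro equivalenceI[of f g]) auto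
qed

lemma equivalence_isom:
  assumes "equivalence_1cell K f" "isom K f g" shows "equivalence_1cell K g"
proof -
  note fg = isom_arr[OF assms(2)]
  obtain h where h: "f \<in> arr K" "h \<in> arr K" "src1 K h = trg1 K f" "trg1 K h = src1 K f"
    "isom K (h \<odot> f) (id1 K (src1 K f))" "isom K (f \<odot> h) (id1 K (trg1 K f))"
    "equivalence_1cell K h"
    by (rule equivalenceE[OF assms(1)])
  have "isom K (h \<odot> g) (h \<odot> f)"
    using h fg isom_left[OF isom_sym[OF assms(2)], of h] by auto
  from isom_trans[OF this h(5)] have 1: "isom K (h \<odot> g) (id1 K (src1 K g))" using fg by simp
  have "isom K (g \<odot> h) (f \<odot> h)"
    using h fg isom_right[OF isom_sym[OF assms(2)], of h] by auto
  from isom_trans[OF this h(6)] have 2: "isom K (g \<odot> h) (id1 K (trg1 K g))" using fg by simp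
  show ?thesis using h fg 1 2 by (intro equivalenceI[of g h]) auto
qed

lemma equivalence_comp1:
  assumes "equivalence_1cell K f" "equivalence_1cell K g" "trg1 K f = src1 K g"
  shows "equivalence_1cell K (g \<odot> f)"
proof -
  obtain f' where f: "f \<in> arr K" "f' \<in> arr K" "src1 K f' = trg1 K f" "trg1 K f' = src1 K f"
    "isom K (f' \<odot> f) (id1 K (src1 K f))" "isom K (f \<odot> f') (id1 K (trg1 K f))"
    "equivalence_1cell K f'"
    by (rule equivalenceE[OF assms(1)])
  obtain g' where g: "g \<in> arr K" "g' \<in> arr K" "src1 K g' = trg1 K g" "trg1 K g' = src1 K g"
    "isom K (g' \<odot> g) (id1 K (src1 K g))" "isom K (g \<odot> g') (id1 K (trg1 K g))"
    "equivalence_1cell K g'"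
    by (rule equivalenceE[OF assms(2)])
  have "isom K (g' \<odot> g \<odot> f) f" using isom_right[OF g(5), of f] f g assms(3) by simp
  then have "isom K (f' \<odot> g' \<odot> g \<odot> f) (f' \<odot> f)"
    by (rule isom_left) (use f g assms(3) in auto)
  note 1 = isom_trans[OF this f(5)]
  have "isom K (f \<odot> f' \<odot> g') g'" using isom_right[OF f(6), of g'] f g assms(3) by simp
  then have "isom K (g \<odot> f \<odot> f' \<odot> g') (g \<odot> g')"
    by (rule isom_left) (use f g assms(3) in auto)
  note 2 = isom_trans[OF this g(6)]
  show ?thesis by (rule equivalenceI[of _ "f' \<odot> g'"]) (use f g assms(3) 1 2 in auto)
qed

text \<open>If \<open>g'\<close> is pseudoinverse to \<open>g\<close>, then \<open>f\<close> is
  isomorphic to the equivalence \<open>g' \<odot> g \<odot> f\<close>. With the next lemma and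
  closure under composition this gives two out of three.\<close>

lemma equivalence_cancel_left:
  assumes gf: "equivalence_1cell K (g \<odot> f)" and g: "equivalence_1cell K g"
    and f: "f \<in> arr K" "trg1 K f = src1 K g"
  shows "equivalence_1cell K f"
proof -
  obtain g' where g: "g \<in> arr K" "g' \<in> arr K" "src1 K g' = trg1 K g" "trg1 K g' = src1 K g"
    "isom K (g' \<odot> g) (id1 K (src1 K g))" "isom K (g \<odot> g') (id1 K (trg1 K g))"
    "equivalence_1cell K g'"
    by (rule equivalenceE[OF g])
  have "isom K (g' \<odot> g \<odot> f) f" using isom_right[OF g(5), of f] f g by simp
  moreover have "equivalence_1cell K (g' \<odot> g \<odot> f)" using equivalence_comp1[OF gf g(7)] f g by simp
  ultimately show ?thesis by (rule equivalence_isom[rotated])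
qed

lemma equivalence_cancel_right:
  assumes gf: "equivalence_1cell K (g \<odot> f)" and f: "equivalence_1cell K f"
    and g: "g \<in> arr K" "trg1 K f = src1 K g"
  shows "equivalence_1cell K g"
proof -
  obtain f' where f: "f \<in> arr K" "f' \<in> arr K" "src1 K f' = trg1 K f" "trg1 K f' = src1 K f"
    "isom K (f' \<odot> f) (id1 K (src1 K f))" "isom K (f \<odot> f') (id1 K (trg1 K f))"
    "equivalence_1cell K f'"
    by (rule equivalenceE[OF f])
  have "isom K (g \<odot> f \<odot> f') g" using isom_left[OF f(6), of g] f g by simp
  moreover have "equivalence_1cell K (g \<odot> f \<odot> f')" using equivalence_comp1[OF f(7) gf] f g by simp
  ultimately show ?thesis by (rule equivalence_isom[rotated])
qed

lemma equivalence_id1: "x \<in> obj K \<Longrightarrow> equivalence_1cell K (id1 K x)"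
  by (rule equivalenceI[of _ "id1 K x"]) (auto intro: isom_refl)

text \<open>Naturality of an isomorphism \<open>\<theta> : k \<odot> e \<Rightarrow> id\<close>
  recovers \<open>\<alpha>\<close> from its whiskering with \<open>k \<odot> e\<close>, hence from
  its whiskering with \<open>e\<close>.\<close>

lemma equivalence_whisker_left_inj:
  assumes e: "equivalence_1cell K e" and "\<alpha> \<in> cell K" "\<beta> \<in> cell K"
    "src2 K \<beta> = src2 K \<alpha>" "trg2 K \<beta> = trg2 K \<alpha>" "trg1 K (src2 K \<alpha>) = src1 K e"
    "id2 K e \<star> \<alpha> = id2 K e \<star> \<beta>"
  shows "\<alpha> = \<beta>"
proof -
  obtain k where k: "e \<in> arr K" "k \<in> arr K" "src1 K k = trg1 K e" "trg1 K k = src1 K e"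
    "isom K (k \<odot> e) (id1 K (src1 K e))" "isom K (e \<odot> k) (id1 K (trg1 K e))"
    "equivalence_1cell K k"
    by (rule equivalenceE[OF e])
  obtain \<theta> where \<theta>: "\<theta> \<in> cell K" "iso_cell K \<theta>" "src2 K \<theta> = k \<odot> e" "trg2 K \<theta> = id1 K (src1 K e)"
    by (rule isomE[OF k(5)]) blast
  have nat: "(\<theta> \<star> id2 K (trg2 K \<gamma>)) \<bullet> (id2 K (k \<odot> e) \<star> \<gamma>) = \<gamma> \<bullet> (\<theta> \<star> id2 K (src2 K \<gamma>))"
    if "\<gamma> \<in> cell K" "trg1 K (src2 K \<gamma>) = src1 K e" for \<gamma>
    using whisker_swap[of \<gamma> \<theta> "k \<odot> e"  "trg2 K \<gamma>" "id1 K (src1 K e)" "src2 K \<gamma>"] that \<theta> k by simp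
  have "id2 K (k \<odot> e) \<star> \<alpha> = id2 K (k \<odot> e) \<star> \<beta>"
    using arg_cong[OF assms(7), of "\<lambda>\<gamma>. id2 K k \<star> \<gamma>"] assms(1-6) k by simp
  then have "\<alpha> \<bullet> (\<theta> \<star> id2 K (src2 K \<alpha>)) = \<beta> \<bullet> (\<theta> \<star> id2 K (src2 K \<alpha>))"
    using nat[of \<alpha>] nat[of \<beta>] assms by simp
  then show ?thesis
    by (rule vcomp_cancel_right[rotated -1]) (use \<theta> k assms in auto)
qed

lemma equivalence_whisker_left_surj:
  assumes e: "equivalence_1cell K e" and "\<gamma> \<in> cell K" "src2 K \<gamma> = e \<odot> f" "trg2 K \<gamma> = e \<odot> g"
    "f \<in> arr K" "g \<in> arr K" "trg1 K f = src1 K e" "trg1 K g = src1 K e"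
  obtains \<alpha> where "\<alpha> \<in> cell K" "src2 K \<alpha> = f" "trg2 K \<alpha> = g" "id2 K e \<star> \<alpha> = \<gamma>"
proof -
  obtain k where k: "e \<in> arr K" "k \<in> arr K" "src1 K k = trg1 K e" "trg1 K k = src1 K e"
    "isom K (k \<odot> e) (id1 K (src1 K e))" "isom K (e \<odot> k) (id1 K (trg1 K e))"
    "equivalence_1cell K k"
    by (rule equivalenceE[OF e])
  obtain \<theta> where \<theta>: "\<theta> \<in> cell K" "iso_cell K \<theta>" "src2 K \<theta> = k \<odot> e" "trg2 K \<theta> = id1 K (src1 K e)"
    by (rule isomE[OF k(5)]) blast
  have "src1 K f = src1 K g"
    using assms(2-8) k(1) cell_arr[of \<gamma>] by simp
  \<comment> \<open>The only candidate: naturality of \<open>\<theta>\<close> forces this formula as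
    soon as \<open>id2 K e \<star> \<alpha> = \<gamma>\<close>.\<close>
  define \<alpha> where "\<alpha> = (\<theta> \<star> id2 K g) \<bullet> (id2 K k \<star> \<gamma>) \<bullet> vinv K (\<theta> \<star> id2 K f)"
  have \<alpha>: "\<alpha> \<in> cell K" "src2 K \<alpha> = f" "trg2 K \<alpha> = g"
    using assms k \<theta> by (auto simp: \<alpha>_def)
  have "\<alpha> \<bullet> (\<theta> \<star> id2 K f) = (\<theta> \<star> id2 K g) \<bullet> (id2 K k \<star> \<gamma>)"
    using assms k \<theta> by (simp add: \<alpha>_def)
  moreover have "(\<theta> \<star> id2 K g) \<bullet> (id2 K (k \<odot> e) \<star> \<alpha>) = \<alpha> \<bullet> (\<theta> \<star> id2 K f)"
    using whisker_swap[of \<alpha> \<theta> "k \<odot> e" g "id1 K (src1 K e)" f] \<alpha> \<theta> k assms by simp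
  ultimately have "(\<theta> \<star> id2 K g) \<bullet> (id2 K k \<star> id2 K e \<star> \<alpha>) = (\<theta> \<star> id2 K g) \<bullet> (id2 K k \<star> \<gamma>)"
    using \<alpha> k assms by simp
  then have "id2 K k \<star> id2 K e \<star> \<alpha> = id2 K k \<star> \<gamma>"
    by (rule vcomp_cancel_left[rotated -1]) (use \<theta> k assms \<alpha> in auto)
  \<comment> \<open>The chosen isomorphisms need not satisfy the triangle identities. Cancelling
    \<open>k\<close>, itself an equivalence, by the injectivity lemma takes their place.\<close>
  then have "id2 K e \<star> \<alpha> = \<gamma>"
    by (rule equivalence_whisker_left_inj[OF k(7), rotated -1]) (use \<alpha> k assms in auto)
  with \<alpha> show thesis by (rule that[of \<alpha>])
qed

text \<open>The mirror image of the left-hand argument, with an isomorphism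
  \<open>e \<odot> k \<Rightarrow> id\<close> whiskered from the other side.\<close>

lemma equivalence_whisker_right_inj:
  assumes e: "equivalence_1cell K e" and "\<alpha> \<in> cell K" "\<beta> \<in> cell K"
    "src2 K \<beta> = src2 K \<alpha>" "trg2 K \<beta> = trg2 K \<alpha>" "src1 K (src2 K \<alpha>) = trg1 K e"
    "\<alpha> \<star> id2 K e = \<beta> \<star> id2 K e"
  shows "\<alpha> = \<beta>"
proof -
  obtain k where k: "e \<in> arr K" "k \<in> arr K" "src1 K k = trg1 K e" "trg1 K k = src1 K e"
    "isom K (k \<odot> e) (id1 K (src1 K e))" "isom K (e \<odot> k) (id1 K (trg1 K e))"
    "equivalence_1cell K k"
    by (rule equivalenceE[OF e])
  obtain \<theta> where \<theta>: "\<theta> \<in> cell K" "iso_cell K \<theta>" "src2 K \<theta> = e \<odot> k" "trg2 K \<theta> = id1 K (trg1 K e)"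
    by (rule isomE[OF k(6)]) blast
  have nat: "(id2 K (trg2 K \<gamma>) \<star> \<theta>) \<bullet> (\<gamma> \<star> id2 K (e \<odot> k)) = \<gamma> \<bullet> (id2 K (src2 K \<gamma>) \<star> \<theta>)"
    if "\<gamma> \<in> cell K" "src1 K (src2 K \<gamma>) = trg1 K e" for \<gamma>
    using whisker_swap[of \<theta> \<gamma> "src2 K \<gamma>" "id1 K (trg1 K e)" "trg2 K \<gamma>" "e \<odot> k"] that \<theta> k by simp
  have "\<alpha> \<star> id2 K (e \<odot> k) = \<beta> \<star> id2 K (e \<odot> k)"
    using arg_cong[OF assms(7), of "\<lambda>\<gamma>. \<gamma> \<star> id2 K k"] assms(1-6) k by simp
  then have "\<alpha> \<bullet> (id2 K (src2 K \<alpha>) \<star> \<theta>) = \<beta> \<bullet> (id2 K (src2 K \<alpha>) \<star> \<theta>)"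
    using nat[of \<alpha>] nat[of \<beta>] assms by simp
  then show ?thesis
    by (rule vcomp_cancel_right[rotated -1]) (use \<theta> k assms in auto)
qed

lemma equivalence_whisker_right_surj:
  assumes e: "equivalence_1cell K e" and "\<gamma> \<in> cell K" "src2 K \<gamma> = f \<odot> e" "trg2 K \<gamma> = g \<odot> e"
    "f \<in> arr K" "g \<in> arr K" "src1 K f = trg1 K e" "src1 K g = trg1 K e"
  obtains \<alpha> where "\<alpha> \<in> cell K" "src2 K \<alpha> = f" "trg2 K \<alpha> = g" "\<alpha> \<star> id2 K e = \<gamma>"
proof -
  obtain k where k: "e \<in> arr K" "k \<in> arr K" "src1 K k = trg1 K e" "trg1 K k = src1 K e"
    "isom K (k \<odot> e) (id1 K (src1 K e))" "isom K (e \<odot> k) (id1 K (trg1 K e))"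
    "equivalence_1cell K k"
    by (rule equivalenceE[OF e])
  obtain \<theta> where \<theta>: "\<theta> \<in> cell K" "iso_cell K \<theta>" "src2 K \<theta> = e \<odot> k" "trg2 K \<theta> = id1 K (trg1 K e)"
    by (rule isomE[OF k(6)]) blast
  have "trg1 K f = trg1 K g"
    using assms(2-8) k(1) cell_arr[of \<gamma>] by simp
  define \<alpha> where "\<alpha> = (id2 K g \<star> \<theta>) \<bullet> (\<gamma> \<star> id2 K k) \<bullet> vinv K (id2 K f \<star> \<theta>)"
  have \<alpha>: "\<alpha> \<in> cell K" "src2 K \<alpha> = f" "trg2 K \<alpha> = g"
    using assms k \<theta> by (auto simp: \<alpha>_def)
  have "\<alpha> \<bullet> (id2 K f \<star> \<theta>) = (id2 K g \<star> \<theta>) \<bullet> (\<gamma> \<star> id2 K k)"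
    using assms k \<theta> by (simp add: \<alpha>_def)
  moreover have "(id2 K g \<star> \<theta>) \<bullet> (\<alpha> \<star> id2 K (e \<odot> k)) = \<alpha> \<bullet> (id2 K f \<star> \<theta>)"
    using whisker_swap[of \<theta> \<alpha> f "id1 K (trg1 K e)" g "e \<odot> k"] \<alpha> \<theta> k assms by simp
  ultimately have "(id2 K g \<star> \<theta>) \<bullet> ((\<alpha> \<star> id2 K e) \<star> id2 K k) = (id2 K g \<star> \<theta>) \<bullet> (\<gamma> \<star> id2 K k)"
    using \<alpha> k assms by simp
  then have "(\<alpha> \<star> id2 K e) \<star> id2 K k = \<gamma> \<star> id2 K k"
    by (rule vcomp_cancel_left[rotated -1]) (use \<theta> k assms \<alpha> in auto)
  then have "\<alpha> \<star> id2 K e = \<gamma>"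
    by (rule equivalence_whisker_right_inj[OF k(7), rotated -1]) (use \<alpha> k assms in auto)
  with \<alpha> show thesis by (rule that[of \<alpha>])
qed

end

section \<open>Squares over a pseudofunctor\<close>

locale psf = K: two_category K + M: two_category M + pseudofunctor K M F
  for K :: "('o, 'a, 'c) two_cat" (structure) and M :: "('p, 'b, 'd) two_cat"
    and F :: "('o, 'a, 'c, 'p, 'b, 'd) psfun"
begin

abbreviation comp1_M (infixr \<open>\<odot>\<^sub>M\<close> 70) where "g \<odot>\<^sub>M f \<equiv> comp1 M g f"
abbreviation vcomp_M (infixr \<open>\<bullet>\<^sub>M\<close> 55) where "\<beta> \<bullet>\<^sub>M \<alpha> \<equiv> vcomp M \<beta> \<alpha>"
abbreviation hcomp_M (infixr \<open>\<star>\<^sub>M\<close> 65) where "\<beta> \<star>\<^sub>M \<alpha> \<equiv> hcomp M \<beta> \<alpha>"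

declare f0_obj [simp]

lemma f1_simps [simp]:
  assumes "f \<in> arr K"
  shows "f1 F f \<in> arr M" "src1 M (f1 F f) = f0 F (src1 K f)" "trg1 M (f1 F f) = f0 F (trg1 K f)"
  using cfunctor.obj[OF local_functor[of "src1 K f" "trg1 K f"], of f] assms
  by (auto simp: hom_cat_def)

lemma local: "f \<in> arr K \<Longrightarrow> cfunctor (hom_cat K (src1 K f) (trg1 K f))
    (hom_cat M (f0 F (src1 K f)) (f0 F (trg1 K f))) (f1 F) (f2 F)"
  by (rule local_functor) auto

lemma f2_simps [simp]:
  assumes "\<alpha> \<in> cell K"
  shows "f2 F \<alpha> \<in> cell M" "src2 M (f2 F \<alpha>) = f1 F (src2 K \<alpha>)" "trg2 M (f2 F \<alpha>) = f1 F (trg2 K \<alpha>)"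
  using cfunctor.arr[OF local[of "src2 K \<alpha>"], of \<alpha> "src2 K \<alpha>" "trg2 K \<alpha>"] assms
  by (auto simp: K.chom_hom_cat M.chom_hom_cat)

lemma f2_id2 [simp]: "f \<in> arr K \<Longrightarrow> f2 F (id2 K f) = id2 M (f1 F f)"
  using cfunctor.ident[OF local, of f f] by (auto simp: hom_cat_def)

lemma f2_vcomp [simp]:
  assumes "\<alpha> \<in> cell K" "\<beta> \<in> cell K" "trg2 K \<alpha> = src2 K \<beta>"
  shows "f2 F (\<beta> \<bullet> \<alpha>) = f2 F \<beta> \<bullet>\<^sub>M f2 F \<alpha>"
proof -
  have "src1 K (src2 K \<beta>) = src1 K (src2 K \<alpha>)" "trg1 K (src2 K \<beta>) = trg1 K (src2 K \<alpha>)"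
    using K.cell_arr(3,4)[OF assms(1)] assms(3) by auto
  then show ?thesis
    using cfunctor.comp[OF local[of "src2 K \<alpha>"], of \<alpha> "src2 K \<alpha>" "src2 K \<beta>" \<beta> "trg2 K \<beta>"] assms
    unfolding K.chom_hom_cat by (simp add: hom_cat_def)
qed

lemma iso_f2 [simp]: "iso_cell K \<alpha> \<Longrightarrow> iso_cell M (f2 F \<alpha>)"
  and vinv_f2: "iso_cell K \<alpha> \<Longrightarrow> vinv M (f2 F \<alpha>) = f2 F (vinv K \<alpha>)"
  by (rule M.iso_cellI[of _ "f2 F (vinv K \<alpha>)"];
      simp add: K.iso_cell_cell f2_vcomp[symmetric] del: f2_vcomp)+

lemma f1_isom: "isom K f g \<Longrightarrow> isom M (f1 F f) (f1 F g)"
  by (metis K.iso_cell_cell K.isomE M.isomI iso_f2 f2_simps(2,3))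

lemma fc_simps [simp]:
  assumes "f \<in> arr K" "g \<in> arr K" "trg1 K f = src1 K g"
  shows "fc F g f \<in> cell M" "src2 M (fc F g f) = f1 F g \<odot>\<^sub>M f1 F f"
    "trg2 M (fc F g f) = f1 F (g \<odot> f)" "iso_cell M (fc F g f)"
  using fc_iso[of f "src1 K f" "trg1 K f" g "trg1 K g"] assms by auto

lemma fu_simps [simp]:
  assumes "x \<in> obj K"
  shows "fu F x \<in> cell M" "src2 M (fu F x) = id1 M (f0 F x)"
    "trg2 M (fu F x) = f1 F (id1 K x)" "iso_cell M (fu F x)"
  using fu_iso[of x] assms by auto

lemma f1_comp_isom:
  "f \<in> arr K \<Longrightarrow> g \<in> arr K \<Longrightarrow> trg1 K f = src1 K g \<Longrightarrow> isom M (f1 F g \<odot>\<^sub>M f1 F f) (f1 F (g \<odot> f))"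
  by (rule M.isomI[of "fc F g f"]) auto

lemma f1_id_isom: "x \<in> obj K \<Longrightarrow> isom M (f1 F (id1 K x)) (id1 M (f0 F x))"
  by (rule M.isom_sym, rule M.isomI[of "fu F x"]) auto

lemma fc_nat:
  assumes "\<alpha> \<in> cell K" "\<beta> \<in> cell K" "trg1 K (src2 K \<alpha>) = src1 K (src2 K \<beta>)"
    "src2 K \<alpha> = f" "trg2 K \<alpha> = f'" "src2 K \<beta> = g" "trg2 K \<beta> = g'"
  shows "f2 F (\<beta> \<star> \<alpha>) \<bullet>\<^sub>M fc F g f = fc F g' f' \<bullet>\<^sub>M (f2 F \<beta> \<star>\<^sub>M f2 F \<alpha>)"
  using fc_natural[of f "src1 K f" "trg1 K f" g "trg1 K g" \<alpha> f' \<beta> g'] assms K.cell_arr by auto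

lemma fc_assoc':
  assumes "f \<in> arr K" "g \<in> arr K" "h \<in> arr K" "trg1 K f = src1 K g" "trg1 K g = src1 K h"
  shows "fc F (h \<odot> g) f \<bullet>\<^sub>M (fc F h g \<star>\<^sub>M id2 M (f1 F f)) = fc F h (g \<odot> f) \<bullet>\<^sub>M (id2 M (f1 F h) \<star>\<^sub>M fc F g f)"
  using fc_assoc[of f "src1 K f" "trg1 K f" g "trg1 K g" h "trg1 K h"] assms by auto

lemma fc_fu [simp]:
  assumes "f \<in> arr K"
  shows "src1 K f = x \<Longrightarrow> fc F f (id1 K x) \<bullet>\<^sub>M (id2 M (f1 F f) \<star>\<^sub>M fu F x) = id2 M (f1 F f)"
    and "trg1 K f = y \<Longrightarrow> fc F (id1 K y) f \<bullet>\<^sub>M (fu F y \<star>\<^sub>M id2 M (f1 F f)) = id2 M (f1 F f)"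
  using fu_right[of f] fu_left[of f] assms by auto

end

text \<open>
  The square \<open>(p, q, u, f, \<sigma>)\<close> stands for the 2-cell \<open>\<sigma> : f \<odot> p \<Rightarrow> q \<odot> F u\<close>: squares are the
  1-cells of the pseudo comma 2-category of \<open>F\<close> over its codomain, and \<open>over\<close> describes its 2-cells.
\<close>

record ('a, 'b, 'd) square =
  dm :: 'b
  cd :: 'b
  bt :: 'a
  tp :: 'b
  fill :: 'd

section \<open>The pseudo comma 2-category: pasting, units and 2-cells\<close>

context psf
begin

definition square :: "('a, 'b, 'd) square \<Rightarrow> bool" where
  "square S \<longleftrightarrow> dm S \<in> arr M \<and> cd S \<in> arr M \<and> bt S \<in> arr K \<and> tp S \<in> arr M \<and>
     src1 M (dm S) = f0 F (src1 K (bt S)) \<and> src1 M (cd S) = f0 F (trg1 K (bt S)) \<and>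
     trg1 M (dm S) = src1 M (tp S) \<and> trg1 M (cd S) = trg1 M (tp S) \<and>
     iso_cell M (fill S) \<and> src2 M (fill S) = tp S \<odot>\<^sub>M dm S \<and> trg2 M (fill S) = cd S \<odot>\<^sub>M f1 F (bt S)"

lemma squareD:
  assumes "square S"
  shows "dm S \<in> arr M" "cd S \<in> arr M" "bt S \<in> arr K" "tp S \<in> arr M"
     "src1 M (dm S) = f0 F (src1 K (bt S))" "src1 M (cd S) = f0 F (trg1 K (bt S))"
     "trg1 M (dm S) = src1 M (tp S)" "trg1 M (cd S) = trg1 M (tp S)"
     "iso_cell M (fill S)" "fill S \<in> cell M"
     "src2 M (fill S) = tp S \<odot>\<^sub>M dm S" "trg2 M (fill S) = cd S \<odot>\<^sub>M f1 F (bt S)"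
  using assms M.iso_cell_cell unfolding square_def by blast+

text \<open>Only the fill sees the compositor of \<open>F\<close>. Bottoms and tops compose
  strictly, so both projections of the comma 2-category are strict.\<close>

definition paste :: "('a, 'b, 'd) square \<Rightarrow> ('a, 'b, 'd) square \<Rightarrow> ('a, 'b, 'd) square"
  (infixr \<open>\<box>\<close> 70) where
  "T \<box> S = \<lparr> dm = dm S, cd = cd T, bt = bt T \<odot> bt S, tp = tp T \<odot>\<^sub>M tp S,
     fill = (id2 M (cd T) \<star>\<^sub>M fc F (bt T) (bt S)) \<bullet>\<^sub>M (fill T \<star>\<^sub>M id2 M (f1 F (bt S))) \<bullet>\<^sub>M
            (id2 M (tp T) \<star>\<^sub>M fill S) \<rparr>"

definition unit_square :: "'b \<Rightarrow> 'o \<Rightarrow> ('a, 'b, 'd) square" where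
  "unit_square p x = \<lparr> dm = p, cd = p, bt = id1 K x, tp = id1 M (trg1 M p),
     fill = id2 M p \<star>\<^sub>M fu F x \<rparr>"

definition over :: "('a, 'b, 'd) square \<Rightarrow> ('a, 'b, 'd) square \<Rightarrow> 'c \<Rightarrow> 'd \<Rightarrow> bool" where
  "over S T \<mu> \<alpha> \<longleftrightarrow> square S \<and> square T \<and> dm S = dm T \<and> cd S = cd T \<and>
     \<mu> \<in> cells K (bt S) (bt T) \<and> \<alpha> \<in> cells M (tp S) (tp T) \<and>
     (id2 M (cd S) \<star>\<^sub>M f2 F \<mu>) \<bullet>\<^sub>M fill S = fill T \<bullet>\<^sub>M (\<alpha> \<star>\<^sub>M id2 M (dm S))"

lemma overD:
  assumes "over S T \<mu> \<alpha>"
  shows "square S" "square T" "dm T = dm S" "cd T = cd S"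
    "\<mu> \<in> cell K" "src2 K \<mu> = bt S" "trg2 K \<mu> = bt T"
    "\<alpha> \<in> cell M" "src2 M \<alpha> = tp S" "trg2 M \<alpha> = tp T"
    "(id2 M (cd S) \<star>\<^sub>M f2 F \<mu>) \<bullet>\<^sub>M fill S = fill T \<bullet>\<^sub>M (\<alpha> \<star>\<^sub>M id2 M (dm S))"
    "src1 K (bt T) = src1 K (bt S)" "trg1 K (bt T) = trg1 K (bt S)"
    "src1 M (tp T) = src1 M (tp S)" "trg1 M (tp T) = trg1 M (tp S)"
  using assms K.cell_arr(3,4)[of \<mu>] M.cell_arr(3,4)[of \<alpha>] unfolding over_def by auto

lemma paste_simps [simp]:
  "dm (T \<box> S) = dm S" "cd (T \<box> S) = cd T" "bt (T \<box> S) = bt T \<odot> bt S" "tp (T \<box> S) = tp T \<odot>\<^sub>M tp S"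
  by (auto simp: paste_def)

lemma unit_square_simps [simp]:
  "dm (unit_square p x) = p" "cd (unit_square p x) = p" "bt (unit_square p x) = id1 K x"
  "tp (unit_square p x) = id1 M (trg1 M p)"
  by (auto simp: unit_square_def)

definition composable :: "('a, 'b, 'd) square \<Rightarrow> ('a, 'b, 'd) square \<Rightarrow> bool" where
  "composable T S \<longleftrightarrow> square S \<and> square T \<and> dm T = cd S \<and> src1 K (bt T) = trg1 K (bt S)"

lemma composableD:
  assumes "composable T S"
  shows "square S" "square T" "dm T = cd S" "src1 K (bt T) = trg1 K (bt S)" "src1 M (tp T) = trg1 M (tp S)"
  using assms squareD(7)[of T] squareD(8)[of S] unfolding composable_def by auto

lemma square_paste [simp]:
  assumes "composable T S" shows "square (T \<box> S)"
  using composableD[OF assms] squareD[of S] squareD[of T]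
  unfolding square_def[of "T \<box> S"] by (simp add: paste_def)

lemma square_unit [simp]:
  "p \<in> arr M \<Longrightarrow> x \<in> obj K \<Longrightarrow> src1 M p = f0 F x \<Longrightarrow> square (unit_square p x)"
  unfolding square_def by (simp add: unit_square_def)

text \<open>Associativity is an equality because both 2-categories are strict and the two ways of
  merging three bottoms agree by \<open>fc_assoc\<close>, once the fill of \<open>U\<close> has been
  slid past the compositor of the other two bottoms.\<close>

lemma paste_assoc:
  assumes "composable T S" "composable U T"
  shows "(U \<box> T) \<box> S = U \<box> (T \<box> S)"
proof -
  note [simp] = composableD[OF assms(1)] composableD[OF assms(2)]
  note S [simp] = squareD[of S, simplified] and T [simp] = squareD[of T, simplified] and U [simp] = squareD[of U, simplified]
  define s w v u where "s = cd U" and "w = bt U" and "v = bt T" and "u = bt S"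
  note d = s_def w_def v_def u_def
  let ?X = "(id2 M (tp U) \<star>\<^sub>M fill T \<star>\<^sub>M id2 M (f1 F u)) \<bullet>\<^sub>M (id2 M (tp U \<odot>\<^sub>M tp T) \<star>\<^sub>M fill S)"
  have a: "(id2 M s \<star>\<^sub>M fc F (w \<odot> v) u) \<bullet>\<^sub>M (id2 M s \<star>\<^sub>M fc F w v \<star>\<^sub>M id2 M (f1 F u)) =
    (id2 M s \<star>\<^sub>M fc F w (v \<odot> u)) \<bullet>\<^sub>M (id2 M (s \<odot>\<^sub>M f1 F w) \<star>\<^sub>M fc F v u)"
    using arg_cong[OF fc_assoc'[of u v w], of "\<lambda>\<alpha>. id2 M s \<star>\<^sub>M \<alpha>"] unfolding d by simp
  have b: "(fill U \<star>\<^sub>M id2 M (f1 F (v \<odot> u))) \<bullet>\<^sub>M (id2 M (tp U \<odot>\<^sub>M dm U) \<star>\<^sub>M fc F v u) =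
    (id2 M (s \<odot>\<^sub>M f1 F w) \<star>\<^sub>M fc F v u) \<bullet>\<^sub>M (fill U \<star>\<^sub>M id2 M (f1 F v \<odot>\<^sub>M f1 F u))"
    unfolding d by (rule M.whisker_swap) auto
  have "fill ((U \<box> T) \<box> S) = ((id2 M s \<star>\<^sub>M fc F (w \<odot> v) u) \<bullet>\<^sub>M (id2 M s \<star>\<^sub>M fc F w v \<star>\<^sub>M id2 M (f1 F u)))
      \<bullet>\<^sub>M (fill U \<star>\<^sub>M id2 M (f1 F v \<odot>\<^sub>M f1 F u)) \<bullet>\<^sub>M ?X"
    by (simp add: paste_def d)
  also have "\<dots> = (id2 M s \<star>\<^sub>M fc F w (v \<odot> u)) \<bullet>\<^sub>M
      ((id2 M (s \<odot>\<^sub>M f1 F w) \<star>\<^sub>M fc F v u) \<bullet>\<^sub>M (fill U \<star>\<^sub>M id2 M (f1 F v \<odot>\<^sub>M f1 F u))) \<bullet>\<^sub>M ?X"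
    unfolding a by (simp add: d)
  also have "\<dots> = fill (U \<box> (T \<box> S))"
    unfolding b[symmetric] by (simp add: paste_def d)
  finally have "fill ((U \<box> T) \<box> S) = fill (U \<box> (T \<box> S))" .
  then show ?thesis by (simp add: paste_def)
qed

lemma over_id: "square S \<Longrightarrow> over S S (id2 K (bt S)) (id2 M (tp S))"
  unfolding over_def using squareD[of S] by simp

lemma over_vcomp:
  assumes 1: "over S T \<mu> \<alpha>" and 2: "over T U \<nu> \<beta>"
  shows "over S U (\<nu> \<bullet> \<mu>) (\<beta> \<bullet>\<^sub>M \<alpha>)"
proof -
  note [simp] = overD(1-10,12-)[OF 1] overD(1-10,12-)[OF 2] squareD[OF overD(1)[OF 1]]
     squareD[OF overD(2)[OF 1], simplified] squareD[OF overD(2)[OF 2], simplified]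
  note e1 = overD(11)[OF 1] and e2 = overD(11)[OF 2]
  have "(id2 M (cd S) \<star>\<^sub>M f2 F (\<nu> \<bullet> \<mu>)) \<bullet>\<^sub>M fill S
      = (id2 M (cd S) \<star>\<^sub>M f2 F \<nu>) \<bullet>\<^sub>M ((id2 M (cd S) \<star>\<^sub>M f2 F \<mu>) \<bullet>\<^sub>M fill S)"
    by simp
  also have "\<dots> = ((id2 M (cd S) \<star>\<^sub>M f2 F \<nu>) \<bullet>\<^sub>M fill T) \<bullet>\<^sub>M (\<alpha> \<star>\<^sub>M id2 M (dm S))"
    unfolding e1 by simp
  also have "\<dots> = fill U \<bullet>\<^sub>M ((\<beta> \<bullet>\<^sub>M \<alpha>) \<star>\<^sub>M id2 M (dm S))"
    using e2 by simp
  finally show ?thesis unfolding over_def by simp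
qed

text \<open>Horizontal composition in the comma 2-category. It rests on naturality of the compositor
  of \<open>F\<close> and on interchange in \<open>M\<close>.\<close>

lemma over_hcomp:
  assumes 1: "over S T \<mu> \<alpha>" and 2: "over S' T' \<mu>' \<alpha>'" and c: "composable S' S"
  shows "over (S' \<box> S) (T' \<box> T) (\<mu>' \<star> \<mu>) (\<alpha>' \<star>\<^sub>M \<alpha>)"
proof -
  note [simp] = overD(1-10,12-)[OF 1] overD(1-10,12-)[OF 2] composableD[OF c]
    squareD[OF overD(1)[OF 1], simplified] squareD[OF overD(1)[OF 2], simplified]
    squareD[OF overD(2)[OF 1], simplified] squareD[OF overD(2)[OF 2], simplified]
  note e1 = overD(11)[OF 1] and e2 = overD(11)[OF 2]
  have [simp]: "composable T' T" using c unfolding composable_def by simp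
  define s u' t u where "s = cd S'" and "u' = bt S'" and "t = bt T" and "u = bt S"
  note d = s_def u'_def t_def u_def
  have a: "(id2 M s \<star>\<^sub>M f2 F (\<mu>' \<star> \<mu>)) \<bullet>\<^sub>M (id2 M s \<star>\<^sub>M fc F u' u) =
    (id2 M s \<star>\<^sub>M fc F (bt T') t) \<bullet>\<^sub>M ((id2 M s \<star>\<^sub>M f2 F \<mu>') \<star>\<^sub>M id2 M (f1 F t)) \<bullet>\<^sub>M
    (id2 M (s \<odot>\<^sub>M f1 F u') \<star>\<^sub>M f2 F \<mu>)"
    using arg_cong[OF fc_nat[of \<mu> \<mu>' u t u' "bt T'"], of "\<lambda>\<alpha>. id2 M s \<star>\<^sub>M \<alpha>"]
      M.hcomp_split[of "f2 F \<mu>" "f2 F \<mu>'" "f1 F u'" "f1 F t"]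
    unfolding d by simp
  have b: "(id2 M (s \<odot>\<^sub>M f1 F u') \<star>\<^sub>M f2 F \<mu>) \<bullet>\<^sub>M (fill S' \<star>\<^sub>M id2 M (f1 F u)) =
     (fill S' \<star>\<^sub>M id2 M (f1 F t)) \<bullet>\<^sub>M (id2 M (tp S' \<odot>\<^sub>M cd S) \<star>\<^sub>M f2 F \<mu>)"
    unfolding d by (rule M.whisker_swap[symmetric]) auto
  have e: "(id2 M (tp S') \<star>\<^sub>M id2 M (cd S) \<star>\<^sub>M f2 F \<mu>) \<bullet>\<^sub>M (id2 M (tp S') \<star>\<^sub>M fill S) =
    (id2 M (tp S') \<star>\<^sub>M fill T) \<bullet>\<^sub>M (id2 M (tp S') \<star>\<^sub>M \<alpha> \<star>\<^sub>M id2 M (dm S))"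
    using arg_cong[OF e1, of "\<lambda>\<alpha>. id2 M (tp S') \<star>\<^sub>M \<alpha>"] by simp
  have e': "((id2 M s \<star>\<^sub>M f2 F \<mu>') \<star>\<^sub>M id2 M (f1 F t)) \<bullet>\<^sub>M (fill S' \<star>\<^sub>M id2 M (f1 F t)) =
    (fill T' \<star>\<^sub>M id2 M (f1 F t)) \<bullet>\<^sub>M (\<alpha>' \<star>\<^sub>M id2 M (cd S \<odot>\<^sub>M f1 F t))"
    using arg_cong[OF e2, of "\<lambda>\<alpha>. \<alpha> \<star>\<^sub>M id2 M (f1 F t)"] unfolding d by simp
  have g: "(\<alpha>' \<star>\<^sub>M id2 M (cd S \<odot>\<^sub>M f1 F t)) \<bullet>\<^sub>M (id2 M (tp S') \<star>\<^sub>M fill T) =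
    (id2 M (tp T') \<star>\<^sub>M fill T) \<bullet>\<^sub>M (\<alpha>' \<star>\<^sub>M id2 M (tp T \<odot>\<^sub>M dm S))"
    unfolding d by (rule M.whisker_swap) auto
  have h: "(\<alpha>' \<star>\<^sub>M \<alpha>) \<star>\<^sub>M id2 M (dm S) =
    (\<alpha>' \<star>\<^sub>M id2 M (tp T \<odot>\<^sub>M dm S)) \<bullet>\<^sub>M (id2 M (tp S') \<star>\<^sub>M \<alpha> \<star>\<^sub>M id2 M (dm S))"
    using M.hcomp_split[of \<alpha> \<alpha>' "tp S'" "tp T"] by simp
  \<comment> \<open>Working from the left, (a) moves \<open>f2 F\<close> across the compositor and
    (b) past the fill of \<open>S'\<close>; (e) and (e') apply the two hypotheses, and (g) and (h)
    reassemble the right-hand side.\<close>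
  have "(id2 M s \<star>\<^sub>M f2 F (\<mu>' \<star> \<mu>)) \<bullet>\<^sub>M fill (S' \<box> S) =
    ((id2 M s \<star>\<^sub>M f2 F (\<mu>' \<star> \<mu>)) \<bullet>\<^sub>M (id2 M s \<star>\<^sub>M fc F u' u)) \<bullet>\<^sub>M
    (fill S' \<star>\<^sub>M id2 M (f1 F u)) \<bullet>\<^sub>M (id2 M (tp S') \<star>\<^sub>M fill S)"
    by (simp add: paste_def d)
  also have "\<dots> = (id2 M s \<star>\<^sub>M fc F (bt T') t) \<bullet>\<^sub>M ((id2 M s \<star>\<^sub>M f2 F \<mu>') \<star>\<^sub>M id2 M (f1 F t)) \<bullet>\<^sub>M
    ((id2 M (s \<odot>\<^sub>M f1 F u') \<star>\<^sub>M f2 F \<mu>) \<bullet>\<^sub>M (fill S' \<star>\<^sub>M id2 M (f1 F u))) \<bullet>\<^sub>M (id2 M (tp S') \<star>\<^sub>M fill S)"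
    unfolding a by (simp add: d)
  also have "\<dots> = (id2 M s \<star>\<^sub>M fc F (bt T') t) \<bullet>\<^sub>M
    (((id2 M s \<star>\<^sub>M f2 F \<mu>') \<star>\<^sub>M id2 M (f1 F t)) \<bullet>\<^sub>M (fill S' \<star>\<^sub>M id2 M (f1 F t))) \<bullet>\<^sub>M
    ((id2 M (tp S') \<star>\<^sub>M id2 M (cd S) \<star>\<^sub>M f2 F \<mu>) \<bullet>\<^sub>M (id2 M (tp S') \<star>\<^sub>M fill S))"
    unfolding b by (simp add: d)
  also have "\<dots> = (id2 M s \<star>\<^sub>M fc F (bt T') t) \<bullet>\<^sub>M (fill T' \<star>\<^sub>M id2 M (f1 F t)) \<bullet>\<^sub>M
    ((\<alpha>' \<star>\<^sub>M id2 M (cd S \<odot>\<^sub>M f1 F t)) \<bullet>\<^sub>M (id2 M (tp S') \<star>\<^sub>M fill T)) \<bullet>\<^sub>M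
    (id2 M (tp S') \<star>\<^sub>M \<alpha> \<star>\<^sub>M id2 M (dm S))"
    unfolding e e' by (simp add: d)
  also have "\<dots> = fill (T' \<box> T) \<bullet>\<^sub>M ((\<alpha>' \<star>\<^sub>M \<alpha>) \<star>\<^sub>M id2 M (dm S))"
    unfolding g h by (simp add: paste_def d)
  finally show ?thesis unfolding over_def by (simp add: c d)
qed

lemma over_vinv:
  assumes 1: "over S T \<mu> \<alpha>" and i: "iso_cell K \<mu>" "iso_cell M \<alpha>"
  shows "over T S (vinv K \<mu>) (vinv M \<alpha>)"
proof -
  note [simp] = overD(1-10,12-)[OF 1] i
    squareD[OF overD(1)[OF 1], simplified] squareD[OF overD(2)[OF 1], simplified]
  let ?a = "id2 M (cd S) \<star>\<^sub>M f2 F \<mu>" and ?b = "\<alpha> \<star>\<^sub>M id2 M (dm S)"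
  let ?a' = "id2 M (cd S) \<star>\<^sub>M f2 F (vinv K \<mu>)" and ?b' = "vinv M \<alpha> \<star>\<^sub>M id2 M (dm S)"
  have "?a' \<bullet>\<^sub>M ?a = id2 M (cd S \<odot>\<^sub>M f1 F (bt S))"
    by (subst M.whisker_left[symmetric], simp_all del: M.whisker_left f2_vcomp add: f2_vcomp[symmetric])
  moreover have "?b \<bullet>\<^sub>M ?b' = id2 M (tp T \<odot>\<^sub>M dm S)"
    by (subst M.whisker_right[symmetric], simp_all del: M.whisker_right)
  moreover have "?a' \<bullet>\<^sub>M (?a \<bullet>\<^sub>M fill S) \<bullet>\<^sub>M ?b' = ?a' \<bullet>\<^sub>M fill T \<bullet>\<^sub>M (?b \<bullet>\<^sub>M ?b')"
    unfolding overD(11)[OF 1] by simp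
  moreover have "?a' \<bullet>\<^sub>M (?a \<bullet>\<^sub>M fill S) \<bullet>\<^sub>M ?b' = (?a' \<bullet>\<^sub>M ?a) \<bullet>\<^sub>M fill S \<bullet>\<^sub>M ?b'" by simp
  ultimately have "fill S \<bullet>\<^sub>M ?b' = ?a' \<bullet>\<^sub>M fill T" by simp
  then show ?thesis unfolding over_def by simp
qed

text \<open>The two unit coherences of \<open>F\<close> are what makes \<open>unit_square\<close> a
  strict unit for pasting.\<close>

lemma paste_unit:
  assumes "square S"
  shows "src1 K (bt S) = x \<Longrightarrow> S \<box> unit_square (dm S) x = S"
    and "trg1 K (bt S) = y \<Longrightarrow> unit_square (cd S) y \<box> S = S"
proof -
  note [simp] = squareD[OF assms]
  show "S \<box> unit_square (dm S) x = S" if x [simp]: "src1 K (bt S) = x"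
  proof -
    have [simp]: "x \<in> obj K" using K.arr_obj(1)[of "bt S"] by simp
    \<comment> \<open>Sliding the fill past the unitor places the unitor next to the compositor,
      where \<open>fc_fu\<close> cancels both.\<close>
    have "(fill S \<star>\<^sub>M id2 M (f1 F (id1 K x))) \<bullet>\<^sub>M (id2 M (tp S \<odot>\<^sub>M dm S) \<star>\<^sub>M fu F x) =
        (id2 M (cd S \<odot>\<^sub>M f1 F (bt S)) \<star>\<^sub>M fu F x) \<bullet>\<^sub>M (fill S \<star>\<^sub>M id2 M (id1 M (f0 F x)))"
      by (rule M.whisker_swap) (use x in auto)
    then have "fill (S \<box> unit_square (dm S) x) = (id2 M (cd S) \<star>\<^sub>M
        (fc F (bt S) (id1 K x) \<bullet>\<^sub>M (id2 M (f1 F (bt S)) \<star>\<^sub>M fu F x))) \<bullet>\<^sub>M fill S"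
      by (simp add: paste_def unit_square_def del: fc_fu flip: x)
    also have "\<dots> = fill S" by simp
    finally show ?thesis by (simp add: paste_def)
  qed
  show "unit_square (cd S) y \<box> S = S" if y [simp]: "trg1 K (bt S) = y"
  proof -
    have [simp]: "y \<in> obj K" using K.arr_obj(2)[of "bt S"] by simp
    have "fill (unit_square (cd S) y \<box> S) = (id2 M (cd S) \<star>\<^sub>M
        (fc F (id1 K y) (bt S) \<bullet>\<^sub>M (fu F y \<star>\<^sub>M id2 M (f1 F (bt S))))) \<bullet>\<^sub>M fill S"
      by (simp add: paste_def unit_square_def del: fc_fu)
    also have "\<dots> = fill S" by simp
    finally show ?thesis by (simp add: paste_def)
  qed
qed

end

section \<open>Right biadjoints from biuniversal arrows\<close>

text \<open>Full faithfulness and essential surjectivity on a single hom-category. Unlike a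
  quasi-inverse functor, this form can be composed, cancelled and transported without
  choices.\<close>

definition local_equiv_at ::
  "('o, 'a, 'c) two_cat \<Rightarrow> ('p, 'b, 'd) two_cat \<Rightarrow> ('o, 'a, 'c, 'p, 'b, 'd) psfun \<Rightarrow> 'o \<Rightarrow> 'o \<Rightarrow> bool" where
  "local_equiv_at K M F x y \<longleftrightarrow>
     (\<forall>f \<in> hom K x y. \<forall>g \<in> hom K x y.
        bij_betw (f2 F) (cells K f g) (cells M (f1 F f) (f1 F g))) \<and>
     (\<forall>g \<in> hom M (f0 F x) (f0 F y). \<exists>f \<in> hom K x y. isom M (f1 F f) g)"

text \<open>The last three assumptions say that \<open>u \<mapsto> e b \<odot> F u\<close> is an
  equivalence from the hom-category \<open>K(x, r0 b)\<close> to \<open>M(F x, b)\<close>: the value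
  at \<open>b\<close> of a right biadjoint, given pointwise and without coherence.\<close>

locale biuniversal = psf K M F
  for K :: "('o, 'a, 'c) two_cat" (structure) and M :: "('p, 'b, 'd) two_cat"
    and F :: "('o, 'a, 'c, 'p, 'b, 'd) psfun" +
  fixes r0 :: "'p \<Rightarrow> 'o" and e :: "'p \<Rightarrow> 'b"
  assumes r0_obj [simp]: "b \<in> obj M \<Longrightarrow> r0 b \<in> obj K"
    and e_simps [simp]: "b \<in> obj M \<Longrightarrow> e b \<in> arr M" "b \<in> obj M \<Longrightarrow> src1 M (e b) = f0 F (r0 b)"
      "b \<in> obj M \<Longrightarrow> trg1 M (e b) = b"
    and ess_surj: "x \<in> obj K \<Longrightarrow> p \<in> arr M \<Longrightarrow> src1 M p = f0 F x \<Longrightarrow> trg1 M p = b \<Longrightarrow>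
      \<exists>u \<in> hom K x (r0 b). isom M p (e b \<odot>\<^sub>M f1 F u)"
    and full: "u \<in> hom K x (r0 b) \<Longrightarrow> v \<in> hom K x (r0 b) \<Longrightarrow> b \<in> obj M \<Longrightarrow>
      \<gamma> \<in> cells M (e b \<odot>\<^sub>M f1 F u) (e b \<odot>\<^sub>M f1 F v) \<Longrightarrow>
      \<exists>\<mu> \<in> cells K u v. id2 M (e b) \<star>\<^sub>M f2 F \<mu> = \<gamma>"
    and faithful: "u \<in> hom K x (r0 b) \<Longrightarrow> v \<in> hom K x (r0 b) \<Longrightarrow> b \<in> obj M \<Longrightarrow>
      \<mu> \<in> cells K u v \<Longrightarrow> \<nu> \<in> cells K u v \<Longrightarrow>
      id2 M (e b) \<star>\<^sub>M f2 F \<mu> = id2 M (e b) \<star>\<^sub>M f2 F \<nu> \<Longrightarrow> \<mu> = \<nu>"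
begin

definition into :: "('a, 'b, 'd) square \<Rightarrow> 'p \<Rightarrow> bool" where
  "into S b \<longleftrightarrow> square S \<and> b \<in> obj M \<and> cd S = e b \<and> trg1 K (bt S) = r0 b"

lemma intoD:
  assumes "into S b"
  shows "square S" "b \<in> obj M" "cd S = e b" "trg1 K (bt S) = r0 b" "trg1 M (tp S) = b"
  using assms squareD(8)[of S] unfolding into_def by auto

text \<open>The fill of \<open>S\<close> is invertible and can be cancelled, which leaves
  \<open>faithful\<close>. The premise \<open>\<alpha> = \<beta>\<close> is kept separate so that a
  coherence equation follows by naming two lifts and leaving the equality in \<open>M\<close> to the
  simplifier.\<close>

lemma over_unique:
  assumes 1: "over S T \<mu> \<alpha>" and 2: "over S T \<nu> \<beta>" and "\<alpha> = \<beta>" and S: "into S b"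
  shows "\<mu> = \<nu>"
proof -
  note [simp] = overD(1-10,12-)[OF 1] overD(5-7)[OF 2] squareD[OF overD(1)[OF 1], simplified]
    squareD[OF overD(2)[OF 1], simplified] intoD[OF S]
  have "(id2 M (cd S) \<star>\<^sub>M f2 F \<mu>) \<bullet>\<^sub>M fill S = (id2 M (cd S) \<star>\<^sub>M f2 F \<nu>) \<bullet>\<^sub>M fill S"
    using overD(11)[OF 1] overD(11)[OF 2] assms(3) by simp
  then have "id2 M (cd S) \<star>\<^sub>M f2 F \<mu> = id2 M (cd S) \<star>\<^sub>M f2 F \<nu>"
    by (rule M.vcomp_cancel_right[rotated -1]) auto
  then show ?thesis
    by (intro faithful[of "bt S" "src1 K (bt S)" b "bt T" \<mu> \<nu>]) auto
qed

text \<open>Since the fill of \<open>S\<close> is invertible, the equation of \<open>over\<close>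
  prescribes \<open>id2 M (e b) \<star> f2 F \<mu>\<close>, and fullness provides such a
  \<open>\<mu>\<close>.\<close>

lemma over_exists:
  assumes S: "into S b" and T: "square T" and "dm T = dm S" "cd T = cd S"
    "src1 K (bt T) = src1 K (bt S)" "trg1 K (bt T) = trg1 K (bt S)"
    and \<alpha>: "\<alpha> \<in> cell M" "src2 M \<alpha> = tp S" "trg2 M \<alpha> = tp T"
  shows "\<exists>\<mu>. over S T \<mu> \<alpha>"
proof -
  note [simp] = intoD[OF S] squareD[OF intoD(1)[OF S], simplified] assms(3-) squareD[OF T, simplified]
  have "\<exists>\<mu> \<in> cells K (bt S) (bt T). id2 M (e b) \<star>\<^sub>M f2 F \<mu> =
      fill T \<bullet>\<^sub>M (\<alpha> \<star>\<^sub>M id2 M (dm S)) \<bullet>\<^sub>M vinv M (fill S)"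
    by (rule full) auto
  then obtain \<mu> where \<mu>: "\<mu> \<in> cells K (bt S) (bt T)"
    "id2 M (e b) \<star>\<^sub>M f2 F \<mu> = fill T \<bullet>\<^sub>M (\<alpha> \<star>\<^sub>M id2 M (dm S)) \<bullet>\<^sub>M vinv M (fill S)"
    by blast
  then have "over S T \<mu> \<alpha>" unfolding over_def using T by simp
  then show ?thesis ..
qed

section \<open>Lifts into biuniversal arrows and the choice of squares\<close>

definition lift :: "('a, 'b, 'd) square \<Rightarrow> ('a, 'b, 'd) square \<Rightarrow> 'd \<Rightarrow> 'c" where
  "lift S T \<alpha> = (SOME \<mu>. over S T \<mu> \<alpha>)"

lemma over_lift:
  assumes "into S b" "square T" "dm T = dm S" "cd T = cd S"
    "src1 K (bt T) = src1 K (bt S)" "trg1 K (bt T) = trg1 K (bt S)"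
    "\<alpha> \<in> cell M" "src2 M \<alpha> = tp S" "trg2 M \<alpha> = tp T"
  shows "over S T (lift S T \<alpha>) \<alpha>"
  unfolding lift_def by (rule someI_ex, rule over_exists[OF assms])

text \<open>The inverse of \<open>\<alpha>\<close> lifts too, and the two composites of lifts lie
  over identities, hence are identities by uniqueness.\<close>

lemma over_iso:
  assumes 1: "over S T \<mu> \<alpha>" and S: "into S b" and i: "iso_cell M \<alpha>"
  shows "iso_cell K \<mu>"
proof -
  note [simp] = overD(1-10,12-)[OF 1] intoD[OF S] i
  have T: "into T b" unfolding into_def by simp
  have 2: "over T S (lift T S (vinv M \<alpha>)) (vinv M \<alpha>)"
    by (rule over_lift[OF T]) auto
  note [simp] = overD(5-7)[OF 2]
  show ?thesis
  proof (rule K.iso_cellI)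
    show "lift T S (vinv M \<alpha>) \<bullet> \<mu> = id2 K (src2 K \<mu>)"
      using over_unique[OF over_vcomp[OF 1 2] over_id[of S] _ S] by simp
    show "\<mu> \<bullet> lift T S (vinv M \<alpha>) = id2 K (trg2 K \<mu>)"
      using over_unique[OF over_vcomp[OF 2 1] over_id[of T] _ T] by simp
  qed auto
qed

text \<open>\<open>ess_surj\<close> is applied to the composite of \<open>p\<close> and
  \<open>f\<close>; its factorisation through the biuniversal arrow supplies both the bottom and the
  fill.\<close>

lemma square_exists:
  assumes "x \<in> obj K" "p \<in> arr M" "f \<in> arr M" "src1 M p = f0 F x" "src1 M f = trg1 M p"
  shows "\<exists>S. square S \<and> dm S = p \<and> cd S = e (trg1 M f) \<and> tp S = f \<and> src1 K (bt S) = x \<and>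
    trg1 K (bt S) = r0 (trg1 M f)"
proof -
  obtain u where u: "u \<in> hom K x (r0 (trg1 M f))" "isom M (f \<odot>\<^sub>M p) (e (trg1 M f) \<odot>\<^sub>M f1 F u)"
    using ess_surj[of x "f \<odot>\<^sub>M p" "trg1 M f"] assms by auto
  obtain \<sigma> where "\<sigma> \<in> cell M" "iso_cell M \<sigma>" "src2 M \<sigma> = f \<odot>\<^sub>M p" "trg2 M \<sigma> = e (trg1 M f) \<odot>\<^sub>M f1 F u"
    using u(2) by (rule M.isomE)
  with u assms show ?thesis
    by (intro exI[of _ "\<lparr> dm = p, cd = e (trg1 M f), bt = u, tp = f, fill = \<sigma> \<rparr>"]) (simp add: square_def)
qed

text \<open>A lift of \<open>f\<close> to the comma 2-category, between the biuniversal arrows of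
  its endpoints. The bottom will be \<open>R f\<close>, and the fill the naturality 2-cell of the
  counit at \<open>f\<close>.\<close>

definition R_square :: "'b \<Rightarrow> ('a, 'b, 'd) square" where
  "R_square f = (SOME S. square S \<and> dm S = e (src1 M f) \<and> cd S = e (trg1 M f) \<and> tp S = f \<and>
     src1 K (bt S) = r0 (src1 M f) \<and> trg1 K (bt S) = r0 (trg1 M f))"

lemma R_square [simp]:
  assumes "f \<in> arr M"
  shows "square (R_square f)" "dm (R_square f) = e (src1 M f)" "cd (R_square f) = e (trg1 M f)" "tp (R_square f) = f"
    "src1 K (bt (R_square f)) = r0 (src1 M f)" "trg1 K (bt (R_square f)) = r0 (trg1 M f)"
  using someI_ex[OF square_exists[of "r0 (src1 M f)" "e (src1 M f)" f]] assms
  unfolding R_square_def by auto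

text \<open>The bottom will be the unit at \<open>x\<close>. The fill compares the identity of
  \<open>F x\<close> with the counit after \<open>F\<close> of the unit, so it will be the
  modification \<open>s\<close> of the biadjunction.\<close>

definition eta_square :: "'o \<Rightarrow> ('a, 'b, 'd) square" where
  "eta_square x = (SOME S. square S \<and> dm S = id1 M (f0 F x) \<and> cd S = e (f0 F x) \<and> tp S = id1 M (f0 F x) \<and>
     src1 K (bt S) = x \<and> trg1 K (bt S) = r0 (f0 F x))"

lemma eta_square [simp]:
  assumes "x \<in> obj K"
  shows "square (eta_square x)" "dm (eta_square x) = id1 M (f0 F x)" "cd (eta_square x) = e (f0 F x)"
    "tp (eta_square x) = id1 M (f0 F x)" "src1 K (bt (eta_square x)) = x" "trg1 K (bt (eta_square x)) = r0 (f0 F x)"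
  using someI_ex[OF square_exists[of x "id1 M (f0 F x)" "id1 M (f0 F x)"]] assms
  unfolding eta_square_def by auto

text \<open>The action on 1-cells of the pseudofunctor from \<open>K\<close> to the comma 2-category
  that sends \<open>x\<close> to the identity of \<open>F x\<close>. It lies over \<open>F\<close>
  and is the identity on bottoms.\<close>

definition id_square :: "'a \<Rightarrow> ('a, 'b, 'd) square" where
  "id_square u = \<lparr> dm = id1 M (f0 F (src1 K u)), cd = id1 M (f0 F (trg1 K u)), bt = u, tp = f1 F u,
     fill = id2 M (f1 F u) \<rparr>"

lemma id_square_sel [simp]:
  "dm (id_square u) = id1 M (f0 F (src1 K u))" "cd (id_square u) = id1 M (f0 F (trg1 K u))" "bt (id_square u) = u"
  "tp (id_square u) = f1 F u" "fill (id_square u) = id2 M (f1 F u)"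
  by (auto simp: id_square_def)

lemma square_id_square [simp]: "u \<in> arr K \<Longrightarrow> square (id_square u)"
  unfolding square_def by simp

text \<open>A 1-cell of the comma 2-category from the identity of \<open>F (r0 b)\<close> to
  \<open>e b\<close> with identity bottom. The triangle for \<open>R\<close> reduces the unit at
  \<open>r0 b\<close> followed by \<open>R (e b)\<close> to it.\<close>

definition counit_square :: "'p \<Rightarrow> ('a, 'b, 'd) square" where
  "counit_square b = \<lparr> dm = id1 M (f0 F (r0 b)), cd = e b, bt = id1 K (r0 b), tp = e b,
     fill = id2 M (e b) \<star>\<^sub>M fu F (r0 b) \<rparr>"

lemma counit_square_sel [simp]:
  "dm (counit_square b) = id1 M (f0 F (r0 b))" "cd (counit_square b) = e b" "bt (counit_square b) = id1 K (r0 b)" "tp (counit_square b) = e b"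
  "fill (counit_square b) = id2 M (e b) \<star>\<^sub>M fu F (r0 b)"
  by (auto simp: counit_square_def)

lemma square_counit_square [simp]: "b \<in> obj M \<Longrightarrow> square (counit_square b)"
  unfolding square_def by simp

lemma fill_simps [simp]:
  "f \<in> arr M \<Longrightarrow> fill (R_square f) \<in> cell M" "f \<in> arr M \<Longrightarrow> iso_cell M (fill (R_square f))"
  "f \<in> arr M \<Longrightarrow> src2 M (fill (R_square f)) = f \<odot>\<^sub>M e (src1 M f)"
  "f \<in> arr M \<Longrightarrow> trg2 M (fill (R_square f)) = e (trg1 M f) \<odot>\<^sub>M f1 F (bt (R_square f))"
  "x \<in> obj K \<Longrightarrow> fill (eta_square x) \<in> cell M" "x \<in> obj K \<Longrightarrow> iso_cell M (fill (eta_square x))"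
  "x \<in> obj K \<Longrightarrow> src2 M (fill (eta_square x)) = id1 M (f0 F x)"
  "x \<in> obj K \<Longrightarrow> trg2 M (fill (eta_square x)) = e (f0 F x) \<odot>\<^sub>M f1 F (bt (eta_square x))"
  "f \<in> arr M \<Longrightarrow> bt (R_square f) \<in> arr K" "x \<in> obj K \<Longrightarrow> bt (eta_square x) \<in> arr K"
  using squareD[of "R_square f"] squareD[of "eta_square x"] by auto

lemma into_simps [simp]:
  "f \<in> arr M \<Longrightarrow> trg1 M f = b \<Longrightarrow> into (R_square f) b" "x \<in> obj K \<Longrightarrow> b = f0 F x \<Longrightarrow> into (eta_square x) b"
  "b \<in> obj M \<Longrightarrow> into (counit_square b) b" "composable T S \<Longrightarrow> into T b \<Longrightarrow> into (T \<box> S) b"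
  "b \<in> obj M \<Longrightarrow> into (unit_square (e b) (r0 b)) b"
  unfolding into_def using composableD squareD(3) by (auto dest: squareD(3))

text \<open>Compositor and unitor lift identity 2-cells: the two squares being compared have the
  same top, because pasting composes tops strictly in \<open>M\<close>.\<close>

definition R :: "('p, 'b, 'd, 'o, 'a, 'c) psfun" where
  "R = \<lparr> f0 = r0, f1 = (\<lambda>f. bt (R_square f)), f2 = (\<lambda>\<alpha>. lift (R_square (src2 M \<alpha>)) (R_square (trg2 M \<alpha>)) \<alpha>),
     fc = (\<lambda>g f. lift (R_square g \<box> R_square f) (R_square (g \<odot>\<^sub>M f)) (id2 M (g \<odot>\<^sub>M f))),
     fu = (\<lambda>b. lift (unit_square (e b) (r0 b)) (R_square (id1 M b)) (id2 M (id1 M b))) \<rparr>"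

definition eps :: "('p, 'b, 'b, 'd) psnat" where
  "eps = \<lparr> tr = e, tc = (\<lambda>f. fill (R_square f)) \<rparr>"

text \<open>The naturality 2-cell lifts an identity: both pasted squares have top
  \<open>F u\<close>, since \<open>eta_square\<close> has an identity on top.\<close>

definition eta :: "('o, 'a, 'a, 'c) psnat" where
  "eta = \<lparr> tr = (\<lambda>x. bt (eta_square x)),
     tc = (\<lambda>u. lift (R_square (f1 F u) \<box> eta_square (src1 K u)) (eta_square (trg1 K u) \<box> id_square u) (id2 M (f1 F u))) \<rparr>"

text \<open>
  Unfolded, the statement that \<open>triangle b\<close> lies over the identity of \<open>e b\<close> is the coherence equation
  for the counit.
\<close>

definition triangle :: "'p \<Rightarrow> 'c" where
  "triangle b = lift (R_square (e b) \<box> eta_square (r0 b)) (counit_square b) (id2 M (e b))"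

lemma R_sel [simp]: "f0 R = r0" "f1 R f = bt (R_square f)" by (auto simp: R_def)
lemma eps_sel [simp]: "tr eps = e" "tc eps f = fill (R_square f)" by (auto simp: eps_def)
lemma eta_sel [simp]: "tr eta x = bt (eta_square x)" by (auto simp: eta_def)

lemma composable_simps [simp]:
  "f \<in> arr M \<Longrightarrow> g \<in> arr M \<Longrightarrow> trg1 M f = src1 M g \<Longrightarrow> composable (R_square g) (R_square f)"
  "x \<in> obj K \<Longrightarrow> g \<in> arr M \<Longrightarrow> src1 M g = f0 F x \<Longrightarrow> composable (R_square g) (eta_square x)"
  "b \<in> obj M \<Longrightarrow> g \<in> arr M \<Longrightarrow> src1 M g = b \<Longrightarrow> composable (R_square g) (counit_square b)"
  "u \<in> arr K \<Longrightarrow> trg1 K u = x \<Longrightarrow> composable (eta_square x) (id_square u)"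
  "b \<in> obj M \<Longrightarrow> u \<in> arr K \<Longrightarrow> trg1 K u = r0 b \<Longrightarrow> composable (counit_square b) (id_square u)"
  "u \<in> arr K \<Longrightarrow> v \<in> arr K \<Longrightarrow> trg1 K u = src1 K v \<Longrightarrow> composable (id_square v) (id_square u)"
  "x \<in> obj K \<Longrightarrow> b = f0 F x \<Longrightarrow> composable (unit_square (e b) (r0 b)) (eta_square x)"
  "f \<in> arr M \<Longrightarrow> trg1 M f = b \<Longrightarrow> composable (unit_square (e b) (r0 b)) (R_square f)"
  "f \<in> arr M \<Longrightarrow> src1 M f = b \<Longrightarrow> composable (R_square f) (unit_square (e b) (r0 b))"
  unfolding composable_def by auto

lemma composable_paste [simp]:
  assumes "composable T S"
  shows "composable U T \<Longrightarrow> composable U (T \<box> S)" "composable S U \<Longrightarrow> composable (T \<box> S) U"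
proof -
  note [simp] = composableD[OF assms] squareD[of S, simplified] squareD[of T, simplified]
  show "composable U (T \<box> S)" if "composable U T"
    using composableD[OF that] unfolding composable_def by (simp add: assms)
  show "composable (T \<box> S) U" if "composable S U"
    using composableD[OF that] unfolding composable_def by (simp add: assms)
qed

section \<open>Lifting properties of the chosen data\<close>

lemma over_f2R:
  assumes "\<alpha> \<in> cell M" "src2 M \<alpha> = f" "trg2 M \<alpha> = g"
  shows "over (R_square f) (R_square g) (f2 R \<alpha>) \<alpha>"
  unfolding R_def psfun.simps assms(2,3)
  by (rule over_lift[of _ "trg1 M f"]) (use assms M.cell_arr[OF assms(1)] in auto)

lemma over_fcR:
  assumes "f \<in> arr M" "g \<in> arr M" "trg1 M f = src1 M g"
  shows "over (R_square g \<box> R_square f) (R_square (g \<odot>\<^sub>M f)) (fc R g f) (id2 M (g \<odot>\<^sub>M f))"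
  unfolding R_def psfun.simps by (rule over_lift[of _ "trg1 M g"]) (use assms in auto)

lemma over_fuR:
  assumes "b \<in> obj M"
  shows "over (unit_square (e b) (r0 b)) (R_square (id1 M b)) (fu R b) (id2 M (id1 M b))"
  unfolding R_def psfun.simps by (rule over_lift[of _ b]) (use assms in auto)

lemma over_eta:
  assumes "u \<in> arr K" "src1 K u = x" "trg1 K u = y"
  shows "over (R_square (f1 F u) \<box> eta_square x) (eta_square y \<box> id_square u) (tc eta u) (id2 M (f1 F u))"
  unfolding eta_def psnat.simps assms(2,3) by (rule over_lift[of _ "f0 F y"]) (use assms in auto)

lemma over_triangle:
  assumes "b \<in> obj M"
  shows "over (R_square (e b) \<box> eta_square (r0 b)) (counit_square b) (triangle b) (id2 M (e b))"
  unfolding triangle_def by (rule over_lift[of _ b]) (use assms in auto)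

lemma iso_fcR:
  assumes "f \<in> arr M" "g \<in> arr M" "trg1 M f = src1 M g" shows "iso_cell K (fc R g f)"
  by (rule over_iso[OF over_fcR[OF assms], of "trg1 M g"]) (use assms in auto)

lemma iso_fuR:
  assumes "b \<in> obj M" shows "iso_cell K (fu R b)"
  by (rule over_iso[OF over_fuR[OF assms], of b]) (use assms in auto)

lemma iso_eta:
  assumes "u \<in> arr K" shows "iso_cell K (tc eta u)"
  by (rule over_iso[OF over_eta[OF assms refl refl], of "f0 F (trg1 K u)"]) (use assms in auto)

lemma iso_triangle:
  assumes "b \<in> obj M" shows "iso_cell K (triangle b)"
  by (rule over_iso[OF over_triangle[OF assms], of b]) (use assms in auto)

lemma R_typing [simp]:
  "\<alpha> \<in> cell M \<Longrightarrow> f2 R \<alpha> \<in> cell K" "\<alpha> \<in> cell M \<Longrightarrow> src2 K (f2 R \<alpha>) = bt (R_square (src2 M \<alpha>))"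
  "\<alpha> \<in> cell M \<Longrightarrow> trg2 K (f2 R \<alpha>) = bt (R_square (trg2 M \<alpha>))"
  "f \<in> arr M \<Longrightarrow> g \<in> arr M \<Longrightarrow> trg1 M f = src1 M g \<Longrightarrow> fc R g f \<in> cell K"
  "f \<in> arr M \<Longrightarrow> g \<in> arr M \<Longrightarrow> trg1 M f = src1 M g \<Longrightarrow> src2 K (fc R g f) = bt (R_square g) \<odot> bt (R_square f)"
  "f \<in> arr M \<Longrightarrow> g \<in> arr M \<Longrightarrow> trg1 M f = src1 M g \<Longrightarrow> trg2 K (fc R g f) = bt (R_square (g \<odot>\<^sub>M f))"
  "b \<in> obj M \<Longrightarrow> fu R b \<in> cell K" "b \<in> obj M \<Longrightarrow> src2 K (fu R b) = id1 K (r0 b)"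
  "b \<in> obj M \<Longrightarrow> trg2 K (fu R b) = bt (R_square (id1 M b))"
  using overD(5-7)[OF over_f2R[OF _ refl refl], of \<alpha>] overD(5-7)[OF over_fcR, of f g]
    overD(5-7)[OF over_fuR, of b] by simp_all

lemma eta_triangle_typing [simp]:
  "u \<in> arr K \<Longrightarrow> tc eta u \<in> cell K"
  "u \<in> arr K \<Longrightarrow> src2 K (tc eta u) = bt (R_square (f1 F u)) \<odot> bt (eta_square (src1 K u))"
  "u \<in> arr K \<Longrightarrow> trg2 K (tc eta u) = bt (eta_square (trg1 K u)) \<odot> u"
  "b \<in> obj M \<Longrightarrow> triangle b \<in> cell K" "b \<in> obj M \<Longrightarrow> src2 K (triangle b) = bt (R_square (e b)) \<odot> bt (eta_square (r0 b))"
  "b \<in> obj M \<Longrightarrow> trg2 K (triangle b) = id1 K (r0 b)"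
  using overD(5-7)[OF over_eta[OF _ refl refl], of u] overD(5-7)[OF over_triangle, of b] by simp_all

text \<open>Each equation compares two lifts of one 2-cell of \<open>M\<close> into a biuniversal
  arrow. For the associativity and unit coherences that 2-cell is an identity, since
  \<open>M\<close> is strict.\<close>

lemma pseudofunctor_R: "pseudofunctor M K R"
proof (rule pseudofunctor.intro)
  fix b assume "b \<in> obj M"
  then show "f0 R b \<in> obj K" by simp
next
  fix x y assume xy: "x \<in> obj M" "y \<in> obj M"
  show "cfunctor (hom_cat M x y) (hom_cat K (f0 R x) (f0 R y)) (f1 R) (f2 R)"
  proof (rule cfunctor.intro)
    fix f assume "f \<in> cobj (hom_cat M x y)"
    then have f: "f \<in> arr M" "src1 M f = x" "trg1 M f = y" by (auto simp: hom_cat_def)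
    then show "f1 R f \<in> cobj (hom_cat K (f0 R x) (f0 R y))" by (auto simp: hom_cat_def)
    have "f2 R (id2 M f) = id2 K (bt (R_square f))"
      by (rule over_unique[where b=y, OF over_f2R over_id]) (use f in auto)
    then show "f2 R (cid (hom_cat M x y) f) = cid (hom_cat K (f0 R x) (f0 R y)) (f1 R f)"
      by (simp add: hom_cat_def)
  next
    fix \<alpha> f g assume "\<alpha> \<in> chom (hom_cat M x y) f g"
    then show "f2 R \<alpha> \<in> chom (hom_cat K (f0 R x) (f0 R y)) (f1 R f) (f1 R g)"
      unfolding M.chom_hom_cat K.chom_hom_cat by auto
  next
    fix \<alpha> f g \<beta> h assume "\<alpha> \<in> chom (hom_cat M x y) f g" "\<beta> \<in> chom (hom_cat M x y) g h"
    then have *: "\<alpha> \<in> cell M" "src2 M \<alpha> = f" "trg2 M \<alpha> = g" "\<beta> \<in> cell M" "src2 M \<beta> = g" "trg2 M \<beta> = h"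
        "f \<in> arr M" "h \<in> arr M" "g \<in> arr M" "trg1 M f = y"
      unfolding M.chom_hom_cat using M.cell_arr(2)[of \<beta>] by auto
    have "f2 R (\<beta> \<bullet>\<^sub>M \<alpha>) = f2 R \<beta> \<bullet> f2 R \<alpha>"
      by (rule over_unique[where b=y, OF over_f2R over_vcomp[OF over_f2R[of \<alpha> f g] over_f2R[of \<beta> g h]]]) (use * in auto)
    then show "f2 R (ccomp (hom_cat M x y) \<beta> \<alpha>) = ccomp (hom_cat K (f0 R x) (f0 R y)) (f2 R \<beta>) (f2 R \<alpha>)"
      by (simp add: hom_cat_def)
  qed
next
  fix f g x y z assume "f \<in> hom M x y" "g \<in> hom M y z"
  then show "fc R g f \<in> isocells K (f1 R g \<odot> f1 R f) (f1 R (g \<odot>\<^sub>M f))"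
    using iso_fcR[of f g] by simp
next
  fix b assume "b \<in> obj M"
  then show "fu R b \<in> isocells K (id1 K (f0 R b)) (f1 R (id1 M b))"
    using iso_fuR by simp
next
  fix f x y g z \<alpha> f' \<beta> g'
  assume *: "f \<in> hom M x y" "g \<in> hom M y z" "\<alpha> \<in> cells M f f'" "\<beta> \<in> cells M g g'"
  have [simp]: "f' \<in> arr M" "g' \<in> arr M" "src1 M f' = x" "trg1 M f' = y" "src1 M g' = y" "trg1 M g' = z"
    using * M.cell_arr[of \<alpha>] M.cell_arr[of \<beta>] by auto
  show "f2 R (\<beta> \<star>\<^sub>M \<alpha>) \<bullet> fc R g f = fc R g' f' \<bullet> (f2 R \<beta> \<star> f2 R \<alpha>)"
    by (rule over_unique[where b=z, OF over_vcomp[OF over_fcR over_f2R]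
          over_vcomp[OF over_hcomp[OF over_f2R[of \<alpha> f f'] over_f2R[of \<beta> g g']] over_fcR]])
      (use * in auto)
next
  fix f w x g y h z assume *: "f \<in> hom M w x" "g \<in> hom M x y" "h \<in> hom M y z"
  have 1: "over (R_square h \<box> R_square g \<box> R_square f) (R_square (h \<odot>\<^sub>M g) \<box> R_square f) (fc R h g \<star> id2 K (bt (R_square f)))
     (id2 M (h \<odot>\<^sub>M g) \<star>\<^sub>M id2 M (tp (R_square f)))"
    using over_hcomp[OF over_id[of "R_square f"] over_fcR[of g h]] * by (simp add: paste_assoc)
  have 2: "over (R_square h \<box> R_square g \<box> R_square f) (R_square (h \<odot>\<^sub>M g \<odot>\<^sub>M f))
     (fc R (h \<odot>\<^sub>M g) f \<bullet> (fc R h g \<star> id2 K (bt (R_square f)))) (id2 M (h \<odot>\<^sub>M g \<odot>\<^sub>M f))"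
    using over_vcomp[OF 1 over_fcR[of f "h \<odot>\<^sub>M g"]] * by simp
  show "fc R (h \<odot>\<^sub>M g) f \<bullet> (fc R h g \<star> id2 K (f1 R f)) = fc R h (g \<odot>\<^sub>M f) \<bullet> (id2 K (f1 R h) \<star> fc R g f)"
    unfolding R_sel
    by (rule over_unique[where b=z, OF 2
          over_vcomp[OF over_hcomp[OF over_fcR[of f g] over_id[of "R_square h"]] over_fcR[of "g \<odot>\<^sub>M f" h]]])
      (use * in auto)
next
  fix f x y assume *: "f \<in> hom M x y"
  \<comment> \<open>\<open>paste_unit\<close> identifies the source square with
    \<open>R_square f\<close> itself, so that after the compositor the composite can be compared
    with an identity.\<close>
  have 1: "over (R_square f) (R_square f \<box> R_square (id1 M x)) (id2 K (bt (R_square f)) \<star> fu R x) (id2 M f \<star>\<^sub>M id2 M (id1 M x))"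
    using over_hcomp[OF over_fuR[of x] over_id[of "R_square f"]] paste_unit(1)[of "R_square f" "r0 x"] * by auto
  have "over (R_square f) (R_square f) (fc R f (id1 M x) \<bullet> (id2 K (bt (R_square f)) \<star> fu R x)) (id2 M f)"
    using over_vcomp[OF 1 over_fcR[of "id1 M x" f]] * by auto
  then show "fc R f (id1 M x) \<bullet> (id2 K (f1 R f) \<star> fu R x) = id2 K (f1 R f)"
    unfolding R_sel by (rule over_unique[where b=y, OF _ over_id]) (use * in auto)
  have 2: "over (R_square f) (R_square (id1 M y) \<box> R_square f) (fu R y \<star> id2 K (bt (R_square f))) (id2 M (id1 M y) \<star>\<^sub>M id2 M f)"
    using over_hcomp[OF over_id[of "R_square f"] over_fuR[of y]] paste_unit(2)[of "R_square f" "r0 y"] * by auto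
  have "over (R_square f) (R_square f) (fc R (id1 M y) f \<bullet> (fu R y \<star> id2 K (bt (R_square f)))) (id2 M f)"
    using over_vcomp[OF 2 over_fcR[of f "id1 M y"]] * by auto
  then show "fc R (id1 M y) f \<bullet> (fu R y \<star> id2 K (f1 R f)) = id2 K (f1 R f)"
    unfolding R_sel by (rule over_unique[where b=y, OF _ over_id]) (use * in auto)
qed

text \<open>With the fills of \<open>R_square\<close> as components, the defining equations of
  \<open>over\<close> for \<open>f2 R\<close>, \<open>fc R\<close> and \<open>fu R\<close> are
  exactly the naturality, composition and unit axioms.\<close>

lemma pseudonatural_eps: "pseudonatural M M (comp_psf M F R) (id_psf M) eps"
proof (rule pseudonatural.intro)
  fix x assume "x \<in> obj M"
  then show "tr eps x \<in> hom M (f0 (comp_psf M F R) x) (f0 (id_psf M) x)"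
    by (simp add: comp_psf_def id_psf_def)
next
  fix f x y assume "f \<in> hom M x y"
  then show "tc eps f \<in> isocells M (f1 (id_psf M) f \<odot>\<^sub>M tr eps x) (tr eps y \<odot>\<^sub>M f1 (comp_psf M F R) f)"
    by (auto simp: comp_psf_def id_psf_def)
next
  fix f x y \<alpha> g assume *: "f \<in> hom M x y" "\<alpha> \<in> cells M f g"
  then have [simp]: "x \<in> obj M" "y \<in> obj M" by auto
  from * show "(id2 M (tr eps y) \<star>\<^sub>M f2 (comp_psf M F R) \<alpha>) \<bullet>\<^sub>M tc eps f =
      tc eps g \<bullet>\<^sub>M (f2 (id_psf M) \<alpha> \<star>\<^sub>M id2 M (tr eps x))"
    using overD(11)[OF over_f2R[of \<alpha> f g]] by (simp add: comp_psf_def id_psf_def)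
next
  fix f x y g z assume *: "f \<in> hom M x y" "g \<in> hom M y z"
  then have [simp]: "x \<in> obj M" "y \<in> obj M" "z \<in> obj M" by auto
  from * show "tc eps (g \<odot>\<^sub>M f) \<bullet>\<^sub>M (fc (id_psf M) g f \<star>\<^sub>M id2 M (tr eps x)) =
       (id2 M (tr eps z) \<star>\<^sub>M fc (comp_psf M F R) g f) \<bullet>\<^sub>M
       (tc eps g \<star>\<^sub>M id2 M (f1 (comp_psf M F R) f)) \<bullet>\<^sub>M (id2 M (f1 (id_psf M) g) \<star>\<^sub>M tc eps f)"
    using overD(11)[OF over_fcR[of f g]] by (simp add: comp_psf_def id_psf_def paste_def)
next
  fix x assume "x \<in> obj M"
  then show "tc eps (id1 M x) \<bullet>\<^sub>M (fu (id_psf M) x \<star>\<^sub>M id2 M (tr eps x)) =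
      id2 M (tr eps x) \<star>\<^sub>M fu (comp_psf M F R) x"
    using overD(11)[OF over_fuR[of x]] by (simp add: comp_psf_def id_psf_def unit_square_def)
qed

lemma over_id_square:
  assumes "\<mu> \<in> cell K" "src2 K \<mu> = u" "trg2 K \<mu> = v"
  shows "over (id_square u) (id_square v) \<mu> (f2 F \<mu>)"
proof -
  have "u \<in> arr K" "v \<in> arr K" "src1 K v = src1 K u" "trg1 K v = trg1 K u"
    using K.cell_arr[OF assms(1)] assms by auto
  then show ?thesis unfolding over_def using assms by simp
qed

text \<open>The pasted square has top \<open>F v \<odot> F u\<close>, not
  \<open>F (v \<odot> u)\<close>. The base 2-cell is therefore the compositor of \<open>F\<close>,
  while the bottom does not change.\<close>

lemma over_id_square_comp:
  assumes "u \<in> arr K" "v \<in> arr K" "trg1 K u = src1 K v"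
  shows "over (id_square v \<box> id_square u) (id_square (v \<odot> u)) (id2 K (v \<odot> u)) (fc F v u)"
proof -
  have "fill (id_square v \<box> id_square u) = fc F v u" using assms by (simp add: paste_def)
  then show ?thesis unfolding over_def using assms by simp
qed

lemma over_id_square_id:
  assumes "x \<in> obj K"
  shows "over (unit_square (id1 M (f0 F x)) x) (id_square (id1 K x)) (id2 K (id1 K x)) (fu F x)"
proof -
  have "fill (unit_square (id1 M (f0 F x)) x) = fu F x" using assms by (simp add: unit_square_def)
  then show ?thesis unfolding over_def using assms by simp
qed

lemma pseudonatural_eta: "pseudonatural K K (id_psf K) (comp_psf K R F) eta"
proof (rule pseudonatural.intro)
  fix x assume "x \<in> obj K"
  then show "tr eta x \<in> hom K (f0 (id_psf K) x) (f0 (comp_psf K R F) x)"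
    by (simp add: comp_psf_def id_psf_def)
next
  fix f x y assume "f \<in> hom K x y"
  then show "tc eta f \<in> isocells K (f1 (comp_psf K R F) f \<odot> tr eta x) (tr eta y \<odot> f1 (id_psf K) f)"
    using iso_eta[of f] by (auto simp: comp_psf_def id_psf_def)
next
  fix u x y \<mu> v assume *: "u \<in> hom K x y" "\<mu> \<in> cells K u v"
  then have [simp]: "v \<in> arr K" "src1 K v = x" "trg1 K v = y" using K.cell_arr[of \<mu>] by auto
  have "(id2 K (bt (eta_square y)) \<star> \<mu>) \<bullet> tc eta u = tc eta v \<bullet> (f2 R (f2 F \<mu>) \<star> id2 K (bt (eta_square x)))"
    by (rule over_unique[where b="f0 F y", OF
        over_vcomp[OF over_eta[of u x y] over_hcomp[OF over_id_square[of \<mu> u v] over_id[of "eta_square y"]]]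
        over_vcomp[OF over_hcomp[OF over_id[of "eta_square x"] over_f2R[of "f2 F \<mu>" "f1 F u" "f1 F v"]] over_eta[of v x y]]])
      (use * in auto)
  then show "(id2 K (tr eta y) \<star> f2 (id_psf K) \<mu>) \<bullet> tc eta u =
      tc eta v \<bullet> (f2 (comp_psf K R F) \<mu> \<star> id2 K (tr eta x))"
    by (simp add: comp_psf_def id_psf_def)
next
  fix u x y v z assume *: "u \<in> hom K x y" "v \<in> hom K y z"
  then have [simp]: "u \<in> arr K" "v \<in> arr K" "src1 K u = x" "trg1 K u = y" "src1 K v = y" "trg1 K v = z"
      "x \<in> obj K" "y \<in> obj K" "z \<in> obj K"
    by auto
  \<comment> \<open>The compositor of \<open>F\<close> enters each side of the composition axiom
    once: here through \<open>f2 R (fc F v u)\<close>, on the other side through \<open>c\<close>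
    with an identity as bottom 2-cell. Both composites lie over \<open>fc F v u\<close>.\<close>
  have 1: "over (R_square (f1 F v) \<box> R_square (f1 F u) \<box> eta_square x) (eta_square z \<box> id_square (v \<odot> u))
      (tc eta (v \<odot> u) \<bullet> (f2 R (fc F v u) \<star> id2 K (bt (eta_square x))) \<bullet> (fc R (f1 F v) (f1 F u) \<star> id2 K (bt (eta_square x))))
      (fc F v u)"
    using over_vcomp[OF over_vcomp[OF over_hcomp[OF over_id[of "eta_square x"] over_fcR[of "f1 F u" "f1 F v"]]
      over_hcomp[OF over_id[of "eta_square x"] over_f2R[of "fc F v u" "f1 F v \<odot>\<^sub>M f1 F u" "f1 F (v \<odot> u)"]]]
        over_eta[of "v \<odot> u" x z]]
    by (simp add: paste_assoc)
  have a: "over (R_square (f1 F v) \<box> R_square (f1 F u) \<box> eta_square x) (R_square (f1 F v) \<box> eta_square y \<box> id_square u)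
      (id2 K (bt (R_square (f1 F v))) \<star> tc eta u) (id2 M (f1 F v \<odot>\<^sub>M f1 F u))"
    using over_hcomp[OF over_eta[of u x y] over_id[of "R_square (f1 F v)"]] by simp
  have b: "over (R_square (f1 F v) \<box> eta_square y \<box> id_square u) (eta_square z \<box> id_square v \<box> id_square u)
      (tc eta v \<star> id2 K u) (id2 M (f1 F v \<odot>\<^sub>M f1 F u))"
    using over_hcomp[OF over_id[of "id_square u"] over_eta[of v y z]] by (simp add: paste_assoc)
  have c: "over (eta_square z \<box> id_square v \<box> id_square u) (eta_square z \<box> id_square (v \<odot> u))
      (id2 K (bt (eta_square z) \<odot> v \<odot> u)) (fc F v u)"
    using over_hcomp[OF over_id_square_comp[of u v] over_id[of "eta_square z"]] by simp
  have "tc eta (v \<odot> u) \<bullet> (f2 R (fc F v u) \<star> id2 K (bt (eta_square x))) \<bullet> (fc R (f1 F v) (f1 F u) \<star> id2 K (bt (eta_square x)))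
     = id2 K (bt (eta_square z) \<odot> v \<odot> u) \<bullet> (tc eta v \<star> id2 K u) \<bullet> (id2 K (bt (R_square (f1 F v))) \<star> tc eta u)"
    by (rule over_unique[where b="f0 F z", OF 1 over_vcomp[OF over_vcomp[OF a b] c]]) auto
  then show "tc eta (v \<odot> u) \<bullet> (fc (comp_psf K R F) v u \<star> id2 K (tr eta x)) =
       (id2 K (tr eta z) \<star> fc (id_psf K) v u) \<bullet>
       (tc eta v \<star> id2 K (f1 (id_psf K) u)) \<bullet> (id2 K (f1 (comp_psf K R F) v) \<star> tc eta u)"
    by (simp add: comp_psf_def id_psf_def)
next
  fix x assume [simp]: "x \<in> obj K"
  have u: "unit_square (e (f0 F x)) (r0 (f0 F x)) \<box> eta_square x = eta_square x"
    using paste_unit(2)[of "eta_square x"] by simp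
  have v: "eta_square x \<box> unit_square (id1 M (f0 F x)) x = eta_square x"
    using paste_unit(1)[of "eta_square x"] by simp
  have 1: "over (eta_square x) (eta_square x \<box> id_square (id1 K x))
    (tc eta (id1 K x) \<bullet> (f2 R (fu F x) \<star> id2 K (bt (eta_square x))) \<bullet> (fu R (f0 F x) \<star> id2 K (bt (eta_square x)))) (fu F x)"
    using over_vcomp[OF over_vcomp[OF over_hcomp[OF over_id[of "eta_square x"] over_fuR[of "f0 F x"]]
      over_hcomp[OF over_id[of "eta_square x"] over_f2R[of "fu F x" "id1 M (f0 F x)" "f1 F (id1 K x)"]]]
        over_eta[of "id1 K x" x x]] u
    by simp
  have 2: "over (eta_square x) (eta_square x \<box> id_square (id1 K x)) (id2 K (bt (eta_square x))) (fu F x)"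
    using over_hcomp[OF over_id_square_id[of x] over_id[of "eta_square x"]] v by (simp add: composable_def)
  show "tc eta (id1 K x) \<bullet> (fu (comp_psf K R F) x \<star> id2 K (tr eta x)) = id2 K (tr eta x) \<star> fu (id_psf K) x"
    using over_unique[where b="f0 F x", OF 1 2] by (simp add: comp_psf_def id_psf_def)
qed

text \<open>Naturality of the counit inside the comma 2-category. By the unit coherences of
  \<open>F\<close> the first pasted fill reduces to \<open>fill (R_square f)\<close> and the second
  to an identity, so that fill is itself the base 2-cell between the two squares.\<close>

lemma over_counit_square:
  assumes "f \<in> arr M" "src1 M f = a" "trg1 M f = b"
  shows "over (R_square f \<box> counit_square a) (counit_square b \<box> id_square (bt (R_square f))) (id2 K (bt (R_square f))) (fill (R_square f))"
proof -
  note [simp] = assms(2,3)[symmetric] assms(1)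
  let ?u = "bt (R_square f)" and ?x = "r0 (src1 M f)" and ?y = "r0 (trg1 M f)"
  have "(fill (R_square f) \<star>\<^sub>M id2 M (f1 F (id1 K ?x))) \<bullet>\<^sub>M (id2 M (f \<odot>\<^sub>M e (src1 M f)) \<star>\<^sub>M fu F ?x) =
      (id2 M (e (trg1 M f) \<odot>\<^sub>M f1 F ?u) \<star>\<^sub>M fu F ?x) \<bullet>\<^sub>M (fill (R_square f) \<star>\<^sub>M id2 M (id1 M (f0 F ?x)))"
    by (rule M.whisker_swap) auto
  then have "fill (R_square f \<box> counit_square (src1 M f)) = (id2 M (e (trg1 M f)) \<star>\<^sub>M
      (fc F ?u (id1 K ?x) \<bullet>\<^sub>M (id2 M (f1 F ?u) \<star>\<^sub>M fu F ?x))) \<bullet>\<^sub>M fill (R_square f)"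
    by (simp add: paste_def del: fc_fu)
  then have 1: "fill (R_square f \<box> counit_square (src1 M f)) = fill (R_square f)" by simp
  have "fill (counit_square (trg1 M f) \<box> id_square ?u) = id2 M (e (trg1 M f)) \<star>\<^sub>M
      (fc F (id1 K ?y) ?u \<bullet>\<^sub>M (fu F ?y \<star>\<^sub>M id2 M (f1 F ?u)))"
    by (simp add: paste_def del: fc_fu)
  then have 2: "fill (counit_square (trg1 M f) \<box> id_square ?u) = id2 M (e (trg1 M f) \<odot>\<^sub>M f1 F ?u)" by simp
  show ?thesis unfolding over_def by (simp add: 1 2)
qed

lemma over_vinv_fcR:
  assumes "f \<in> arr M" "g \<in> arr M" "trg1 M f = src1 M g"
  shows "over (R_square (g \<odot>\<^sub>M f)) (R_square g \<box> R_square f) (vinv K (fc R g f)) (id2 M (g \<odot>\<^sub>M f))"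
  using over_vinv[OF over_fcR[OF assms] iso_fcR[OF assms]] assms by simp

text \<open>This is the equation of \<open>over_eta\<close> with the compositor of \<open>F\<close>
  at \<open>u\<close> and the unit at \<open>y\<close> moved to the other side, where
  \<open>psn_left\<close> contains its inverse.\<close>

lemma modification_fill_eta_square:
  "invertible_modification K M F F (id_psn M F)
    (vcomp_psn K M (psn_right eps F) (psn_left K M F (id_psf K) (comp_psf K R F) eta)) (\<lambda>x. fill (eta_square x))"
proof (rule invertible_modification.intro)
  fix x assume "x \<in> obj K"
  then show "fill (eta_square x) \<in> isocells M (tr (id_psn M F) x)
      (tr (vcomp_psn K M (psn_right eps F) (psn_left K M F (id_psf K) (comp_psf K R F) eta)) x)"
    by (simp add: id_psn_def vcomp_psn_def psn_right_def psn_left_def)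
next
  fix u x y assume "u \<in> hom K x y"
  then have [simp]: "u \<in> arr K" "src1 K u = x" "trg1 K u = y" "x \<in> obj K" "y \<in> obj K" by auto
  let ?h = "bt (eta_square x)" and ?k = "bt (eta_square y)" and ?r = "bt (R_square (f1 F u))"
  let ?c = "id2 M (e (f0 F y)) \<star>\<^sub>M fc F ?k u"
  have "(id2 M (e (f0 F y)) \<star>\<^sub>M f2 F (tc eta u)) \<bullet>\<^sub>M fill (R_square (f1 F u) \<box> eta_square x) = fill (eta_square y \<box> id_square u)"
    using overD(11)[OF over_eta[of u x y]] squareD[of "eta_square y \<box> id_square u"] by simp
  then have eq: "(id2 M (e (f0 F y)) \<star>\<^sub>M f2 F (tc eta u)) \<bullet>\<^sub>M (id2 M (e (f0 F y)) \<star>\<^sub>M fc F ?r ?h) \<bullet>\<^sub>M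
      (fill (R_square (f1 F u)) \<star>\<^sub>M id2 M (f1 F ?h)) \<bullet>\<^sub>M (id2 M (f1 F u) \<star>\<^sub>M fill (eta_square x)) =
      ?c \<bullet>\<^sub>M (fill (eta_square y) \<star>\<^sub>M id2 M (f1 F u))"
    by (simp add: paste_def)
  have "(id2 M (e (f0 F y)) \<star>\<^sub>M vinv M (fc F ?k u)) \<bullet>\<^sub>M ?c = id2 M (e (f0 F y) \<odot>\<^sub>M f1 F ?k \<odot>\<^sub>M f1 F u)"
    by (subst M.whisker_left[symmetric]) (simp_all del: M.whisker_left)
  then have "fill (eta_square y) \<star>\<^sub>M id2 M (f1 F u) =
     ((id2 M (e (f0 F y)) \<star>\<^sub>M vinv M (fc F ?k u)) \<bullet>\<^sub>M ?c) \<bullet>\<^sub>M (fill (eta_square y) \<star>\<^sub>M id2 M (f1 F u))"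
    by simp
  also have "\<dots> = (id2 M (e (f0 F y)) \<star>\<^sub>M vinv M (fc F ?k u)) \<bullet>\<^sub>M
      ((id2 M (e (f0 F y)) \<star>\<^sub>M f2 F (tc eta u)) \<bullet>\<^sub>M (id2 M (e (f0 F y)) \<star>\<^sub>M fc F ?r ?h) \<bullet>\<^sub>M
      (fill (R_square (f1 F u)) \<star>\<^sub>M id2 M (f1 F ?h)) \<bullet>\<^sub>M (id2 M (f1 F u) \<star>\<^sub>M fill (eta_square x)))"
    unfolding eq by simp
  finally show "(fill (eta_square y) \<star>\<^sub>M id2 M (f1 F u)) \<bullet>\<^sub>M tc (id_psn M F) u =
      tc (vcomp_psn K M (psn_right eps F) (psn_left K M F (id_psf K) (comp_psf K R F) eta)) u \<bullet>\<^sub>M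
      (id2 M (f1 F u) \<star>\<^sub>M fill (eta_square x))"
    by (simp add: id_psn_def vcomp_psn_def psn_right_def psn_left_def id_psf_def comp_psf_def)
qed

text \<open>Both sides are lifts of \<open>fill (R_square f)\<close>. On the side of
  \<open>triangle b\<close> it enters through \<open>f2 R (fill (R_square f))\<close>, on the side
  of \<open>triangle a\<close> through \<open>over_counit_square\<close>.\<close>

lemma modification_triangle:
  "invertible_modification M K R R
    (vcomp_psn M K (psn_left M K R (comp_psf M F R) (id_psf M) eps) (psn_right eta R)) (id_psn K R) triangle"
proof (rule invertible_modification.intro)
  fix b assume "b \<in> obj M"
  then show "triangle b \<in> isocells K
      (tr (vcomp_psn M K (psn_left M K R (comp_psf M F R) (id_psf M) eps) (psn_right eta R)) b)
      (tr (id_psn K R) b)"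
    using iso_triangle by (simp add: id_psn_def vcomp_psn_def psn_right_def psn_left_def)
next
  fix f a b assume "f \<in> hom M a b"
  then have [simp]: "f \<in> arr M" "src1 M f = a" "trg1 M f = b" "a \<in> obj M" "b \<in> obj M" by auto
  let ?u = "bt (R_square f)" and ?eb = "bt (R_square (e b))" and ?n = "eta_square (r0 a)"
  let ?i = "id2 K (bt ?n)"
  have 1: "over (R_square f \<box> R_square (e a) \<box> ?n) (R_square (f \<odot>\<^sub>M e a) \<box> ?n) (fc R f (e a) \<star> ?i) (id2 M (f \<odot>\<^sub>M e a))"
    using over_hcomp[OF over_id[of ?n] over_fcR[of "e a" f]] by (simp add: paste_assoc)
  have 2: "over (R_square (f \<odot>\<^sub>M e a) \<box> ?n) (R_square (e b \<odot>\<^sub>M f1 F ?u) \<box> ?n) (f2 R (fill (R_square f)) \<star> ?i) (fill (R_square f))"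
    using over_hcomp[OF over_id[of ?n] over_f2R[of "fill (R_square f)" "f \<odot>\<^sub>M e a" "e b \<odot>\<^sub>M f1 F ?u"]] by simp
  have 3: "over (R_square (e b \<odot>\<^sub>M f1 F ?u) \<box> ?n) (R_square (e b) \<box> R_square (f1 F ?u) \<box> ?n)
      (vinv K (fc R (e b) (f1 F ?u)) \<star> ?i) (id2 M (e b \<odot>\<^sub>M f1 F ?u))"
    using over_hcomp[OF over_id[of ?n] over_vinv_fcR[of "f1 F ?u" "e b"]] by (simp add: paste_assoc)
  have 4: "over (R_square (e b) \<box> R_square (f1 F ?u) \<box> ?n) (R_square (e b) \<box> eta_square (r0 b) \<box> id_square ?u)
      (id2 K ?eb \<star> tc eta ?u) (id2 M (e b \<odot>\<^sub>M f1 F ?u))"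
    using over_hcomp[OF over_eta[of ?u "r0 a" "r0 b"] over_id[of "R_square (e b)"]] by simp
  have 5: "over (R_square (e b) \<box> eta_square (r0 b) \<box> id_square ?u) (counit_square b \<box> id_square ?u) (triangle b \<star> id2 K ?u) (id2 M (e b \<odot>\<^sub>M f1 F ?u))"
    using over_hcomp[OF over_id[of "id_square ?u"] over_triangle[of b]] by (simp add: paste_assoc)
  have 6: "over (R_square f \<box> R_square (e a) \<box> ?n) (R_square f \<box> counit_square a) (id2 K ?u \<star> triangle a) (id2 M (f \<odot>\<^sub>M e a))"
    using over_hcomp[OF over_triangle[of a] over_id[of "R_square f"]] by simp
  note 7 = over_counit_square[of f a b]
  have iso: "iso_cell K (fc R (e b) (f1 F ?u))" by (rule iso_fcR) auto
  note [simp] = K.vinv_simps(1-3)[OF iso]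
  have L: "over (R_square f \<box> R_square (e a) \<box> ?n) (counit_square b \<box> id_square ?u)
     ((triangle b \<star> id2 K ?u) \<bullet> (id2 K ?eb \<star> tc eta ?u) \<bullet>
      ((vinv K (fc R (e b) (f1 F ?u)) \<bullet> f2 R (fill (R_square f)) \<bullet> fc R f (e a)) \<star> ?i)) (fill (R_square f))"
    using over_vcomp[OF over_vcomp[OF over_vcomp[OF over_vcomp[OF 1 2] 3] 4] 5] by simp
  have R: "over (R_square f \<box> R_square (e a) \<box> ?n) (counit_square b \<box> id_square ?u) (id2 K ?u \<star> triangle a) (fill (R_square f))"
    using over_vcomp[OF 6 7] by simp
  have "(triangle b \<star> id2 K ?u) \<bullet> (id2 K ?eb \<star> tc eta ?u) \<bullet>
      ((vinv K (fc R (e b) (f1 F ?u)) \<bullet> f2 R (fill (R_square f)) \<bullet> fc R f (e a)) \<star> ?i) = id2 K ?u \<star> triangle a"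
    by (rule over_unique[where b=b, OF L R]) auto
  then show "(triangle b \<star> id2 K (f1 R f)) \<bullet>
      tc (vcomp_psn M K (psn_left M K R (comp_psf M F R) (id_psf M) eps) (psn_right eta R)) f =
      tc (id_psn K R) f \<bullet> (id2 K (f1 R f) \<star> triangle a)"
    by (simp add: id_psn_def vcomp_psn_def psn_right_def psn_left_def id_psf_def comp_psf_def)
qed

theorem biadjunction_R: "biadjunction K M F R eta eps (\<lambda>x. fill (eta_square x)) triangle"
proof (rule biadjunction.intro)
  show "pseudofunctor K M F" by (rule pseudofunctor_axioms)
  show "pseudofunctor M K R" by (rule pseudofunctor_R)
  show "pseudonatural K K (id_psf K) (comp_psf K R F) eta" by (rule pseudonatural_eta)
  show "pseudonatural M M (comp_psf M F R) (id_psf M) eps" by (rule pseudonatural_eps)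
  show "invertible_modification K M F F (id_psn M F)
    (vcomp_psn K M (psn_right eps F) (psn_left K M F (id_psf K) (comp_psf K R F) eta)) (\<lambda>x. fill (eta_square x))"
    by (rule modification_fill_eta_square)
  show "invertible_modification M K R R
    (vcomp_psn M K (psn_left M K R (comp_psf M F R) (id_psf M) eps) (psn_right eta R)) (id_psn K R) triangle"
    by (rule modification_triangle)
next
  fix b e' n assume [simp]: "b \<in> obj M" "e' = tr eps b" "n = tr eta (f0 R b)"
  have "(id2 M (e b) \<star>\<^sub>M f2 F (triangle b)) \<bullet>\<^sub>M fill (R_square (e b) \<box> eta_square (r0 b)) = id2 M (e b) \<star>\<^sub>M fu F (r0 b)"
    using overD(11)[OF over_triangle[of b]] by simp
  moreover have "(id2 M (e b) \<star>\<^sub>M vinv M (fu F (r0 b))) \<bullet>\<^sub>M (id2 M (e b) \<star>\<^sub>M fu F (r0 b)) = id2 M (e b)"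
    by (subst M.whisker_left[symmetric]) (simp_all del: M.whisker_left)
  ultimately show "(id2 M e' \<star>\<^sub>M vinv M (fu F (f0 R b))) \<bullet>\<^sub>M (id2 M e' \<star>\<^sub>M f2 F (triangle b)) \<bullet>\<^sub>M
      (id2 M e' \<star>\<^sub>M fc F (f1 R e') n) \<bullet>\<^sub>M (tc eps e' \<star>\<^sub>M id2 M (f1 F n)) \<bullet>\<^sub>M
      (id2 M e' \<star>\<^sub>M fill (eta_square (f0 R b))) = id2 M e'"
    by (simp add: paste_def)
next
  fix x h' e' assume [simp]: "x \<in> obj K" and he: "h' = tr eta x" "e' = tr eps (f0 F x)"
  let ?b = "f0 F x"
  let ?n = "eta_square x"
  define h where "h = bt (eta_square x)"
  have [simp]: "h \<in> arr K" "src1 K h = x" "trg1 K h = r0 ?b" "bt (eta_square x) = h" by (auto simp: h_def)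
  let ?i = "id2 K h" and ?Fh = "f1 F h"
  have u: "unit_square (e ?b) (r0 ?b) \<box> ?n = ?n"
    using paste_unit(2)[of ?n] by simp
  have 1: "over ?n (R_square (id1 M ?b) \<box> ?n) (fu R ?b \<star> ?i) (id2 M (id1 M ?b))"
    using over_hcomp[OF over_id[of ?n] over_fuR[of ?b]] u by simp
  have 2: "over (R_square (id1 M ?b) \<box> ?n) (R_square (e ?b \<odot>\<^sub>M ?Fh) \<box> ?n) (f2 R (fill ?n) \<star> ?i) (fill ?n)"
    using over_hcomp[OF over_id[of ?n] over_f2R[of "fill ?n" "id1 M ?b" "e ?b \<odot>\<^sub>M ?Fh"]] by simp
  have 3: "over (R_square (e ?b \<odot>\<^sub>M ?Fh) \<box> ?n) (R_square (e ?b) \<box> R_square ?Fh \<box> ?n) (vinv K (fc R (e ?b) ?Fh) \<star> ?i)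
      (id2 M (e ?b \<odot>\<^sub>M ?Fh))"
    using over_hcomp[OF over_id[of ?n] over_vinv_fcR[of ?Fh "e ?b"]] by (simp add: paste_assoc)
  have 4: "over (R_square (e ?b) \<box> R_square ?Fh \<box> ?n) (R_square (e ?b) \<box> eta_square (r0 ?b) \<box> id_square h)
      (id2 K (bt (R_square (e ?b))) \<star> tc eta h) (id2 M (e ?b \<odot>\<^sub>M ?Fh))"
    using over_hcomp[OF over_eta[of h x "r0 ?b"] over_id[of "R_square (e ?b)"]] by simp
  have 5: "over (R_square (e ?b) \<box> eta_square (r0 ?b) \<box> id_square h) (counit_square ?b \<box> id_square h) (triangle ?b \<star> ?i) (id2 M (e ?b \<odot>\<^sub>M ?Fh))"
    using over_hcomp[OF over_id[of "id_square h"] over_triangle[of ?b]] by (simp add: paste_assoc)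
  have "fill (counit_square ?b \<box> id_square h) = id2 M (e ?b) \<star>\<^sub>M
      (fc F (id1 K (r0 ?b)) h \<bullet>\<^sub>M (fu F (r0 ?b) \<star>\<^sub>M id2 M ?Fh))"
    by (simp add: paste_def del: fc_fu)
  then have "fill (counit_square ?b \<box> id_square h) = id2 M (e ?b \<odot>\<^sub>M ?Fh)" by simp
  \<comment> \<open>The pasted square has an identity as fill, so the inverse of the fill of
    \<open>eta_square x\<close> leads back to \<open>eta_square x\<close> with identity bottom. It
    cancels the base 2-cell of step 2, and the whole loop lies over an identity.\<close>
  then have 6: "over (counit_square ?b \<box> id_square h) ?n ?i (vinv M (fill ?n))"
    unfolding over_def by simp
  have iso: "iso_cell K (fc R (e ?b) ?Fh)" by (rule iso_fcR) auto
  note [simp] = K.vinv_simps(1-3)[OF iso]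
  have "over ?n ?n ((triangle ?b \<star> ?i) \<bullet> (id2 K (bt (R_square (e ?b))) \<star> tc eta h) \<bullet>
      (vinv K (fc R (e ?b) ?Fh) \<star> ?i) \<bullet> (f2 R (fill ?n) \<star> ?i) \<bullet> (fu R ?b \<star> ?i)) (id2 M (id1 M ?b))"
    using over_vcomp[OF over_vcomp[OF over_vcomp[OF over_vcomp[OF over_vcomp[OF 1 2] 3] 4] 5] 6] by simp
  then have "(triangle ?b \<star> ?i) \<bullet> (id2 K (bt (R_square (e ?b))) \<star> tc eta h) \<bullet>
      (vinv K (fc R (e ?b) ?Fh) \<star> ?i) \<bullet> (f2 R (fill ?n) \<star> ?i) \<bullet> (fu R ?b \<star> ?i) = ?i"
    by (rule over_unique[where b="?b", OF _ over_id[of ?n, simplified]]) auto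
  then show "(triangle ?b \<star> id2 K h') \<bullet> (id2 K (f1 R e') \<star> tc eta h') \<bullet>
      (vinv K (fc R e' (f1 F h')) \<star> id2 K h') \<bullet> (f2 R (fill ?n) \<star> id2 K h') \<bullet> (fu R ?b \<star> id2 K h') = id2 K h'"
    unfolding he by simp
qed

text \<open>The equation of \<open>over\<close> matches \<open>\<alpha> \<star> id2 M (e a)\<close>
  with \<open>id2 M (e b) \<star> f2 F \<mu>\<close> up to invertible fills. As \<open>e a\<close>
  is an equivalence, every \<open>\<mu>\<close> determines such an \<open>\<alpha>\<close>, and
  uniqueness of lifts gives \<open>f2 R \<alpha> = \<mu>\<close>.\<close>

lemma local_equiv_at_R:
  assumes eq: "\<And>b. b \<in> obj M \<Longrightarrow> equivalence_1cell M (e b)" and a: "a \<in> obj M" and b: "b \<in> obj M"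
  shows "local_equiv_at M K R a b"
  unfolding local_equiv_at_def
proof (intro conjI ballI)
  fix f g assume "f \<in> hom M a b" "g \<in> hom M a b"
  then have [simp]: "f \<in> arr M" "src1 M f = a" "trg1 M f = b" "g \<in> arr M" "src1 M g = a" "trg1 M g = b"
    by auto
  note [simp] = a b
  show "bij_betw (f2 R) (cells M f g) (cells K (f1 R f) (f1 R g))"
    unfolding bij_betw_def
  proof (intro conjI inj_onI equalityI subsetI)
    fix \<alpha> \<beta> assume *: "\<alpha> \<in> cells M f g" "\<beta> \<in> cells M f g" "f2 R \<alpha> = f2 R \<beta>"
    then have "fill (R_square g) \<bullet>\<^sub>M (\<alpha> \<star>\<^sub>M id2 M (e a)) = fill (R_square g) \<bullet>\<^sub>M (\<beta> \<star>\<^sub>M id2 M (e a))"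
      using overD(11)[OF over_f2R[of \<alpha> f g]] overD(11)[OF over_f2R[of \<beta> f g]] by simp
    then have "\<alpha> \<star>\<^sub>M id2 M (e a) = \<beta> \<star>\<^sub>M id2 M (e a)"
      by (rule M.vcomp_cancel_left[rotated -1]) (use * in auto)
    then show "\<alpha> = \<beta>"
      by (rule M.equivalence_whisker_right_inj[OF eq[OF a], rotated -1]) (use * in auto)
  next
    fix \<mu> assume "\<mu> \<in> f2 R ` cells M f g"
    then show "\<mu> \<in> cells K (f1 R f) (f1 R g)" by auto
  next
    fix \<mu> assume "\<mu> \<in> cells K (f1 R f) (f1 R g)"
    then have [simp]: "\<mu> \<in> cell K" "src2 K \<mu> = bt (R_square f)" "trg2 K \<mu> = bt (R_square g)" by auto
    define \<gamma> where "\<gamma> = vinv M (fill (R_square g)) \<bullet>\<^sub>M (id2 M (e b) \<star>\<^sub>M f2 F \<mu>) \<bullet>\<^sub>M fill (R_square f)"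
    have "\<gamma> \<in> cell M" "src2 M \<gamma> = f \<odot>\<^sub>M e a" "trg2 M \<gamma> = g \<odot>\<^sub>M e a" by (auto simp: \<gamma>_def)
    then obtain \<alpha> where \<alpha>: "\<alpha> \<in> cell M" "src2 M \<alpha> = f" "trg2 M \<alpha> = g" "\<alpha> \<star>\<^sub>M id2 M (e a) = \<gamma>"
      by (rule M.equivalence_whisker_right_surj[OF eq[OF a]]) auto
    have "over (R_square f) (R_square g) \<mu> \<alpha>" unfolding over_def using \<alpha> by (simp add: \<gamma>_def)
    then have "f2 R \<alpha> = \<mu>"
      using over_unique[where b=b, OF over_f2R[OF \<alpha>(1-3)]] by simp
    then show "\<mu> \<in> f2 R ` cells M f g" using \<alpha> by auto
  qed
next
  fix v assume "v \<in> hom K (f0 R a) (f0 R b)"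
  then have [simp]: "v \<in> arr K" "src1 K v = r0 a" "trg1 K v = r0 b" by auto
  note [simp] = a b
  obtain k where k: "e a \<in> arr M" "k \<in> arr M" "src1 M k = trg1 M (e a)" "trg1 M k = src1 M (e a)"
    "isom M (k \<odot>\<^sub>M e a) (id1 M (src1 M (e a)))" "isom M (e a \<odot>\<^sub>M k) (id1 M (trg1 M (e a)))"
    "equivalence_1cell M k"
    by (rule M.equivalenceE[OF eq[OF a]])
  \<comment> \<open>For \<open>R g\<close> to be isomorphic to \<open>v\<close>,
    \<open>g \<odot> e a\<close> has to be isomorphic to \<open>e b \<odot> F v\<close>. Composing
    with the pseudoinverse \<open>k\<close> of \<open>e a\<close> solves this for
    \<open>g\<close>.\<close>
  define g where "g = e b \<odot>\<^sub>M f1 F v \<odot>\<^sub>M k"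
  have g [simp]: "g \<in> arr M" "src1 M g = a" "trg1 M g = b" using k by (auto simp: g_def)
  have "isom M ((e b \<odot>\<^sub>M f1 F v) \<odot>\<^sub>M k \<odot>\<^sub>M e a) ((e b \<odot>\<^sub>M f1 F v) \<odot>\<^sub>M id1 M (src1 M (e a)))"
    by (rule M.isom_left[OF k(5)]) (use k in auto)
  then have "isom M (g \<odot>\<^sub>M e a) (e b \<odot>\<^sub>M f1 F v)" using k by (simp add: g_def)
  then obtain \<sigma> where \<sigma>: "\<sigma> \<in> cell M" "iso_cell M \<sigma>" "src2 M \<sigma> = g \<odot>\<^sub>M e a" "trg2 M \<sigma> = e b \<odot>\<^sub>M f1 F v"
    by (rule M.isomE)
  \<comment> \<open>A second square with top \<open>g\<close>, now with the prescribed bottom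
    \<open>v\<close>. The identity of \<open>g\<close> lifts to an isomorphism between the two
    bottoms.\<close>
  define S where "S = \<lparr> dm = e a, cd = e b, bt = v, tp = g, fill = \<sigma> \<rparr>"
  have S [simp]: "dm S = e a" "cd S = e b" "bt S = v" "tp S = g" by (auto simp: S_def)
  have "square S" unfolding square_def using \<sigma> by (simp add: S_def)
  then have l: "over (R_square g) S (lift (R_square g) S (id2 M g)) (id2 M g)"
    by (intro over_lift[of _ b]) auto
  have "iso_cell K (lift (R_square g) S (id2 M g))"
    by (rule over_iso[OF l, of b]) auto
  then have "isom K (f1 R g) v" using overD(6,7)[OF l] by (intro K.isomI) auto
  then show "\<exists>f \<in> hom M a b. isom K (f1 R f) v" by (intro bexI[of _ g]) auto
qed

end

section \<open>Pseudofunctors that are equivalences on a hom-category\<close>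

text \<open>Essential surjectivity gives, by choice, the quasi-inverse on objects with its
  isomorphisms. Its action on arrows and the remaining natural isomorphism are unique preimages
  under the fully faithful functor.\<close>

lemma fully_faithful_cat_equivalence:
  assumes C: "category C" and D: "category D" and F: "cfunctor C D Fo Fa"
    and ff: "\<And>x y. x \<in> cobj C \<Longrightarrow> y \<in> cobj C \<Longrightarrow> bij_betw Fa (chom C x y) (chom D (Fo x) (Fo y))"
    and es: "\<And>d. d \<in> cobj D \<Longrightarrow> \<exists>c \<in> cobj C. \<exists>\<phi> \<in> chom D (Fo c) d. iso_arr D \<phi>"
  shows "cat_equivalence C D Fo Fa"
proof -
  interpret C: category C by fact
  interpret D: category D by fact
  interpret F: cfunctor C D Fo Fa by fact
  have "\<exists>c \<phi> \<psi>. c \<in> cobj C \<and> \<phi> \<in> chom D (Fo c) d \<and> \<psi> \<in> chom D d (Fo c) \<and>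
      ccomp D \<psi> \<phi> = cid D (Fo c) \<and> ccomp D \<phi> \<psi> = cid D d" if "d \<in> cobj D" for d
    using es[OF that] by (fastforce simp: iso_arr_def chom_def)
  then obtain Go \<phi> \<psi> where G: "\<And>d. d \<in> cobj D \<Longrightarrow> Go d \<in> cobj C" "\<And>d. d \<in> cobj D \<Longrightarrow> \<phi> d \<in> chom D (Fo (Go d)) d"
     "\<And>d. d \<in> cobj D \<Longrightarrow> \<psi> d \<in> chom D d (Fo (Go d))" "\<And>d. d \<in> cobj D \<Longrightarrow> ccomp D (\<psi> d) (\<phi> d) = cid D (Fo (Go d))"
     "\<And>d. d \<in> cobj D \<Longrightarrow> ccomp D (\<phi> d) (\<psi> d) = cid D d"
    by metis
  define inv where "inv x y = the_inv_into (chom C x y) Fa" for x y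
  have inv: "inv x y g \<in> chom C x y" "Fa (inv x y g) = g"
    if "x \<in> cobj C" "y \<in> cobj C" "g \<in> chom D (Fo x) (Fo y)" for x y g
    using ff[OF that(1,2)] that(3) unfolding inv_def bij_betw_def
    by (auto intro: the_inv_into_into f_the_inv_into_f)
  have inj: "f = g" if "f \<in> chom C x y" "g \<in> chom C x y" "Fa f = Fa g" for f g x y
  proof -
    have "x \<in> cobj C" "y \<in> cobj C" using that(1) C.src_trg by (auto simp: chom_def)
    then show ?thesis using ff[of x y] that by (auto simp: bij_betw_def inj_on_def)
  qed
  have homD: "x \<in> cobj D \<and> y \<in> cobj D" if "f \<in> chom D x y" for f x y
    using that D.src_trg by (auto simp: chom_def)
  have homC: "x \<in> cobj C \<and> y \<in> cobj C" if "f \<in> chom C x y" for f x y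
    using that C.src_trg by (auto simp: chom_def)
  \<comment> \<open>The preimage of \<open>g\<close> conjugated by the chosen isomorphisms, which
    makes \<open>\<phi>\<close> natural by construction.\<close>
  define Ga where "Ga g = inv (Go (csrc D g)) (Go (ctrg D g))
    (ccomp D (\<psi> (ctrg D g)) (ccomp D g (\<phi> (csrc D g))))" for g
  have Ga: "Ga g \<in> chom C (Go x) (Go y)" "Fa (Ga g) = ccomp D (\<psi> y) (ccomp D g (\<phi> x))"
    if g: "g \<in> chom D x y" for g x y
  proof -
    have "csrc D g = x" "ctrg D g = y" using g by (auto simp: chom_def)
    moreover have "ccomp D (\<psi> y) (ccomp D g (\<phi> x)) \<in> chom D (Fo (Go x)) (Fo (Go y))"
      using G(2,3) homD[OF g] g D.comp_hom by meson
    ultimately show "Ga g \<in> chom C (Go x) (Go y)" "Fa (Ga g) = ccomp D (\<psi> y) (ccomp D g (\<phi> x))"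
      using homD[OF g] G(1) unfolding Ga_def by (auto intro!: inv)
  qed
  have nat: "ccomp D (\<phi> y) (Fa (Ga g)) = ccomp D g (\<phi> x)" if g: "g \<in> chom D x y" for g x y
  proof -
    have xy: "x \<in> cobj D" "y \<in> cobj D" using homD[OF g] by auto
    have *: "ccomp D g (\<phi> x) \<in> chom D (Fo (Go x)) y" using D.comp_hom[OF G(2)[OF xy(1)] g] .
    have "ccomp D (\<phi> y) (Fa (Ga g)) = ccomp D (ccomp D (\<phi> y) (\<psi> y)) (ccomp D g (\<phi> x))"
      unfolding Ga(2)[OF g] by (rule D.assoc[OF * G(3)[OF xy(2)] G(2)[OF xy(2)]])
    then show ?thesis using G(5)[OF xy(2)] D.id_left[OF *] by simp
  qed
  have "cfunctor D C Go Ga"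
  proof (rule cfunctor.intro)
    fix x assume x: "x \<in> cobj D"
    then show "Go x \<in> cobj C" by (rule G)
    have i: "cid D x \<in> chom D x x" using D.id_hom[OF x] .
    show "Ga (cid D x) = cid C (Go x)"
      by (rule inj[OF Ga(1)[OF i] C.id_hom[OF G(1)[OF x]]])
        (use Ga(2)[OF i] D.id_left[OF G(2)[OF x]] G(4)[OF x] F.ident[OF G(1)[OF x]] in simp)
  next
    fix f x y assume "f \<in> chom D x y"
    then show "Ga f \<in> chom C (Go x) (Go y)" by (rule Ga)
  next
    fix f x y g z assume fg: "f \<in> chom D x y" "g \<in> chom D y z"
    have xyz: "x \<in> cobj D" "y \<in> cobj D" "z \<in> cobj D" using homD fg by auto
    have gf: "ccomp D g f \<in> chom D x z" using D.comp_hom[OF fg] .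
    have gp: "ccomp D g (\<phi> y) \<in> chom D (Fo (Go y)) z" using D.comp_hom[OF G(2)[OF xyz(2)] fg(2)] .
    have Ff: "Fa (Ga f) \<in> chom D (Fo (Go x)) (Fo (Go y))" using F.arr[OF Ga(1)[OF fg(1)]] .
    have "Fa (ccomp C (Ga g) (Ga f)) = ccomp D (ccomp D (\<psi> z) (ccomp D g (\<phi> y))) (Fa (Ga f))"
      using F.comp[OF Ga(1)[OF fg(1)] Ga(1)[OF fg(2)]] Ga(2)[OF fg(2)] by simp
    also have "\<dots> = ccomp D (\<psi> z) (ccomp D (ccomp D g (\<phi> y)) (Fa (Ga f)))"
      by (rule D.assoc[symmetric, OF Ff gp G(3)[OF xyz(3)]])
    also have "ccomp D (ccomp D g (\<phi> y)) (Fa (Ga f)) = ccomp D g (ccomp D (\<phi> y) (Fa (Ga f)))"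
      by (rule D.assoc[symmetric, OF Ff G(2)[OF xyz(2)] fg(2)])
    also have "\<dots> = ccomp D (ccomp D g f) (\<phi> x)"
      unfolding nat[OF fg(1)] by (rule D.assoc[OF G(2)[OF xyz(1)] fg])
    also have "ccomp D (\<psi> z) \<dots> = Fa (Ga (ccomp D g f))" using Ga(2)[OF gf] by simp
    finally show "Ga (ccomp D g f) = ccomp C (Ga g) (Ga f)"
      by (intro inj[OF Ga(1)[OF gf] C.comp_hom[OF Ga(1)[OF fg(1)] Ga(1)[OF fg(2)]]]) simp
  qed
  moreover have "nat_iso D D (Fo \<circ> Go) (Fa \<circ> Ga) id id \<phi>"
    unfolding nat_iso_def using G(2-5) nat by (fastforce simp: iso_arr_def chom_def)
  \<comment> \<open>The components are preimages of \<open>\<phi> (Fo x)\<close>. Since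
    \<open>Fa\<close> is injective on hom-sets, their invertibility and naturality are checked after
    applying \<open>Fa\<close>.\<close>
  moreover have "nat_iso C C (Go \<circ> Fo) (Ga \<circ> Fa) id id (\<lambda>x. inv (Go (Fo x)) x (\<phi> (Fo x)))"
  proof -
    define \<theta> where "\<theta> x = inv (Go (Fo x)) x (\<phi> (Fo x))" for x
    have \<theta>: "\<theta> x \<in> chom C (Go (Fo x)) x" "Fa (\<theta> x) = \<phi> (Fo x)" if "x \<in> cobj C" for x
      using inv[of "Go (Fo x)" x "\<phi> (Fo x)"] G(1,2)[OF F.obj[OF that]] that by (auto simp: \<theta>_def)
    have iso: "iso_arr C (\<theta> x)" if x: "x \<in> cobj C" for x
    proof -
      let ?j = "inv x (Go (Fo x)) (\<psi> (Fo x))"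
      note g = G[OF F.obj[OF x]]
      have j: "?j \<in> chom C x (Go (Fo x))" "Fa ?j = \<psi> (Fo x)"
        using inv[OF x g(1,3)] by auto
      have "ccomp C ?j (\<theta> x) = cid C (Go (Fo x))"
        by (rule inj[OF C.comp_hom[OF \<theta>(1)[OF x] j(1)] C.id_hom[OF g(1)]])
          (use F.comp[OF \<theta>(1)[OF x] j(1)] F.ident[OF g(1)] g(4) j \<theta>(2)[OF x] in simp)
      moreover have "ccomp C (\<theta> x) ?j = cid C x"
        by (rule inj[OF C.comp_hom[OF j(1) \<theta>(1)[OF x]] C.id_hom[OF x]])
          (use F.comp[OF j(1) \<theta>(1)[OF x]] F.ident[OF x] g(5) j \<theta>(2)[OF x] in simp)
      ultimately show ?thesis using j(1) \<theta>(1)[OF x] unfolding iso_arr_def by (auto simp: chom_def)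
    qed
    have "ccomp C (\<theta> y) (Ga (Fa f)) = ccomp C f (\<theta> x)" if f: "f \<in> chom C x y" for f x y
    proof -
      have xy: "x \<in> cobj C" "y \<in> cobj C" using homC[OF f] by auto
      show ?thesis
        by (rule inj[OF C.comp_hom[OF Ga(1)[OF F.arr[OF f]] \<theta>(1)[OF xy(2)]] C.comp_hom[OF \<theta>(1)[OF xy(1)] f]])
          (use F.comp[OF Ga(1)[OF F.arr[OF f]] \<theta>(1)[OF xy(2)]] F.comp[OF \<theta>(1)[OF xy(1)] f]
            nat[OF F.arr[OF f]] \<theta>(2)[OF xy(1)] \<theta>(2)[OF xy(2)] in simp)
    qed
    with \<theta>(1) iso show ?thesis unfolding nat_iso_def \<theta>_def[symmetric] by simp
  qed
  ultimately show ?thesis unfolding cat_equivalence_def using F by blast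
qed

lemma local_equiv_atD:
  assumes "local_equiv_at K M F x y"
  shows "f \<in> hom K x y \<Longrightarrow> g \<in> hom K x y \<Longrightarrow> \<alpha> \<in> cells K f g \<Longrightarrow> \<beta> \<in> cells K f g \<Longrightarrow> f2 F \<alpha> = f2 F \<beta> \<Longrightarrow> \<alpha> = \<beta>"
    and "f \<in> hom K x y \<Longrightarrow> g \<in> hom K x y \<Longrightarrow> \<gamma> \<in> cells M (f1 F f) (f1 F g) \<Longrightarrow> \<exists>\<alpha> \<in> cells K f g. f2 F \<alpha> = \<gamma>"
    and "h \<in> hom M (f0 F x) (f0 F y) \<Longrightarrow> \<exists>f \<in> hom K x y. isom M (f1 F f) h"
proof -
  assume fg: "f \<in> hom K x y" "g \<in> hom K x y"
  have b: "bij_betw (f2 F) (cells K f g) (cells M (f1 F f) (f1 F g))"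
    using assms fg unfolding local_equiv_at_def by blast
  show "\<alpha> \<in> cells K f g \<Longrightarrow> \<beta> \<in> cells K f g \<Longrightarrow> f2 F \<alpha> = f2 F \<beta> \<Longrightarrow> \<alpha> = \<beta>"
    using bij_betw_imp_inj_on[OF b] by (rule inj_onD)
  show "\<gamma> \<in> cells M (f1 F f) (f1 F g) \<Longrightarrow> \<exists>\<alpha> \<in> cells K f g. f2 F \<alpha> = \<gamma>"
    using bij_betw_imp_surj_on[OF b] by (metis imageE)
next
  show "h \<in> hom M (f0 F x) (f0 F y) \<Longrightarrow> \<exists>f \<in> hom K x y. isom M (f1 F f) h"
    using assms unfolding local_equiv_at_def by blast
qed

lemma local_equiv_atI:
  assumes "\<And>f g \<alpha>. f \<in> hom K x y \<Longrightarrow> g \<in> hom K x y \<Longrightarrow> \<alpha> \<in> cells K f g \<Longrightarrow>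
      f2 F \<alpha> \<in> cells M (f1 F f) (f1 F g)"
    and "\<And>f g \<alpha> \<beta>. f \<in> hom K x y \<Longrightarrow> g \<in> hom K x y \<Longrightarrow> \<alpha> \<in> cells K f g \<Longrightarrow> \<beta> \<in> cells K f g \<Longrightarrow>
      f2 F \<alpha> = f2 F \<beta> \<Longrightarrow> \<alpha> = \<beta>"
    and "\<And>f g \<gamma>. f \<in> hom K x y \<Longrightarrow> g \<in> hom K x y \<Longrightarrow> \<gamma> \<in> cells M (f1 F f) (f1 F g) \<Longrightarrow>
      \<exists>\<alpha> \<in> cells K f g. f2 F \<alpha> = \<gamma>"
    and "\<And>h. h \<in> hom M (f0 F x) (f0 F y) \<Longrightarrow> \<exists>f \<in> hom K x y. isom M (f1 F f) h"
  shows "local_equiv_at K M F x y"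
  unfolding local_equiv_at_def
proof (intro conjI ballI)
  fix f g assume fg: "f \<in> hom K x y" "g \<in> hom K x y"
  show "bij_betw (f2 F) (cells K f g) (cells M (f1 F f) (f1 F g))"
  proof (rule bij_betw_imageI)
    show "inj_on (f2 F) (cells K f g)" by (rule inj_onI, rule assms(2)[OF fg])
    show "f2 F ` cells K f g = cells M (f1 F f) (f1 F g)"
      using assms(1,3)[OF fg] by blast
  qed
qed (rule assms(4))

section \<open>Factoring 1-cells through equivalences\<close>

context two_category
begin

lemma isom_cancel_right:
  assumes w: "equivalence_1cell K w" and "isom K (p \<odot> w) (q \<odot> w)" "p \<in> arr K" "q \<in> arr K"
    "src1 K p = trg1 K w" "src1 K q = trg1 K w"
  shows "isom K p q"
proof -
  obtain k where k: "w \<in> arr K" "k \<in> arr K" "src1 K k = trg1 K w" "trg1 K k = src1 K w"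
    "isom K (k \<odot> w) (id1 K (src1 K w))" "isom K (w \<odot> k) (id1 K (trg1 K w))"
    "equivalence_1cell K k"
    by (rule equivalenceE[OF w])
  have r: "isom K (f \<odot> w \<odot> k) f" if "f \<in> arr K" "src1 K f = trg1 K w" for f
    using isom_left[OF k(6), of f] that k by simp
  have "isom K ((p \<odot> w) \<odot> k) ((q \<odot> w) \<odot> k)" by (rule isom_right[OF assms(2)]) (use assms k in auto)
  then have "isom K (p \<odot> w \<odot> k) (q \<odot> w \<odot> k)" using assms k by simp
  from isom_trans[OF isom_trans[OF isom_sym[OF r] this] r] show ?thesis using assms by simp
qed

lemma equivalence_lift_left:
  assumes w: "equivalence_1cell K w" and "p \<in> arr K" "trg1 K p = trg1 K w"
  obtains f where "f \<in> arr K" "src1 K f = src1 K p" "trg1 K f = src1 K w" "isom K (w \<odot> f) p"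
proof -
  obtain k where k: "w \<in> arr K" "k \<in> arr K" "src1 K k = trg1 K w" "trg1 K k = src1 K w"
    "isom K (k \<odot> w) (id1 K (src1 K w))" "isom K (w \<odot> k) (id1 K (trg1 K w))"
    "equivalence_1cell K k"
    by (rule equivalenceE[OF w])
  show thesis
    by (rule that[of "k \<odot> p"]) (use isom_right[OF k(6), of p] assms k in auto)
qed

lemma equivalence_lift_right:
  assumes w: "equivalence_1cell K w" and "p \<in> arr K" "src1 K p = src1 K w"
  obtains f where "f \<in> arr K" "src1 K f = trg1 K w" "trg1 K f = trg1 K p" "isom K (f \<odot> w) p"
proof -
  obtain k where k: "w \<in> arr K" "k \<in> arr K" "src1 K k = trg1 K w" "trg1 K k = src1 K w"
    "isom K (k \<odot> w) (id1 K (src1 K w))" "isom K (w \<odot> k) (id1 K (trg1 K w))"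
    "equivalence_1cell K k"
    by (rule equivalenceE[OF w])
  show thesis
    by (rule that[of "p \<odot> k"]) (use isom_left[OF k(5), of p] assms k in auto)
qed

lemma iso_arr_hom_cat:
  assumes "iso_cell K \<alpha>" "src2 K \<alpha> \<in> hom K x y"
  shows "iso_arr (hom_cat K x y) \<alpha>"
  unfolding iso_arr_def
  using assms iso_cell_cell[OF assms(1)]
  by (auto simp: hom_cat_def chom_def intro!: exI[of _ "vinv K \<alpha>"])

end

section \<open>From single hom-categories to local equivalence; change of source\<close>

context psf
begin

lemma local_equivalenceI:
  assumes "\<And>x y. x \<in> obj K \<Longrightarrow> y \<in> obj K \<Longrightarrow> local_equiv_at K M F x y"
  shows "local_equivalence K M F"
  unfolding local_equivalence_def
proof (intro conjI ballI)
  show "pseudofunctor K M F" by (rule pseudofunctor_axioms)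
  fix x y assume xy: "x \<in> obj K" "y \<in> obj K"
  note le = assms[OF xy]
  show "cat_equivalence (hom_cat K x y) (hom_cat M (f0 F x) (f0 F y)) (f1 F) (f2 F)"
  proof (rule fully_faithful_cat_equivalence)
    show "category (hom_cat K x y)" using K.hom_category xy by blast
    show "category (hom_cat M (f0 F x) (f0 F y))" using M.hom_category xy by simp
    show "cfunctor (hom_cat K x y) (hom_cat M (f0 F x) (f0 F y)) (f1 F) (f2 F)"
      using local_functor[OF xy] .
  next
    fix f g assume "f \<in> cobj (hom_cat K x y)" "g \<in> cobj (hom_cat K x y)"
    then have fg: "f \<in> hom K x y" "g \<in> hom K x y" by (auto simp: hom_cat_def)
    have "chom (hom_cat K x y) f g = cells K f g" using fg by (auto simp: K.chom_hom_cat)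
    moreover have "chom (hom_cat M (f0 F x) (f0 F y)) (f1 F f) (f1 F g) = cells M (f1 F f) (f1 F g)"
      using fg by (auto simp: M.chom_hom_cat)
    ultimately show "bij_betw (f2 F) (chom (hom_cat K x y) f g)
        (chom (hom_cat M (f0 F x) (f0 F y)) (f1 F f) (f1 F g))"
      using le fg unfolding local_equiv_at_def by simp
  next
    fix d assume "d \<in> cobj (hom_cat M (f0 F x) (f0 F y))"
    then obtain f where f: "f \<in> hom K x y" "isom M (f1 F f) d"
      using local_equiv_atD(3)[OF le, of d] by (auto simp: hom_cat_def)
    obtain \<phi> where \<phi>: "\<phi> \<in> cell M" "iso_cell M \<phi>" "src2 M \<phi> = f1 F f" "trg2 M \<phi> = d"
      by (rule M.isomE[OF f(2)])
    have "\<phi> \<in> chom (hom_cat M (f0 F x) (f0 F y)) (f1 F f) d" "iso_arr (hom_cat M (f0 F x) (f0 F y)) \<phi>"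
      using f(1) \<phi> by (auto simp: M.chom_hom_cat intro!: M.iso_arr_hom_cat)
    moreover have "f \<in> cobj (hom_cat K x y)" using f(1) by (simp add: hom_cat_def)
    ultimately show "\<exists>c \<in> cobj (hom_cat K x y). \<exists>\<phi> \<in> chom (hom_cat M (f0 F x) (f0 F y)) (f1 F c) d.
        iso_arr (hom_cat M (f0 F x) (f0 F y)) \<phi>" by blast
  qed
qed

lemma equivalence_f1:
  assumes "equivalence_1cell K f"
  shows "equivalence_1cell M (f1 F f)"
proof -
  obtain g where g: "f \<in> arr K" "g \<in> arr K" "src1 K g = trg1 K f" "trg1 K g = src1 K f"
    "isom K (g \<odot> f) (id1 K (src1 K f))" "isom K (f \<odot> g) (id1 K (trg1 K f))"
    "equivalence_1cell K g"
    by (rule K.equivalenceE[OF assms])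
  have "isom M (f1 F g \<odot>\<^sub>M f1 F f) (id1 M (f0 F (src1 K f)))"
    by (rule M.isom_trans[OF M.isom_trans[OF f1_comp_isom f1_isom[OF g(5)]] f1_id_isom]) (use g in auto)
  moreover have "isom M (f1 F f \<odot>\<^sub>M f1 F g) (id1 M (f0 F (trg1 K f)))"
    by (rule M.isom_trans[OF M.isom_trans[OF f1_comp_isom f1_isom[OF g(6)]] f1_id_isom]) (use g in auto)
  ultimately show ?thesis using g by (intro M.equivalenceI[of _ "f1 F g"]) auto
qed

text \<open>Precomposition with \<open>w\<close> and with \<open>F w\<close> are equivalences of
  hom-categories, and the compositor intertwines them with the two local functors of
  \<open>F\<close>.\<close>

lemma local_equiv_at_source:
  assumes le: "local_equiv_at K M F x y" and w: "equivalence_1cell K w" "src1 K w = x" "trg1 K w = x'"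
  shows "local_equiv_at K M F x' y"
proof -
  obtain k where k: "w \<in> arr K" "k \<in> arr K" "src1 K k = trg1 K w" "trg1 K k = src1 K w"
    "isom K (k \<odot> w) (id1 K (src1 K w))" "isom K (w \<odot> k) (id1 K (trg1 K w))"
    "equivalence_1cell K k"
    by (rule K.equivalenceE[OF w(1)])
  note Fw = equivalence_f1[OF w(1)]
  have nat: "f2 F (\<alpha> \<star> id2 K w) \<bullet>\<^sub>M fc F f w = fc F g w \<bullet>\<^sub>M (f2 F \<alpha> \<star>\<^sub>M id2 M (f1 F w))"
    if "\<alpha> \<in> cell K" "src2 K \<alpha> = f" "trg2 K \<alpha> = g" "src1 K f = x'" for \<alpha> f g
    using fc_nat[of "id2 K w" \<alpha> w w f g] that w k(1) by simp
  show ?thesis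
  proof (rule local_equiv_atI)
    fix f g \<alpha> assume "f \<in> hom K x' y" "g \<in> hom K x' y" "\<alpha> \<in> cells K f g"
    then show "f2 F \<alpha> \<in> cells M (f1 F f) (f1 F g)" by auto
  next
    fix f g \<alpha> \<beta> assume *: "f \<in> hom K x' y" "g \<in> hom K x' y" "\<alpha> \<in> cells K f g" "\<beta> \<in> cells K f g"
      "f2 F \<alpha> = f2 F \<beta>"
    have "f2 F (\<alpha> \<star> id2 K w) \<bullet>\<^sub>M fc F f w = f2 F (\<beta> \<star> id2 K w) \<bullet>\<^sub>M fc F f w"
      using nat[of \<alpha> f g] nat[of \<beta> f g] * by simp
    then have "f2 F (\<alpha> \<star> id2 K w) = f2 F (\<beta> \<star> id2 K w)"
      by (rule M.vcomp_cancel_right[rotated -1]) (use * w k(1) in auto)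
    then have "\<alpha> \<star> id2 K w = \<beta> \<star> id2 K w"
      by (rule local_equiv_atD(1)[OF le, rotated -1, where f="f \<odot> w" and g="g \<odot> w"]) (use * w k(1) in auto)
    then show "\<alpha> = \<beta>"
      by (rule K.equivalence_whisker_right_inj[OF w(1), rotated -1]) (use * w in auto)
  next
    fix f g \<gamma> assume *: "f \<in> hom K x' y" "g \<in> hom K x' y" "\<gamma> \<in> cells M (f1 F f) (f1 F g)"
    let ?\<gamma> = "fc F g w \<bullet>\<^sub>M (\<gamma> \<star>\<^sub>M id2 M (f1 F w)) \<bullet>\<^sub>M vinv M (fc F f w)"
    have "\<exists>\<rho> \<in> cells K (f \<odot> w) (g \<odot> w). f2 F \<rho> = ?\<gamma>"
      by (rule local_equiv_atD(2)[OF le]) (use * w k(1) in auto)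
    then obtain \<rho> where \<rho>: "\<rho> \<in> cell K" "src2 K \<rho> = f \<odot> w" "trg2 K \<rho> = g \<odot> w" "f2 F \<rho> = ?\<gamma>" by auto
    obtain \<alpha> where \<alpha>: "\<alpha> \<in> cell K" "src2 K \<alpha> = f" "trg2 K \<alpha> = g" "\<alpha> \<star> id2 K w = \<rho>"
      by (rule K.equivalence_whisker_right_surj[OF w(1) \<rho>(1-3)]) (use * w in auto)
    have "fc F g w \<bullet>\<^sub>M (f2 F \<alpha> \<star>\<^sub>M id2 M (f1 F w)) = fc F g w \<bullet>\<^sub>M (\<gamma> \<star>\<^sub>M id2 M (f1 F w))"
      using nat[of \<alpha> f g] \<alpha> \<rho>(4) * w k(1) by simp
    then have "f2 F \<alpha> \<star>\<^sub>M id2 M (f1 F w) = \<gamma> \<star>\<^sub>M id2 M (f1 F w)"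
      by (rule M.vcomp_cancel_left[rotated -1]) (use * w k(1) \<alpha> in auto)
    then have "f2 F \<alpha> = \<gamma>"
      by (rule M.equivalence_whisker_right_inj[OF Fw, rotated -1]) (use * w k(1) \<alpha> in auto)
    then show "\<exists>\<alpha> \<in> cells K f g. f2 F \<alpha> = \<gamma>" using \<alpha> by auto
  next
    fix h assume h: "h \<in> hom M (f0 F x') (f0 F y)"
    obtain f where f: "f \<in> hom K x y" "isom M (f1 F f) (h \<odot>\<^sub>M f1 F w)"
      using local_equiv_atD(3)[OF le, of "h \<odot>\<^sub>M f1 F w"] h w k(1) by auto
    obtain g where g: "g \<in> arr K" "src1 K g = trg1 K w" "trg1 K g = trg1 K f" "isom K (g \<odot> w) f"
      by (rule K.equivalence_lift_right[OF w(1), of f]) (use f w in auto)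
    have "isom M (f1 F g \<odot>\<^sub>M f1 F w) (h \<odot>\<^sub>M f1 F w)"
      by (rule M.isom_trans[OF M.isom_trans[OF f1_comp_isom f1_isom[OF g(4)]] f(2)]) (use g k(1) in auto)
    then have "isom M (f1 F g) h"
      by (rule M.isom_cancel_right[OF Fw]) (use g h w k(1) in auto)
    then show "\<exists>f \<in> hom K x' y. isom M (f1 F f) h" using g f w by auto
  qed
qed

end

section \<open>Composition and cancellation of local equivalences\<close>

lemma local_equiv_at_comp:
  assumes "pseudofunctor K M F" "two_category K" "two_category M" "psf M N G"
    and F: "local_equiv_at K M F x y" and G: "local_equiv_at M N G (f0 F x) (f0 F y)"
    and xy: "x \<in> obj K" "y \<in> obj K"
  shows "local_equiv_at K N (comp_psf N G F) x y"
proof -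
  interpret F: psf K M F using assms by (simp add: psf_def)
  interpret G: psf M N G by fact
  show ?thesis
  proof (rule local_equiv_atI)
    fix f g \<alpha> assume "f \<in> hom K x y" "g \<in> hom K x y" "\<alpha> \<in> cells K f g"
    then show "f2 (comp_psf N G F) \<alpha> \<in> cells N (f1 (comp_psf N G F) f) (f1 (comp_psf N G F) g)"
      by (simp add: comp_psf_def)
  next
    fix f g \<alpha> \<beta> assume *: "f \<in> hom K x y" "g \<in> hom K x y" "\<alpha> \<in> cells K f g" "\<beta> \<in> cells K f g"
      "f2 (comp_psf N G F) \<alpha> = f2 (comp_psf N G F) \<beta>"
    then have "f2 G (f2 F \<alpha>) = f2 G (f2 F \<beta>)" by (simp add: comp_psf_def)
    then have "f2 F \<alpha> = f2 F \<beta>"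
      by (rule local_equiv_atD(1)[OF G, rotated -1, where f="f1 F f" and g="f1 F g"]) (use * in auto)
    then show "\<alpha> = \<beta>" using local_equiv_atD(1)[OF F] * by blast
  next
    fix f g \<gamma> assume *: "f \<in> hom K x y" "g \<in> hom K x y"
      and \<gamma>: "\<gamma> \<in> cells N (f1 (comp_psf N G F) f) (f1 (comp_psf N G F) g)"
    have "\<exists>\<beta> \<in> cells M (f1 F f) (f1 F g). f2 G \<beta> = \<gamma>"
      by (rule local_equiv_atD(2)[OF G]) (use * \<gamma> in \<open>auto simp: comp_psf_def\<close>)
    then obtain \<beta> where \<beta>: "\<beta> \<in> cells M (f1 F f) (f1 F g)" "f2 G \<beta> = \<gamma>" by blast
    with local_equiv_atD(2)[OF F * \<beta>(1)] show "\<exists>\<alpha> \<in> cells K f g. f2 (comp_psf N G F) \<alpha> = \<gamma>"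
      by (auto simp: comp_psf_def)
  next
    fix h assume "h \<in> hom N (f0 (comp_psf N G F) x) (f0 (comp_psf N G F) y)"
    then have "h \<in> hom N (f0 G (f0 F x)) (f0 G (f0 F y))" by (simp add: comp_psf_def)
    from local_equiv_atD(3)[OF G this] obtain g where g: "g \<in> hom M (f0 F x) (f0 F y)" "isom N (f1 G g) h" by blast
    from local_equiv_atD(3)[OF F g(1)] obtain f where f: "f \<in> hom K x y" "isom M (f1 F f) g" by blast
    have "isom N (f1 (comp_psf N G F) f) h"
      using G.M.isom_trans[OF G.f1_isom[OF f(2)] g(2)] by (simp add: comp_psf_def)
    with f(1) show "\<exists>f \<in> hom K x y. isom N (f1 (comp_psf N G F) f) h" by blast
  qed
qed

text \<open>Every 1-cell from \<open>f0 F x\<close> to \<open>f0 F y\<close> is isomorphic to one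
  coming from \<open>K\<close>. Conjugating by such isomorphisms turns 2-cells of \<open>M\<close>
  into images under \<open>F\<close>, where the hypothesis on the composite applies.\<close>

lemma local_equiv_at_cancel:
  assumes "pseudofunctor K M F" "two_category K" "two_category M" "psf M N G"
    and F: "local_equiv_at K M F x y" and GF: "local_equiv_at K N (comp_psf N G F) x y"
    and xy: "x \<in> obj K" "y \<in> obj K"
  shows "local_equiv_at M N G (f0 F x) (f0 F y)"
proof -
  interpret F: psf K M F using assms by (simp add: psf_def)
  interpret G: psf M N G by fact
  show ?thesis
  proof (rule local_equiv_atI)
    fix f g \<alpha> assume "f \<in> hom M (f0 F x) (f0 F y)" "g \<in> hom M (f0 F x) (f0 F y)" "\<alpha> \<in> cells M f g"
    then show "f2 G \<alpha> \<in> cells N (f1 G f) (f1 G g)" by auto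
  next
    fix g g' assume g: "g \<in> hom M (f0 F x) (f0 F y)" and g': "g' \<in> hom M (f0 F x) (f0 F y)"
    from local_equiv_atD(3)[OF F g] obtain f where f: "f \<in> hom K x y" "isom M (f1 F f) g" by blast
    from local_equiv_atD(3)[OF F g'] obtain f' where f': "f' \<in> hom K x y" "isom M (f1 F f') g'" by blast
    obtain \<phi> where \<phi>: "\<phi> \<in> cell M" "iso_cell M \<phi>" "src2 M \<phi> = f1 F f" "trg2 M \<phi> = g"
      by (rule F.M.isomE[OF f(2)])
    obtain \<phi>' where \<phi>': "\<phi>' \<in> cell M" "iso_cell M \<phi>'" "src2 M \<phi>' = f1 F f'" "trg2 M \<phi>' = g'"
      by (rule F.M.isomE[OF f'(2)])
    have con: "\<exists>\<rho> \<in> cells K f f'. f2 F \<rho> = vinv M \<phi>' \<bullet>\<^bsub>M\<^esub> \<alpha> \<bullet>\<^bsub>M\<^esub> \<phi>" if "\<alpha> \<in> cells M g g'" for \<alpha>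
      by (rule local_equiv_atD(2)[OF F f(1) f'(1)]) (use that \<phi> \<phi>' in auto)
    show "\<alpha> = \<beta>" if *: "\<alpha> \<in> cells M g g'" "\<beta> \<in> cells M g g'" "f2 G \<alpha> = f2 G \<beta>" for \<alpha> \<beta>
    proof -
      obtain \<rho> where \<rho>: "\<rho> \<in> cells K f f'" "f2 F \<rho> = vinv M \<phi>' \<bullet>\<^bsub>M\<^esub> \<alpha> \<bullet>\<^bsub>M\<^esub> \<phi>" using con[OF *(1)] by blast
      obtain \<rho>' where \<rho>': "\<rho>' \<in> cells K f f'" "f2 F \<rho>' = vinv M \<phi>' \<bullet>\<^bsub>M\<^esub> \<beta> \<bullet>\<^bsub>M\<^esub> \<phi>" using con[OF *(2)] by blast
      have "f2 (comp_psf N G F) \<rho> = f2 (comp_psf N G F) \<rho>'"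
        using \<rho> \<rho>' * \<phi> \<phi>' by (simp add: comp_psf_def)
      then have "\<rho> = \<rho>'" using local_equiv_atD(1)[OF GF f(1) f'(1) \<rho>(1) \<rho>'(1)] by blast
      then have "vinv M \<phi>' \<bullet>\<^bsub>M\<^esub> (\<alpha> \<bullet>\<^bsub>M\<^esub> \<phi>) = vinv M \<phi>' \<bullet>\<^bsub>M\<^esub> (\<beta> \<bullet>\<^bsub>M\<^esub> \<phi>)" using \<rho>(2) \<rho>'(2) by simp
      then have "\<alpha> \<bullet>\<^bsub>M\<^esub> \<phi> = \<beta> \<bullet>\<^bsub>M\<^esub> \<phi>"
        by (rule F.M.vcomp_cancel_left[rotated -1]) (use * \<phi> \<phi>' in auto)
      then show ?thesis
        by (rule F.M.vcomp_cancel_right[rotated -1]) (use * \<phi> in auto)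
    qed
    show "\<exists>\<alpha> \<in> cells M g g'. f2 G \<alpha> = \<gamma>" if *: "\<gamma> \<in> cells N (f1 G g) (f1 G g')" for \<gamma>
    proof -
      have "\<exists>\<rho> \<in> cells K f f'. f2 (comp_psf N G F) \<rho> = f2 G (vinv M \<phi>') \<bullet>\<^bsub>N\<^esub> \<gamma> \<bullet>\<^bsub>N\<^esub> f2 G \<phi>"
        by (rule local_equiv_atD(2)[OF GF f(1) f'(1)]) (use * \<phi> \<phi>' in \<open>auto simp: comp_psf_def\<close>)
      then obtain \<rho> where \<rho>: "\<rho> \<in> cell K" "src2 K \<rho> = f" "trg2 K \<rho> = f'"
        "f2 G (f2 F \<rho>) = vinv N (f2 G \<phi>') \<bullet>\<^bsub>N\<^esub> \<gamma> \<bullet>\<^bsub>N\<^esub> f2 G \<phi>"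
        using \<phi>' by (auto simp: comp_psf_def G.vinv_f2)
      have "f2 G (\<phi>' \<bullet>\<^bsub>M\<^esub> f2 F \<rho> \<bullet>\<^bsub>M\<^esub> vinv M \<phi>) = f2 G \<phi>' \<bullet>\<^bsub>N\<^esub> f2 G (f2 F \<rho>) \<bullet>\<^bsub>N\<^esub> vinv N (f2 G \<phi>)"
        using \<rho>(1-3) \<phi> \<phi>' by (simp add: G.vinv_f2)
      also have "\<dots> = \<gamma>" unfolding \<rho>(4) using * \<phi> \<phi>' by simp
      finally show ?thesis using \<rho>(1-3) \<phi> \<phi>' by (intro bexI[of _ "\<phi>' \<bullet>\<^bsub>M\<^esub> f2 F \<rho> \<bullet>\<^bsub>M\<^esub> vinv M \<phi>"]) auto
    qed
  next
    fix h assume "h \<in> hom N (f0 G (f0 F x)) (f0 G (f0 F y))"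
    then have "h \<in> hom N (f0 (comp_psf N G F) x) (f0 (comp_psf N G F) y)" by (simp add: comp_psf_def)
    from local_equiv_atD(3)[OF GF this] obtain f where "f \<in> hom K x y" "isom N (f1 G (f1 F f)) h"
      by (auto simp: comp_psf_def)
    then show "\<exists>f \<in> hom M (f0 F x) (f0 F y). isom N (f1 G f) h" by (intro bexI[of _ "f1 F f"]) auto
  qed
qed

section \<open>Units and counits of biadjunctions\<close>

text \<open>Naturality of \<open>\<sigma>\<close> identifies whiskering \<open>G \<alpha>\<close>
  with \<open>\<sigma>\<close> at \<open>x\<close> and whiskering \<open>F \<alpha>\<close> with
  \<open>\<sigma>\<close> at \<open>y\<close>; both whiskerings are bijective on 2-cells. The typing
  of \<open>F\<close> and \<open>G\<close> is assumed in elementary form, so that for composites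
  \<open>comp_psf\<close> it follows by unfolding.\<close>

lemma local_equiv_at_transfer:
  assumes "two_category K" "two_category M" and \<sigma>: "pseudonatural K M F G \<sigma>"
    and x: "x \<in> obj K" "equivalence_1cell M (tr \<sigma> x)"
    and y: "y \<in> obj K" "equivalence_1cell M (tr \<sigma> y)"
    and F1: "\<And>f. f \<in> hom K x y \<Longrightarrow> f1 F f \<in> hom M (f0 F x) (f0 F y)"
    and F2: "\<And>f g \<alpha>. f \<in> hom K x y \<Longrightarrow> \<alpha> \<in> cells K f g \<Longrightarrow> f2 F \<alpha> \<in> cells M (f1 F f) (f1 F g)"
    and G1: "\<And>f. f \<in> hom K x y \<Longrightarrow> f1 G f \<in> hom M (f0 G x) (f0 G y)"
    and G2: "\<And>f g \<alpha>. f \<in> hom K x y \<Longrightarrow> \<alpha> \<in> cells K f g \<Longrightarrow> f2 G \<alpha> \<in> cells M (f1 G f) (f1 G g)"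
    and le: "local_equiv_at K M F x y"
  shows "local_equiv_at K M G x y"
proof -
  interpret K: two_category K by fact
  interpret M: two_category M by fact
  let ?x = "tr \<sigma> x" and ?y = "tr \<sigma> y"
  have t [simp]: "?x \<in> arr M" "src1 M ?x = f0 F x" "trg1 M ?x = f0 G x"
     "?y \<in> arr M" "src1 M ?y = f0 F y" "trg1 M ?y = f0 G y"
    using pseudonatural.tr_hom[OF \<sigma> x(1)] pseudonatural.tr_hom[OF \<sigma> y(1)] by auto
  have c: "tc \<sigma> f \<in> cell M" "src2 M (tc \<sigma> f) = f1 G f \<odot>\<^bsub>M\<^esub> ?x" "trg2 M (tc \<sigma> f) = ?y \<odot>\<^bsub>M\<^esub> f1 F f"
     "iso_cell M (tc \<sigma> f)" if "f \<in> hom K x y" for f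
    using pseudonatural.tc_iso[OF \<sigma> that] by auto
  note nat = pseudonatural.tc_natural[OF \<sigma>]
  show ?thesis
  proof (rule local_equiv_atI)
    fix f g \<alpha> assume "f \<in> hom K x y" "\<alpha> \<in> cells K f g"
    then show "f2 G \<alpha> \<in> cells M (f1 G f) (f1 G g)" by (rule G2)
  next
    fix f g \<alpha> \<beta> assume f: "f \<in> hom K x y" and g: "g \<in> hom K x y"
      and a: "\<alpha> \<in> cells K f g" and b: "\<beta> \<in> cells K f g" and eq: "f2 G \<alpha> = f2 G \<beta>"
    note [simp] = c[OF f] c[OF g] F1[OF f, simplified] F1[OF g, simplified]
      F2[OF f a, simplified] F2[OF f b, simplified]
    have "(id2 M ?y \<star>\<^bsub>M\<^esub> f2 F \<alpha>) \<bullet>\<^bsub>M\<^esub> tc \<sigma> f = (id2 M ?y \<star>\<^bsub>M\<^esub> f2 F \<beta>) \<bullet>\<^bsub>M\<^esub> tc \<sigma> f"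
      using nat[OF f a] nat[OF f b] eq by simp
    then have "id2 M ?y \<star>\<^bsub>M\<^esub> f2 F \<alpha> = id2 M ?y \<star>\<^bsub>M\<^esub> f2 F \<beta>"
      by (rule M.vcomp_cancel_right[rotated -1]) auto
    then have "f2 F \<alpha> = f2 F \<beta>"
      by (rule M.equivalence_whisker_left_inj[OF y(2), rotated -1]) auto
    then show "\<alpha> = \<beta>" by (rule local_equiv_atD(1)[OF le f g a b])
  next
    fix f g \<gamma> assume f: "f \<in> hom K x y" and g: "g \<in> hom K x y" and \<gamma>: "\<gamma> \<in> cells M (f1 G f) (f1 G g)"
    note [simp] = c[OF f] c[OF g] F1[OF f, simplified] F1[OF g, simplified]
      G1[OF f, simplified] G1[OF g, simplified] \<gamma>[simplified]
    let ?\<delta> = "tc \<sigma> g \<bullet>\<^bsub>M\<^esub> (\<gamma> \<star>\<^bsub>M\<^esub> id2 M ?x) \<bullet>\<^bsub>M\<^esub> vinv M (tc \<sigma> f)"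
    obtain \<delta> where \<delta>: "\<delta> \<in> cell M" "src2 M \<delta> = f1 F f" "trg2 M \<delta> = f1 F g" "id2 M ?y \<star>\<^bsub>M\<^esub> \<delta> = ?\<delta>"
      by (rule M.equivalence_whisker_left_surj[OF y(2), of ?\<delta> "f1 F f" "f1 F g"]) auto
    obtain \<alpha> where \<alpha>: "\<alpha> \<in> cells K f g" "f2 F \<alpha> = \<delta>"
      using local_equiv_atD(2)[OF le f g, of \<delta>] \<delta> by auto
    note [simp] = G2[OF f \<alpha>(1), simplified]
    have "tc \<sigma> g \<bullet>\<^bsub>M\<^esub> (f2 G \<alpha> \<star>\<^bsub>M\<^esub> id2 M ?x) = tc \<sigma> g \<bullet>\<^bsub>M\<^esub> (\<gamma> \<star>\<^bsub>M\<^esub> id2 M ?x)"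
      using nat[OF f \<alpha>(1)] \<alpha>(2) \<delta>(4) by simp
    then have "f2 G \<alpha> \<star>\<^bsub>M\<^esub> id2 M ?x = \<gamma> \<star>\<^bsub>M\<^esub> id2 M ?x"
      by (rule M.vcomp_cancel_left[rotated -1]) auto
    then have "f2 G \<alpha> = \<gamma>"
      by (rule M.equivalence_whisker_right_inj[OF x(2), rotated -1]) auto
    then show "\<exists>\<alpha> \<in> cells K f g. f2 G \<alpha> = \<gamma>" using \<alpha>(1) by blast
  next
    fix h assume "h \<in> hom M (f0 G x) (f0 G y)"
    then have h [simp]: "h \<in> arr M" "src1 M h = f0 G x" "trg1 M h = f0 G y" by auto
    obtain p where p: "p \<in> arr M" "src1 M p = src1 M (h \<odot>\<^bsub>M\<^esub> ?x)" "trg1 M p = src1 M ?y"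
        "isom M (?y \<odot>\<^bsub>M\<^esub> p) (h \<odot>\<^bsub>M\<^esub> ?x)"
      by (rule M.equivalence_lift_left[OF y(2), of "h \<odot>\<^bsub>M\<^esub> ?x"]) auto
    obtain f where f: "f \<in> hom K x y" "isom M (f1 F f) p"
      using local_equiv_atD(3)[OF le, of p] p by auto
    note [simp] = F1[OF f(1), simplified] G1[OF f(1), simplified] c[OF f(1)]
    have "isom M (f1 G f \<odot>\<^bsub>M\<^esub> ?x) (?y \<odot>\<^bsub>M\<^esub> f1 F f)" by (rule M.isomI[of "tc \<sigma> f"]) auto
    moreover have "isom M (?y \<odot>\<^bsub>M\<^esub> f1 F f) (?y \<odot>\<^bsub>M\<^esub> p)" by (rule M.isom_left[OF f(2)]) auto
    ultimately have "isom M (f1 G f \<odot>\<^bsub>M\<^esub> ?x) (h \<odot>\<^bsub>M\<^esub> ?x)"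
      using M.isom_trans[OF M.isom_trans p(4)] by blast
    then have "isom M (f1 G f) h"
      by (rule M.isom_cancel_right[OF x(2)]) auto
    then show "\<exists>f \<in> hom K x y. isom M (f1 G f) h" using f(1) by blast
  qed
qed

lemma pseudonatural_equivalence_inverse:
  assumes "two_category M" and \<sigma>: "pseudonatural_equivalence K M F G \<sigma>"
  obtains \<tau> where "pseudonatural K M G F \<tau>" "\<And>x. x \<in> obj K \<Longrightarrow> equivalence_1cell M (tr \<tau> x)"
    "\<And>x. x \<in> obj K \<Longrightarrow> equivalence_1cell M (tr \<sigma> x)"
proof -
  interpret M: two_category M by fact
  obtain \<tau> \<Gamma> \<Delta> where t: "pseudonatural K M F G \<sigma>" "pseudonatural K M G F \<tau>"
    "invertible_modification K M F F (id_psn M F) (vcomp_psn K M \<tau> \<sigma>) \<Gamma>"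
    "invertible_modification K M G G (vcomp_psn K M \<sigma> \<tau>) (id_psn M G) \<Delta>"
    using \<sigma> unfolding pseudonatural_equivalence_def by blast
  have "equivalence_1cell M (tr \<tau> x) \<and> equivalence_1cell M (tr \<sigma> x)" if x: "x \<in> obj K" for x
  proof -
    have [simp]: "tr \<sigma> x \<in> arr M" "src1 M (tr \<sigma> x) = f0 F x" "trg1 M (tr \<sigma> x) = f0 G x"
      "tr \<tau> x \<in> arr M" "src1 M (tr \<tau> x) = f0 G x" "trg1 M (tr \<tau> x) = f0 F x"
      using pseudonatural.tr_hom[OF t(1) x] pseudonatural.tr_hom[OF t(2) x] by auto
    have "isom M (id1 M (f0 F x)) (tr \<tau> x \<odot>\<^bsub>M\<^esub> tr \<sigma> x)"
      using invertible_modification.component[OF t(3) x]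
      by (intro M.isomI[of "\<Gamma> x"]) (auto simp: id_psn_def vcomp_psn_def)
    then have 1: "isom M (tr \<tau> x \<odot>\<^bsub>M\<^esub> tr \<sigma> x) (id1 M (f0 F x))" by (rule M.isom_sym)
    have 2: "isom M (tr \<sigma> x \<odot>\<^bsub>M\<^esub> tr \<tau> x) (id1 M (f0 G x))"
      using invertible_modification.component[OF t(4) x]
      by (intro M.isomI[of "\<Delta> x"]) (auto simp: id_psn_def vcomp_psn_def)
    show ?thesis
      using 1 2 M.equivalenceI[of "tr \<tau> x" "tr \<sigma> x"] M.equivalenceI[of "tr \<sigma> x" "tr \<tau> x"] by simp
  qed
  with t show thesis using that by blast
qed

section \<open>Full sub-2-categories\<close>

lemma two_category_full_sub:
  assumes "two_category K"
  shows "two_category (full_sub K S)"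
proof -
  interpret K: two_category K by fact
  have hc: "hom_cat (full_sub K S) x y = hom_cat K x y" if "x \<in> S" "y \<in> S" for x y
    using that by (auto simp: hom_cat_def full_sub_def hom_def)
  show ?thesis
  proof (rule two_category.intro)
    fix x y assume "x \<in> obj (full_sub K S)" "y \<in> obj (full_sub K S)"
    then show "category (hom_cat (full_sub K S) x y)"
      using hc K.hom_category by (simp add: full_sub_def)
  qed (simp_all add: full_sub_def K.interchange')
qed

text \<open>Fullness on 1-cells and 2-cells keeps the pseudoinverse and both isomorphisms inside the
  sub-2-category.\<close>

lemma equivalence_full_sub:
  assumes "two_category K" "equivalence_1cell K f" "src1 K f \<in> S" "trg1 K f \<in> S"
  shows "equivalence_1cell (full_sub K S) f"
proof -
  interpret K: two_category K by fact
  interpret S: two_category "full_sub K S" by (rule two_category_full_sub) fact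
  obtain g where g: "f \<in> arr K" "g \<in> arr K" "src1 K g = trg1 K f" "trg1 K g = src1 K f"
    "isom K (g \<odot>\<^bsub>K\<^esub> f) (id1 K (src1 K f))" "isom K (f \<odot>\<^bsub>K\<^esub> g) (id1 K (trg1 K f))"
    "equivalence_1cell K g"
    by (rule K.equivalenceE[OF assms(2)])
  have sub: "isom (full_sub K S) p q" if i: "isom K p q" and S: "src1 K p \<in> S" "trg1 K p \<in> S" for p q
  proof -
    obtain \<alpha> where \<alpha>: "\<alpha> \<in> cell K" "iso_cell K \<alpha>" "src2 K \<alpha> = p" "trg2 K \<alpha> = q"
      by (rule K.isomE[OF i])
    have "src1 K q \<in> S" "trg1 K q \<in> S" using K.isom_arr[OF i] S by auto
    then have "iso_cell (full_sub K S) \<alpha>"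
      using \<alpha> S by (intro S.iso_cellI(1)[of \<alpha> "vinv K \<alpha>"]) (auto simp: full_sub_def)
    then show ?thesis by (rule S.isomI) (use \<alpha> in \<open>auto simp: full_sub_def\<close>)
  qed
  show ?thesis
    by (rule S.equivalenceI[of f g])
      (use g assms(3,4) sub[OF g(5)] sub[OF g(6)] in \<open>auto simp: full_sub_def\<close>)
qed

section \<open>Consequences of a biadjunction for units, counits and the left biadjoint\<close>

locale biadj = K: two_category K + M: two_category M + biadjunction K M L U \<eta> \<epsilon> s t
  for K :: "('o, 'a, 'c) two_cat" and M :: "('p, 'b, 'd) two_cat"
    and L :: "('o, 'a, 'c, 'p, 'b, 'd) psfun" and U :: "('p, 'b, 'd, 'o, 'a, 'c) psfun"
    and \<eta> :: "('o, 'a, 'a, 'c) psnat" and \<epsilon> :: "('p, 'b, 'b, 'd) psnat"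
    and s :: "'o \<Rightarrow> 'd" and t :: "'p \<Rightarrow> 'c"
begin

lemma psf_L: "psf K M L" and psf_U: "psf M K U"
  using L U K.two_category_axioms M.two_category_axioms by (auto simp: psf_def)

interpretation L: psf K M L by (rule psf_L)
interpretation U: psf M K U by (rule psf_U)

lemma unit_simps [simp]:
  assumes "x \<in> obj K"
  shows "tr \<eta> x \<in> arr K" "src1 K (tr \<eta> x) = x" "trg1 K (tr \<eta> x) = f0 U (f0 L x)"
  using pseudonatural.tr_hom[OF \<eta> assms] by (auto simp: id_psf_def comp_psf_def)

lemma counit_simps [simp]:
  assumes "y \<in> obj M"
  shows "tr \<epsilon> y \<in> arr M" "src1 M (tr \<epsilon> y) = f0 L (f0 U y)" "trg1 M (tr \<epsilon> y) = y"
  using pseudonatural.tr_hom[OF \<epsilon> assms] by (auto simp: id_psf_def comp_psf_def)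

lemma unit_cell [simp]:
  assumes "f \<in> arr K"
  shows "tc \<eta> f \<in> cell K" "src2 K (tc \<eta> f) = f1 U (f1 L f) \<odot>\<^bsub>K\<^esub> tr \<eta> (src1 K f)"
    "trg2 K (tc \<eta> f) = tr \<eta> (trg1 K f) \<odot>\<^bsub>K\<^esub> f" "iso_cell K (tc \<eta> f)"
  using pseudonatural.tc_iso[OF \<eta>, of f "src1 K f" "trg1 K f"] assms
  by (auto simp: id_psf_def comp_psf_def)

lemma counit_cell [simp]:
  assumes "f \<in> arr M"
  shows "tc \<epsilon> f \<in> cell M" "src2 M (tc \<epsilon> f) = f \<odot>\<^bsub>M\<^esub> tr \<epsilon> (src1 M f)"
    "trg2 M (tc \<epsilon> f) = tr \<epsilon> (trg1 M f) \<odot>\<^bsub>M\<^esub> f1 L (f1 U f)" "iso_cell M (tc \<epsilon> f)"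
  using pseudonatural.tc_iso[OF \<epsilon>, of f "src1 M f" "trg1 M f"] assms
  by (auto simp: id_psf_def comp_psf_def)

lemma unit_isom: "f \<in> arr K \<Longrightarrow>
    isom K (f1 U (f1 L f) \<odot>\<^bsub>K\<^esub> tr \<eta> (src1 K f)) (tr \<eta> (trg1 K f) \<odot>\<^bsub>K\<^esub> f)"
  by (rule K.isomI[of "tc \<eta> f"]) auto

lemma counit_isom: "f \<in> arr M \<Longrightarrow>
    isom M (f \<odot>\<^bsub>M\<^esub> tr \<epsilon> (src1 M f)) (tr \<epsilon> (trg1 M f) \<odot>\<^bsub>M\<^esub> f1 L (f1 U f))"
  by (rule M.isomI[of "tc \<epsilon> f"]) auto

lemma unit_natural:
  assumes "\<alpha> \<in> cell K" "src2 K \<alpha> = f" "trg2 K \<alpha> = g"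
  shows "(id2 K (tr \<eta> (trg1 K f)) \<star>\<^bsub>K\<^esub> \<alpha>) \<bullet>\<^bsub>K\<^esub> tc \<eta> f =
    tc \<eta> g \<bullet>\<^bsub>K\<^esub> (f2 U (f2 L \<alpha>) \<star>\<^bsub>K\<^esub> id2 K (tr \<eta> (src1 K f)))"
  using pseudonatural.tc_natural[OF \<eta>, of f "src1 K f" "trg1 K f" \<alpha> g] assms K.cell_arr(1)[of \<alpha>]
  by (auto simp: id_psf_def comp_psf_def)

lemma counit_natural:
  assumes "\<alpha> \<in> cell M" "src2 M \<alpha> = f" "trg2 M \<alpha> = g"
  shows "(id2 M (tr \<epsilon> (trg1 M f)) \<star>\<^bsub>M\<^esub> f2 L (f2 U \<alpha>)) \<bullet>\<^bsub>M\<^esub> tc \<epsilon> f =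
    tc \<epsilon> g \<bullet>\<^bsub>M\<^esub> (\<alpha> \<star>\<^bsub>M\<^esub> id2 M (tr \<epsilon> (src1 M f)))"
  using pseudonatural.tc_natural[OF \<epsilon>, of f "src1 M f" "trg1 M f" \<alpha> g] assms M.cell_arr(1)[of \<alpha>]
  by (auto simp: id_psf_def comp_psf_def)

lemma triangle_L:
  assumes "x \<in> obj K"
  shows "isom M (tr \<epsilon> (f0 L x) \<odot>\<^bsub>M\<^esub> f1 L (tr \<eta> x)) (id1 M (f0 L x))"
  using invertible_modification.component[OF s assms]
  by (intro M.isom_sym[OF M.isomI[of "s x"]]) (auto simp: id_psn_def vcomp_psn_def psn_right_def psn_left_def)

lemma triangle_U:
  assumes "y \<in> obj M"
  shows "isom K (f1 U (tr \<epsilon> y) \<odot>\<^bsub>K\<^esub> tr \<eta> (f0 U y)) (id1 K (f0 U y))"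
  using invertible_modification.component[OF t assms]
  by (intro K.isomI[of "t y"]) (auto simp: id_psn_def vcomp_psn_def psn_right_def psn_left_def)

text \<open>Applying \<open>L\<close> and whiskering with the counit undoes transposition: by
  naturality of the counit it produces \<open>\<alpha>\<close> whiskered with
  \<open>\<epsilon> \<odot> L \<eta>\<close>, a 1-cell isomorphic to an identity by the triangle, so
  that \<open>\<alpha>\<close> can be recovered.\<close>

lemma transpose_faithful:
  assumes x: "x \<in> obj K" and "\<alpha> \<in> cell M" "\<beta> \<in> cell M" "src2 M \<beta> = src2 M \<alpha>" "trg2 M \<beta> = trg2 M \<alpha>"
    and src: "src1 M (src2 M \<alpha>) = f0 L x"
    and eq: "f2 U \<alpha> \<star>\<^bsub>K\<^esub> id2 K (tr \<eta> x) = f2 U \<beta> \<star>\<^bsub>K\<^esub> id2 K (tr \<eta> x)"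
  shows "\<alpha> = \<beta>"
proof -
  let ?n = "tr \<eta> x" and ?Ln = "f1 L (tr \<eta> x)"
  define v w y where "v = src2 M \<alpha>" and "w = trg2 M \<alpha>" and "y = trg1 M v"
  have [simp]: "src2 M \<alpha> = v" "trg2 M \<alpha> = w" "src2 M \<beta> = v" "trg2 M \<beta> = w" "v \<in> arr M" "w \<in> arr M"
    "src1 M v = f0 L x" "trg1 M v = y" "src1 M w = f0 L x" "trg1 M w = y" "y \<in> obj M"
    using assms M.cell_arr[OF assms(2)] by (auto simp: v_def w_def y_def)
  note [simp] = assms(1-3)
  have "f2 L (f2 U \<gamma> \<star>\<^bsub>K\<^esub> id2 K ?n) \<bullet>\<^bsub>M\<^esub> fc L (f1 U v) ?n = fc L (f1 U w) ?n \<bullet>\<^bsub>M\<^esub> (f2 L (f2 U \<gamma>) \<star>\<^bsub>M\<^esub> id2 M ?Ln)"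
    if "\<gamma> \<in> cell M" "src2 M \<gamma> = v" "trg2 M \<gamma> = w" for \<gamma>
    using L.fc_nat[of "id2 K ?n" "f2 U \<gamma>" ?n ?n "f1 U v" "f1 U w"] that by simp
  from this[of \<alpha>] this[of \<beta>] eq
  have "fc L (f1 U w) ?n \<bullet>\<^bsub>M\<^esub> (f2 L (f2 U \<alpha>) \<star>\<^bsub>M\<^esub> id2 M ?Ln) = fc L (f1 U w) ?n \<bullet>\<^bsub>M\<^esub> (f2 L (f2 U \<beta>) \<star>\<^bsub>M\<^esub> id2 M ?Ln)"
    by simp
  then have 1: "f2 L (f2 U \<alpha>) \<star>\<^bsub>M\<^esub> id2 M ?Ln = f2 L (f2 U \<beta>) \<star>\<^bsub>M\<^esub> id2 M ?Ln"
    by (rule M.vcomp_cancel_left[rotated -1]) auto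
  have "(tc \<epsilon> w \<bullet>\<^bsub>M\<^esub> (\<gamma> \<star>\<^bsub>M\<^esub> id2 M (tr \<epsilon> (f0 L x)))) \<star>\<^bsub>M\<^esub> id2 M ?Ln =
      (id2 M (tr \<epsilon> y) \<star>\<^bsub>M\<^esub> (f2 L (f2 U \<gamma>) \<star>\<^bsub>M\<^esub> id2 M ?Ln)) \<bullet>\<^bsub>M\<^esub> (tc \<epsilon> v \<star>\<^bsub>M\<^esub> id2 M ?Ln)"
    if "\<gamma> \<in> cell M" "src2 M \<gamma> = v" "trg2 M \<gamma> = w" for \<gamma>
    using arg_cong[OF counit_natural[OF that], of "\<lambda>\<delta>. \<delta> \<star>\<^bsub>M\<^esub> id2 M ?Ln"] that by simp
  from this[of \<alpha>] this[of \<beta>] 1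
  have "(tc \<epsilon> w \<star>\<^bsub>M\<^esub> id2 M ?Ln) \<bullet>\<^bsub>M\<^esub> (\<alpha> \<star>\<^bsub>M\<^esub> id2 M (tr \<epsilon> (f0 L x) \<odot>\<^bsub>M\<^esub> ?Ln)) =
    (tc \<epsilon> w \<star>\<^bsub>M\<^esub> id2 M ?Ln) \<bullet>\<^bsub>M\<^esub> (\<beta> \<star>\<^bsub>M\<^esub> id2 M (tr \<epsilon> (f0 L x) \<odot>\<^bsub>M\<^esub> ?Ln))"
    by simp
  then have 2: "\<alpha> \<star>\<^bsub>M\<^esub> id2 M (tr \<epsilon> (f0 L x) \<odot>\<^bsub>M\<^esub> ?Ln) = \<beta> \<star>\<^bsub>M\<^esub> id2 M (tr \<epsilon> (f0 L x) \<odot>\<^bsub>M\<^esub> ?Ln)"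
    by (rule M.vcomp_cancel_left[rotated -1]) auto
  have "equivalence_1cell M (tr \<epsilon> (f0 L x) \<odot>\<^bsub>M\<^esub> ?Ln)"
    by (rule M.equivalence_isom[OF M.equivalence_id1 M.isom_sym[OF triangle_L[OF x]]]) simp
  then show ?thesis
    by (rule M.equivalence_whisker_right_inj[OF _ _ _ _ _ _ 2]) auto
qed

text \<open>Transposition compares 1-cells \<open>L x \<rightarrow> L y\<close> with 1-cells
  \<open>x \<rightarrow> U (L y)\<close>. Under it \<open>L\<close> becomes, up to naturality of the
  unit, composition with the unit at \<open>y\<close>, an equivalence by assumption.\<close>

lemma local_equiv_at_unit:
  assumes x: "x \<in> obj K" and y: "y \<in> obj K" and n: "equivalence_1cell K (tr \<eta> y)"
  shows "local_equiv_at K M L x y"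
proof (rule local_equiv_atI)
  fix f g \<alpha> assume "f \<in> hom K x y" "g \<in> hom K x y" "\<alpha> \<in> cells K f g"
  then show "f2 L \<alpha> \<in> cells M (f1 L f) (f1 L g)" by auto
next
  note [simp] = x y
  fix f g \<alpha> \<beta> assume *: "f \<in> hom K x y" "g \<in> hom K x y" "\<alpha> \<in> cells K f g" "\<beta> \<in> cells K f g"
    "f2 L \<alpha> = f2 L \<beta>"
  have "(id2 K (tr \<eta> y) \<star>\<^bsub>K\<^esub> \<alpha>) \<bullet>\<^bsub>K\<^esub> tc \<eta> f = (id2 K (tr \<eta> y) \<star>\<^bsub>K\<^esub> \<beta>) \<bullet>\<^bsub>K\<^esub> tc \<eta> f"
    using unit_natural[of \<alpha> f g] unit_natural[of \<beta> f g] * by simp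
  then have "id2 K (tr \<eta> y) \<star>\<^bsub>K\<^esub> \<alpha> = id2 K (tr \<eta> y) \<star>\<^bsub>K\<^esub> \<beta>"
    by (rule K.vcomp_cancel_right[rotated -1]) (use * in auto)
  then show "\<alpha> = \<beta>" by (rule K.equivalence_whisker_left_inj[OF n, rotated -1]) (use * in auto)
next
  note [simp] = x y
  fix f g \<gamma> assume "f \<in> hom K x y" "g \<in> hom K x y" and \<gamma>: "\<gamma> \<in> cells M (f1 L f) (f1 L g)"
  then have [simp]: "f \<in> arr K" "g \<in> arr K" "src1 K f = x" "src1 K g = x" "trg1 K f = y" "trg1 K g = y" by auto
  note [simp] = \<gamma>[simplified]
  \<comment> \<open>The transpose of \<open>\<gamma>\<close>, conjugated so that it runs from
    \<open>tr \<eta> y \<odot> f\<close> to \<open>tr \<eta> y \<odot> g\<close> and can be factored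
    through the unit at \<open>y\<close>.\<close>
  let ?\<delta> = "tc \<eta> g \<bullet>\<^bsub>K\<^esub> (f2 U \<gamma> \<star>\<^bsub>K\<^esub> id2 K (tr \<eta> x)) \<bullet>\<^bsub>K\<^esub> vinv K (tc \<eta> f)"
  obtain \<alpha> where \<alpha>: "\<alpha> \<in> cell K" "src2 K \<alpha> = f" "trg2 K \<alpha> = g" "id2 K (tr \<eta> y) \<star>\<^bsub>K\<^esub> \<alpha> = ?\<delta>"
    by (rule K.equivalence_whisker_left_surj[OF n, of ?\<delta> f g]) auto
  have "tc \<eta> g \<bullet>\<^bsub>K\<^esub> (f2 U (f2 L \<alpha>) \<star>\<^bsub>K\<^esub> id2 K (tr \<eta> x)) = tc \<eta> g \<bullet>\<^bsub>K\<^esub> (f2 U \<gamma> \<star>\<^bsub>K\<^esub> id2 K (tr \<eta> x))"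
    using unit_natural[OF \<alpha>(1-3)] \<alpha>(4) by simp
  then have "f2 U (f2 L \<alpha>) \<star>\<^bsub>K\<^esub> id2 K (tr \<eta> x) = f2 U \<gamma> \<star>\<^bsub>K\<^esub> id2 K (tr \<eta> x)"
    by (rule K.vcomp_cancel_left[rotated -1]) (use \<alpha> in auto)
  then have "f2 L \<alpha> = \<gamma>"
    by (rule transpose_faithful[OF x, rotated -1]) (use \<alpha> in auto)
  then show "\<exists>\<alpha> \<in> cells K f g. f2 L \<alpha> = \<gamma>" using \<alpha> by auto
next
  note [simp] = x y
  fix v assume "v \<in> hom M (f0 L x) (f0 L y)"
  then have [simp]: "v \<in> arr M" "src1 M v = f0 L x" "trg1 M v = f0 L y" by auto
  obtain f where f: "f \<in> arr K" "src1 K f = src1 K (f1 U v \<odot>\<^bsub>K\<^esub> tr \<eta> x)" "trg1 K f = src1 K (tr \<eta> y)"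
      "isom K (tr \<eta> y \<odot>\<^bsub>K\<^esub> f) (f1 U v \<odot>\<^bsub>K\<^esub> tr \<eta> x)"
    by (rule K.equivalence_lift_left[OF n, of "f1 U v \<odot>\<^bsub>K\<^esub> tr \<eta> x"]) auto
  have [simp]: "f \<in> arr K" "src1 K f = x" "trg1 K f = y" using f by auto
  let ?e = "tr \<epsilon> (f0 L y)"
  \<comment> \<open>\<open>f\<close> was obtained by factoring the transpose of \<open>v\<close>
    through the unit at \<open>y\<close>. Transposing back, the chain reaches \<open>v\<close> by
    naturality of the counit and the triangle at \<open>x\<close>.\<close>
  have "isom M (f1 L f) (?e \<odot>\<^bsub>M\<^esub> f1 L (tr \<eta> y) \<odot>\<^bsub>M\<^esub> f1 L f)"
    using M.isom_sym[OF M.isom_right[OF triangle_L[OF y], of "f1 L f"]] by simp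
  also have "isom M \<dots> (?e \<odot>\<^bsub>M\<^esub> f1 L (tr \<eta> y \<odot>\<^bsub>K\<^esub> f))"
    by (rule M.isom_left[OF L.f1_comp_isom]) auto
  also have "isom M \<dots> (?e \<odot>\<^bsub>M\<^esub> f1 L (f1 U v \<odot>\<^bsub>K\<^esub> tr \<eta> x))"
    by (rule M.isom_left[OF L.f1_isom[OF f(4)]]) auto
  also have "isom M \<dots> (?e \<odot>\<^bsub>M\<^esub> f1 L (f1 U v) \<odot>\<^bsub>M\<^esub> f1 L (tr \<eta> x))"
    by (rule M.isom_left[OF M.isom_sym[OF L.f1_comp_isom]]) auto
  also have "isom M \<dots> (v \<odot>\<^bsub>M\<^esub> tr \<epsilon> (f0 L x) \<odot>\<^bsub>M\<^esub> f1 L (tr \<eta> x))"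
    using M.isom_right[OF M.isom_sym[OF counit_isom[of v]], of "f1 L (tr \<eta> x)"] by simp
  also have "isom M \<dots> v"
    using M.isom_left[OF triangle_L[OF x], of v] by simp
  finally show "\<exists>f \<in> hom K x y. isom M (f1 L f) v" by (intro bexI[of _ f]) auto
qed

text \<open>The naturality square of the unit at \<open>w\<close> has the equivalences
  \<open>w\<close> and \<open>U (L w)\<close> as two of its sides; two out of three gives the
  claim.\<close>

lemma unit_equivalence_transport:
  assumes w: "equivalence_1cell K w" and n: "equivalence_1cell K (tr \<eta> (trg1 K w))"
  shows "equivalence_1cell K (tr \<eta> (src1 K w))"
proof -
  have [simp]: "w \<in> arr K" using w by (auto simp: equivalence_1cell_def)
  have "equivalence_1cell K (tr \<eta> (trg1 K w) \<odot>\<^bsub>K\<^esub> w)"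
    using K.equivalence_comp1[OF w n] by simp
  then have "equivalence_1cell K (f1 U (f1 L w) \<odot>\<^bsub>K\<^esub> tr \<eta> (src1 K w))"
    by (rule K.equivalence_isom[OF _ K.isom_sym[OF unit_isom]]) simp
  then show ?thesis
    by (rule K.equivalence_cancel_left[OF _ U.equivalence_f1[OF L.equivalence_f1[OF w]]]) auto
qed

text \<open>The comparison is \<open>U\<close> with codomain \<open>Ps_Alg K \<eta>\<close>, so its
  typing on objects already contains the claim.\<close>

lemma unit_equivalence:
  assumes "pseudomonadic K M U \<eta>" "y \<in> obj M"
  shows "equivalence_1cell K (tr \<eta> (f0 U y))"
proof -
  have "f0 U y \<in> obj (Ps_Alg K \<eta>)"
    using assms unfolding pseudomonadic_def biequivalence_def by (blast dest: pseudofunctor.f0_obj)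
  then show ?thesis by (simp add: Ps_Alg_def full_sub_def admits_pseudoalgebra_def)
qed

lemma counit_equivalence:
  assumes pm: "pseudomonadic K M U \<eta>" and y: "y \<in> obj M"
  shows "equivalence_1cell M (tr \<epsilon> y)"
proof -
  note [simp] = y
  let ?S = "{x. admits_pseudoalgebra K \<eta> x}"
  have adm: "f0 U z \<in> ?S" if "z \<in> obj M" for z
    using unit_equivalence[OF pm that] that by (simp add: admits_pseudoalgebra_def)
  have "equivalence_1cell K (f1 U (tr \<epsilon> y) \<odot>\<^bsub>K\<^esub> tr \<eta> (f0 U y))"
    by (rule K.equivalence_isom[OF K.equivalence_id1 K.isom_sym[OF triangle_U[OF y]]]) simp
  then have "equivalence_1cell K (f1 U (tr \<epsilon> y))"
    by (rule K.equivalence_cancel_right[OF _ unit_equivalence[OF pm y]]) auto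
  \<comment> \<open>\<open>G\<close> is defined on \<open>Ps_Alg K \<eta>\<close> and preserves
    equivalences of that 2-category, so the pseudoinverse has to live there.\<close>
  then have eq: "equivalence_1cell (Ps_Alg K \<eta>) (f1 U (tr \<epsilon> y))"
    unfolding Ps_Alg_def
    by (rule equivalence_full_sub[OF K.two_category_axioms]) (use adm in simp_all)
  obtain G where G: "pseudofunctor (Ps_Alg K \<eta>) M G"
    "pseudonaturally_equivalent M M (comp_psf M G U) (id_psf M)"
    using pm unfolding pseudomonadic_def biequivalence_def by blast
  interpret G: psf "Ps_Alg K \<eta>" M G
    using G(1) M.two_category_axioms two_category_full_sub[OF K.two_category_axioms]
    unfolding psf_def Ps_Alg_def by blast
  obtain \<sigma> where \<sigma>: "pseudonatural_equivalence M M (comp_psf M G U) (id_psf M) \<sigma>"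
    using G(2) unfolding pseudonaturally_equivalent_def by blast
  have \<sigma>': "pseudonatural M M (comp_psf M G U) (id_psf M) \<sigma>"
    using \<sigma> by (simp add: pseudonatural_equivalence_def)
  have e\<sigma>: "equivalence_1cell M (tr \<sigma> z)" if "z \<in> obj M" for z
    by (rule pseudonatural_equivalence_inverse[OF M.two_category_axioms \<sigma>]) (use that in blast)
  have h\<sigma>: "tr \<sigma> z \<in> arr M" "src1 M (tr \<sigma> z) = f0 G (f0 U z)" "trg1 M (tr \<sigma> z) = z" if "z \<in> obj M" for z
    using pseudonatural.tr_hom[OF \<sigma>' that] by (auto simp: comp_psf_def id_psf_def)
  let ?z = "f0 L (f0 U y)"
  \<comment> \<open>Naturality of \<open>\<sigma>\<close> at the counit: the components of
    \<open>\<sigma>\<close> and \<open>G (U \<epsilon>)\<close> are equivalences, hence so is the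
    fourth side, the counit.\<close>
  have iso: "isom M (tr \<epsilon> y \<odot>\<^bsub>M\<^esub> tr \<sigma> ?z) (tr \<sigma> y \<odot>\<^bsub>M\<^esub> f1 G (f1 U (tr \<epsilon> y)))"
    using pseudonatural.tc_iso[OF \<sigma>', of "tr \<epsilon> y" ?z y]
    by (intro M.isomI[of "tc \<sigma> (tr \<epsilon> y)"]) (auto simp: comp_psf_def id_psf_def)
  have "src1 M (tr \<sigma> y \<odot>\<^bsub>M\<^esub> f1 G (f1 U (tr \<epsilon> y))) = src1 M (tr \<sigma> ?z)"
    using M.isom_arr(3)[OF iso] h\<sigma>[of ?z] by simp
  have "trg1 M (f1 G (f1 U (tr \<epsilon> y))) = src1 M (tr \<sigma> y)"
    using G.f1_simps(3)[of "f1 U (tr \<epsilon> y)"] eq h\<sigma>[of y]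
    by (auto simp: equivalence_1cell_def Ps_Alg_def full_sub_def)
  then have "equivalence_1cell M (tr \<sigma> y \<odot>\<^bsub>M\<^esub> f1 G (f1 U (tr \<epsilon> y)))"
    by (intro M.equivalence_comp1[OF G.equivalence_f1[OF eq] e\<sigma>[OF y]])
  then have "equivalence_1cell M (tr \<epsilon> y \<odot>\<^bsub>M\<^esub> tr \<sigma> ?z)"
    by (rule M.equivalence_isom[OF _ M.isom_sym[OF iso]])
  then show ?thesis
    by (rule M.equivalence_cancel_right[OF _ e\<sigma>]) (use h\<sigma>[of ?z] in auto)
qed

end

section \<open>The lifting theorem\<close>

text \<open>Fullness lifts the isomorphism and its inverse separately; faithfulness makes the two
  lifts inverse to each other.\<close>

lemma local_equiv_at_comp_reflect:
  assumes "psf K M F" "psf M N G" and le: "local_equiv_at K N (comp_psf N G F) x y"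
    and f: "f \<in> hom K x y" and g: "g \<in> hom K x y" and iso: "isom N (f1 G (f1 F f)) (f1 G (f1 F g))"
  shows "isom K f g"
proof -
  interpret F: psf K M F by fact
  interpret G: psf M N G by fact
  obtain \<gamma> where \<gamma>: "\<gamma> \<in> cell N" "iso_cell N \<gamma>" "src2 N \<gamma> = f1 G (f1 F f)" "trg2 N \<gamma> = f1 G (f1 F g)"
    by (rule G.M.isomE[OF iso])
  have "\<exists>\<alpha> \<in> cells K f g. f2 (comp_psf N G F) \<alpha> = \<gamma>"
    by (rule local_equiv_atD(2)[OF le f g]) (use \<gamma> in \<open>auto simp: comp_psf_def\<close>)
  then obtain \<alpha> where \<alpha>: "\<alpha> \<in> cell K" "src2 K \<alpha> = f" "trg2 K \<alpha> = g" "f2 G (f2 F \<alpha>) = \<gamma>"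
    by (auto simp: comp_psf_def)
  have "\<exists>\<beta> \<in> cells K g f. f2 (comp_psf N G F) \<beta> = vinv N \<gamma>"
    by (rule local_equiv_atD(2)[OF le g f]) (use \<gamma> in \<open>auto simp: comp_psf_def\<close>)
  then obtain \<beta> where \<beta>: "\<beta> \<in> cell K" "src2 K \<beta> = g" "trg2 K \<beta> = f" "f2 G (f2 F \<beta>) = vinv N \<gamma>"
    by (auto simp: comp_psf_def)
  have "\<beta> \<bullet>\<^bsub>K\<^esub> \<alpha> = id2 K f"
    by (rule local_equiv_atD(1)[OF le f f]) (use \<alpha> \<beta> \<gamma> f g in \<open>auto simp: comp_psf_def\<close>)
  moreover have "\<alpha> \<bullet>\<^bsub>K\<^esub> \<beta> = id2 K g"
    by (rule local_equiv_atD(1)[OF le g g]) (use \<alpha> \<beta> \<gamma> f g in \<open>auto simp: comp_psf_def\<close>)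
  ultimately have "iso_cell K \<alpha>"
    using \<alpha> \<beta> by (intro F.K.iso_cellI(1)[of \<alpha> \<beta>]) auto
  then show ?thesis using \<alpha> by (intro F.K.isomI) auto
qed

locale lifting_square =
  LA: biadj \<BB> \<AA> LA A \<eta>A \<epsilon>A sA tA + LB: biadj \<CC> \<BB> LB B \<eta>B \<epsilon>B sB tB +
  LC: biadj \<CC> \<HH> LC C \<eta>C \<epsilon>C sC tC + E: pseudofunctor \<HH> \<AA> E
  for \<AA> :: "('oA, 'aA, 'cA) two_cat" and \<BB> :: "('oB, 'aB, 'cB) two_cat"
    and \<CC> :: "('oC, 'aC, 'cC) two_cat" and \<HH> :: "('oH, 'aH, 'cH) two_cat"
    and LA A \<eta>A \<epsilon>A sA tA LB B \<eta>B \<epsilon>B sB tB LC C \<eta>C \<epsilon>C sC tC E +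
  fixes \<sigma> :: "('oC, 'aC, 'aA, 'cA) psnat"
  assumes \<sigma>: "pseudonatural_equivalence \<CC> \<AA> (comp_psf \<AA> E LC) (comp_psf \<AA> LA LB) \<sigma>"
    and pmA: "pseudomonadic \<BB> \<AA> A \<eta>A" and pmB: "pseudomonadic \<CC> \<BB> B \<eta>B"
    and pmC: "pseudomonadic \<CC> \<HH> C \<eta>C"
begin

lemma psf_E: "psf \<HH> \<AA> E"
  using E.pseudofunctor_axioms LA.M.two_category_axioms LC.M.two_category_axioms by (simp add: psf_def)

interpretation E: psf \<HH> \<AA> E by (rule psf_E)
interpretation lA: psf \<BB> \<AA> LA by (rule LA.psf_L)
interpretation uA: psf \<AA> \<BB> A by (rule LA.psf_U)
interpretation lB: psf \<CC> \<BB> LB by (rule LB.psf_L)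
interpretation uB: psf \<BB> \<CC> B by (rule LB.psf_U)
interpretation lC: psf \<CC> \<HH> LC by (rule LC.psf_L)
interpretation uC: psf \<HH> \<CC> C by (rule LC.psf_U)

text \<open>The unit of \<open>B\<close> at \<open>x\<close> controls \<open>LB\<close>, and the
  unit of \<open>A\<close> at \<open>LB x\<close> controls \<open>LA\<close>. The composite is
  transferred along \<open>\<tau>\<close> because \<open>\<sigma>\<close> points from
  \<open>E \<circ> LC\<close> to \<open>LA \<circ> LB\<close>.\<close>

lemma local_equiv_at_E_LC:
  assumes x: "x \<in> obj \<CC>" "equivalence_1cell \<CC> (tr \<eta>B x)" "equivalence_1cell \<BB> (tr \<eta>A (f0 LB x))"
    and z: "z \<in> obj \<CC>"
  shows "local_equiv_at \<CC> \<AA> (comp_psf \<AA> E LC) z x"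
proof -
  obtain \<tau> where \<tau>: "pseudonatural \<CC> \<AA> (comp_psf \<AA> LA LB) (comp_psf \<AA> E LC) \<tau>"
    "\<And>x. x \<in> obj \<CC> \<Longrightarrow> equivalence_1cell \<AA> (tr \<tau> x)"
    by (rule pseudonatural_equivalence_inverse[OF LA.M.two_category_axioms \<sigma>]) blast
  have "local_equiv_at \<CC> \<AA> (comp_psf \<AA> LA LB) z x"
    by (rule local_equiv_at_comp[OF lB.pseudofunctor_axioms LB.K.two_category_axioms
          LA.K.two_category_axioms LA.psf_L LB.local_equiv_at_unit LA.local_equiv_at_unit])
      (use x z in auto)
  then show ?thesis
    by (intro local_equiv_at_transfer[OF LB.K.two_category_axioms LA.M.two_category_axioms \<tau>(1) z \<tau>(2)[OF z]
          x(1) \<tau>(2)[OF x(1)]])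
      (auto simp: comp_psf_def)
qed

text \<open>
  The unit at \<open>x\<close> is inverted by \<open>E \<circ> LC\<close>, which is a local equivalence at \<open>(T x, x)\<close>, so its
  inverse lifts to a retraction \<open>r\<close> of the unit; naturality of the unit at \<open>r\<close> then
  shows that \<open>r\<close> is a pseudoinverse.
\<close>

lemma unit_C_equivalence:
  assumes x: "x \<in> obj \<CC>" "equivalence_1cell \<CC> (tr \<eta>B x)" "equivalence_1cell \<BB> (tr \<eta>A (f0 LB x))"
  shows "equivalence_1cell \<CC> (tr \<eta>C x)"
proof -
  note [simp] = x(1)
  let ?n = "tr \<eta>C x" and ?T = "f0 C (f0 LC x)"
  have "equivalence_1cell \<HH> (tr \<epsilon>C (f0 LC x) \<odot>\<^bsub>\<HH>\<^esub> f1 LC ?n)"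
    by (rule LC.M.equivalence_isom[OF LC.M.equivalence_id1 LC.M.isom_sym[OF LC.triangle_L[OF x(1)]]]) simp
  \<comment> \<open>By the triangle, \<open>LC\<close> of the unit is a right factor of an
    equivalence whose left factor, the counit, is an equivalence.\<close>
  then have Ln: "equivalence_1cell \<HH> (f1 LC ?n)"
    by (rule LC.M.equivalence_cancel_left[OF _ LC.counit_equivalence[OF pmC]]) auto
  obtain g where g: "f1 E (f1 LC ?n) \<in> arr \<AA>" "g \<in> arr \<AA>" "src1 \<AA> g = trg1 \<AA> (f1 E (f1 LC ?n))"
    "trg1 \<AA> g = src1 \<AA> (f1 E (f1 LC ?n))"
    "isom \<AA> (g \<odot>\<^bsub>\<AA>\<^esub> f1 E (f1 LC ?n)) (id1 \<AA> (src1 \<AA> (f1 E (f1 LC ?n))))"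
    "isom \<AA> (f1 E (f1 LC ?n) \<odot>\<^bsub>\<AA>\<^esub> g) (id1 \<AA> (trg1 \<AA> (f1 E (f1 LC ?n))))" "equivalence_1cell \<AA> g"
    by (rule LA.M.equivalenceE[OF E.equivalence_f1[OF Ln]])
  obtain r where r: "r \<in> hom \<CC> ?T x" "isom \<AA> (f1 E (f1 LC r)) g"
    using local_equiv_atD(3)[OF local_equiv_at_E_LC[OF x, of ?T], of g] g(2-4)
    by (auto simp: comp_psf_def)
  then have [simp]: "r \<in> arr \<CC>" "src1 \<CC> r = ?T" "trg1 \<CC> r = x" by auto
  have "isom \<AA> (f1 E (f1 LC (r \<odot>\<^bsub>\<CC>\<^esub> ?n))) (f1 E (f1 LC r \<odot>\<^bsub>\<HH>\<^esub> f1 LC ?n))"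
    by (rule E.f1_isom[OF LC.M.isom_sym[OF lC.f1_comp_isom]]) auto
  also have "isom \<AA> \<dots> (f1 E (f1 LC r) \<odot>\<^bsub>\<AA>\<^esub> f1 E (f1 LC ?n))"
    by (rule LA.M.isom_sym[OF E.f1_comp_isom]) auto
  also have "isom \<AA> \<dots> (g \<odot>\<^bsub>\<AA>\<^esub> f1 E (f1 LC ?n))"
    by (rule LA.M.isom_right[OF r(2)]) auto
  also have "isom \<AA> \<dots> (id1 \<AA> (f0 E (f0 LC x)))"
    using g(5) by simp
  also have "isom \<AA> \<dots> (f1 E (id1 \<HH> (f0 LC x)))"
    by (rule LA.M.isom_sym[OF E.f1_id_isom]) simp
  also have "isom \<AA> \<dots> (f1 E (f1 LC (id1 \<CC> x)))"
    by (rule E.f1_isom[OF LC.M.isom_sym[OF lC.f1_id_isom]]) simp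
  finally have "isom \<AA> (f1 E (f1 LC (r \<odot>\<^bsub>\<CC>\<^esub> ?n))) (f1 E (f1 LC (id1 \<CC> x)))" .
  then have retr: "isom \<CC> (r \<odot>\<^bsub>\<CC>\<^esub> ?n) (id1 \<CC> x)"
    by (intro local_equiv_at_comp_reflect[OF LC.psf_L psf_E local_equiv_at_E_LC[OF x x(1)]]) auto
  let ?Tr = "f1 C (f1 LC r)" and ?Tn = "f1 C (f1 LC ?n)"
  have Tn: "equivalence_1cell \<CC> ?Tn" by (rule uC.equivalence_f1[OF Ln])
  have "isom \<CC> (?Tr \<odot>\<^bsub>\<CC>\<^esub> ?Tn) (f1 C (f1 LC r \<odot>\<^bsub>\<HH>\<^esub> f1 LC ?n))"
    by (rule uC.f1_comp_isom) auto
  also have "isom \<CC> \<dots> (f1 C (f1 LC (r \<odot>\<^bsub>\<CC>\<^esub> ?n)))"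
    by (rule uC.f1_isom[OF lC.f1_comp_isom]) auto
  also have "isom \<CC> \<dots> (f1 C (f1 LC (id1 \<CC> x)))"
    by (rule uC.f1_isom[OF lC.f1_isom[OF retr]])
  also have "isom \<CC> \<dots> (f1 C (id1 \<HH> (f0 LC x)))"
    by (rule uC.f1_isom[OF lC.f1_id_isom]) simp
  also have "isom \<CC> \<dots> (id1 \<CC> ?T)"
    by (rule uC.f1_id_isom) simp
  finally have "equivalence_1cell \<CC> (?Tr \<odot>\<^bsub>\<CC>\<^esub> ?Tn)"
    by (intro LB.K.equivalence_isom[OF LB.K.equivalence_id1 LB.K.isom_sym]) auto
  then have "equivalence_1cell \<CC> ?Tr"
    by (rule LB.K.equivalence_cancel_right[OF _ Tn]) auto
  \<comment> \<open>The unit is an equivalence at \<open>?T\<close> because this object is a value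
    of \<open>C\<close>. By naturality the composite is isomorphic to
    \<open>?n \<odot> r\<close>.\<close>
  then have "equivalence_1cell \<CC> (?Tr \<odot>\<^bsub>\<CC>\<^esub> tr \<eta>C ?T)"
    using LC.unit_equivalence[OF pmC, of "f0 LC x"] by (intro LB.K.equivalence_comp1) auto
  then have "equivalence_1cell \<CC> (?n \<odot>\<^bsub>\<CC>\<^esub> r)"
    by (rule LB.K.equivalence_isom) (use LC.unit_isom[of r] in simp)
  then obtain k where k: "?n \<odot>\<^bsub>\<CC>\<^esub> r \<in> arr \<CC>" "k \<in> arr \<CC>" "src1 \<CC> k = trg1 \<CC> (?n \<odot>\<^bsub>\<CC>\<^esub> r)"
    "trg1 \<CC> k = src1 \<CC> (?n \<odot>\<^bsub>\<CC>\<^esub> r)"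
    "isom \<CC> (k \<odot>\<^bsub>\<CC>\<^esub> ?n \<odot>\<^bsub>\<CC>\<^esub> r) (id1 \<CC> (src1 \<CC> (?n \<odot>\<^bsub>\<CC>\<^esub> r)))"
    "isom \<CC> ((?n \<odot>\<^bsub>\<CC>\<^esub> r) \<odot>\<^bsub>\<CC>\<^esub> k) (id1 \<CC> (trg1 \<CC> (?n \<odot>\<^bsub>\<CC>\<^esub> r)))" "equivalence_1cell \<CC> k"
    by (rule LB.K.equivalenceE)
  \<comment> \<open>\<open>r\<close> is a left pseudoinverse of the unit, and
    \<open>r \<odot> k\<close> a right one.\<close>
  show ?thesis
    by (rule LB.K.equivalence_two_sided[where g=r and h="r \<odot>\<^bsub>\<CC>\<^esub> k"]) (use retr k in auto)
qed

definition r0 :: "'oA \<Rightarrow> 'oH" where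
  "r0 a = f0 LC (f0 B (f0 A a))"

definition e :: "'oA \<Rightarrow> 'aA" where
  "e a = tr \<epsilon>A a \<odot>\<^bsub>\<AA>\<^esub> f1 LA (tr \<epsilon>B (f0 A a)) \<odot>\<^bsub>\<AA>\<^esub> tr \<sigma> (f0 B (f0 A a))"

lemma e_equivalence:
  assumes [simp]: "a \<in> obj \<AA>"
  shows "equivalence_1cell \<AA> (e a)" "src1 \<AA> (e a) = f0 E (r0 a)" "trg1 \<AA> (e a) = a"
proof -
  let ?x = "f0 B (f0 A a)"
  have \<sigma>': "pseudonatural \<CC> \<AA> (comp_psf \<AA> E LC) (comp_psf \<AA> LA LB) \<sigma>"
    using \<sigma> by (simp add: pseudonatural_equivalence_def)
  have [simp]: "tr \<sigma> ?x \<in> arr \<AA>" "src1 \<AA> (tr \<sigma> ?x) = f0 E (f0 LC ?x)" "trg1 \<AA> (tr \<sigma> ?x) = f0 LA (f0 LB ?x)"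
    using pseudonatural.tr_hom[OF \<sigma>', of ?x] by (auto simp: comp_psf_def)
  have s: "equivalence_1cell \<AA> (tr \<sigma> ?x)"
    by (rule pseudonatural_equivalence_inverse[OF LA.M.two_category_axioms \<sigma>]) simp
  have b: "equivalence_1cell \<AA> (f1 LA (tr \<epsilon>B (f0 A a)))"
    by (rule lA.equivalence_f1[OF LB.counit_equivalence[OF pmB]]) simp
  show "equivalence_1cell \<AA> (e a)"
    unfolding e_def
    by (intro LA.M.equivalence_comp1 s b LA.counit_equivalence[OF pmA]) auto
  show "src1 \<AA> (e a) = f0 E (r0 a)" "trg1 \<AA> (e a) = a"
    by (auto simp: e_def r0_def)
qed

lemma local_equiv_at_E:
  assumes [simp]: "a \<in> obj \<AA>" "k \<in> obj \<HH>"
  shows "local_equiv_at \<HH> \<AA> E k (r0 a)"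
proof -
  let ?x = "f0 B (f0 A a)"
  have 1: "equivalence_1cell \<CC> (tr \<eta>B ?x)" by (rule LB.unit_equivalence[OF pmB]) simp
  \<comment> \<open>The counit of \<open>B\<close> at \<open>A a\<close> is an equivalence from
    \<open>LB ?x\<close> to \<open>A a\<close>, where the unit of \<open>A\<close> is an
    equivalence; this is transported back along the counit.\<close>
  have 2: "equivalence_1cell \<BB> (tr \<eta>A (f0 LB ?x))"
    using LA.unit_equivalence_transport[OF LB.counit_equivalence[OF pmB, of "f0 A a"]]
      LA.unit_equivalence[OF pmA, of a] by simp
  have 3: "equivalence_1cell \<CC> (tr \<eta>C ?x)" by (rule unit_C_equivalence[OF _ 1 2]) simp
  \<comment> \<open>Cancelling \<open>LC\<close> requires a source in its image.
    \<open>LC (C k)\<close> is one, and the counit at \<open>k\<close> then allows the source to be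
    changed to \<open>k\<close>.\<close>
  let ?z = "f0 C k"
  have "local_equiv_at \<HH> \<AA> E (f0 LC ?z) (f0 LC ?x)"
    by (rule local_equiv_at_cancel[OF lC.pseudofunctor_axioms LB.K.two_category_axioms
          LC.M.two_category_axioms psf_E LC.local_equiv_at_unit[OF _ _ 3] local_equiv_at_E_LC[OF _ 1 2]])
      auto
  then show ?thesis unfolding r0_def
    by (rule E.local_equiv_at_source[OF _ LC.counit_equivalence[OF pmC assms(2)]]) auto
qed

text \<open>Composing with the equivalence \<open>e b\<close> preserves the local equivalence of
  \<open>E\<close> with target \<open>r0 b\<close>; fullness, faithfulness and essential
  surjectivity of the composite are the conditions of \<open>biuniversal\<close>.\<close>

lemma biuniversal_E: "biuniversal \<HH> \<AA> E r0 e"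
proof (intro biuniversal.intro psf_E biuniversal_axioms.intro)
  note [simp] = e_equivalence(2,3)
  have [simp]: "e b \<in> arr \<AA>" if "b \<in> obj \<AA>" for b
    using e_equivalence(1)[OF that] by (simp add: equivalence_1cell_def)
  fix b assume b [simp]: "b \<in> obj \<AA>"
  show "r0 b \<in> obj \<HH>" by (simp add: r0_def)
  show "e b \<in> arr \<AA>" "src1 \<AA> (e b) = f0 E (r0 b)" "trg1 \<AA> (e b) = b" by simp_all
  note eq = e_equivalence(1)[OF b]
  fix x u v assume "u \<in> hom \<HH> x (r0 b)" "v \<in> hom \<HH> x (r0 b)"
  then have uv [simp]: "u \<in> arr \<HH>" "src1 \<HH> u = x" "trg1 \<HH> u = r0 b" "v \<in> arr \<HH>" "src1 \<HH> v = x" "trg1 \<HH> v = r0 b"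
    "x \<in> obj \<HH>" by auto
  note le = local_equiv_at_E[OF b uv(7)]
  show "\<exists>\<mu> \<in> cells \<HH> u v. id2 \<AA> (e b) \<star>\<^bsub>\<AA>\<^esub> f2 E \<mu> = \<gamma>"
    if \<gamma>: "\<gamma> \<in> cells \<AA> (e b \<odot>\<^bsub>\<AA>\<^esub> f1 E u) (e b \<odot>\<^bsub>\<AA>\<^esub> f1 E v)" for \<gamma>
  proof -
    obtain \<delta> where \<delta>: "\<delta> \<in> cell \<AA>" "src2 \<AA> \<delta> = f1 E u" "trg2 \<AA> \<delta> = f1 E v" "id2 \<AA> (e b) \<star>\<^bsub>\<AA>\<^esub> \<delta> = \<gamma>"
      by (rule LA.M.equivalence_whisker_left_surj[OF eq, of \<gamma> "f1 E u" "f1 E v"]) (use \<gamma> in auto)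
    have "\<exists>\<mu> \<in> cells \<HH> u v. f2 E \<mu> = \<delta>"
      by (rule local_equiv_atD(2)[OF le]) (use \<delta> in auto)
    then show ?thesis using \<delta>(4) by auto
  qed
  show "\<mu> = \<nu>" if *: "\<mu> \<in> cells \<HH> u v" "\<nu> \<in> cells \<HH> u v"
    "id2 \<AA> (e b) \<star>\<^bsub>\<AA>\<^esub> f2 E \<mu> = id2 \<AA> (e b) \<star>\<^bsub>\<AA>\<^esub> f2 E \<nu>" for \<mu> \<nu>
  proof -
    have "f2 E \<mu> = f2 E \<nu>"
      by (rule LA.M.equivalence_whisker_left_inj[OF eq _ _ _ _ _ *(3)]) (use *(1,2) in auto)
    then show ?thesis by (intro local_equiv_atD(1)[OF le _ _ *(1,2)]) auto
  qed
next
  fix x p b assume *: "x \<in> obj \<HH>" "p \<in> arr \<AA>" "src1 \<AA> p = f0 E x" "trg1 \<AA> p = b"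
  then have b: "b \<in> obj \<AA>" by auto
  note [simp] = e_equivalence(2,3)[OF b]
  obtain q where q: "q \<in> arr \<AA>" "src1 \<AA> q = src1 \<AA> p" "trg1 \<AA> q = src1 \<AA> (e b)" "isom \<AA> (e b \<odot>\<^bsub>\<AA>\<^esub> q) p"
    by (rule LA.M.equivalence_lift_left[OF e_equivalence(1)[OF b], of p]) (use * in auto)
  have "\<exists>u \<in> hom \<HH> x (r0 b). isom \<AA> (f1 E u) q"
    by (rule local_equiv_atD(3)[OF local_equiv_at_E[OF b *(1)]]) (use q * in auto)
  then obtain u where u: "u \<in> hom \<HH> x (r0 b)" "isom \<AA> (f1 E u) q" by blast
  have "isom \<AA> (e b \<odot>\<^bsub>\<AA>\<^esub> f1 E u) (e b \<odot>\<^bsub>\<AA>\<^esub> q)"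
    by (rule LA.M.isom_left[OF u(2)]) (use u(1) e_equivalence(1)[OF b] in \<open>auto simp: equivalence_1cell_def\<close>)
  then have "isom \<AA> p (e b \<odot>\<^bsub>\<AA>\<^esub> f1 E u)"
    by (rule LA.M.isom_sym[OF LA.M.isom_trans[OF _ q(4)]])
  with u(1) show "\<exists>u \<in> hom \<HH> x (r0 b). isom \<AA> p (e b \<odot>\<^bsub>\<AA>\<^esub> f1 E u)" by blast
qed

lemma right_biadjoint_exists:
  "\<exists>R. pseudofunctor \<AA> \<HH> R \<and> right_biadjoint \<HH> \<AA> E R \<and> local_equivalence \<AA> \<HH> R"
proof -
  interpret bu: biuniversal \<HH> \<AA> E r0 e by (rule biuniversal_E)
  interpret R: psf \<AA> \<HH> bu.R
    using bu.pseudofunctor_R LA.M.two_category_axioms LC.M.two_category_axioms by (simp add: psf_def)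
  show ?thesis
    using bu.pseudofunctor_R bu.biadjunction_R
      R.local_equivalenceI[OF bu.local_equiv_at_R[OF e_equivalence(1)]]
    unfolding right_biadjoint_def by blast
qed

end

theorem corollary2p22:
  fixes \<AA> :: "('oA, 'aA, 'cA) two_cat" and \<BB> :: "('oB, 'aB, 'cB) two_cat"
    and \<CC> :: "('oC, 'aC, 'cC) two_cat" and \<HH> :: "('oH, 'aH, 'cH) two_cat"
    and LA :: "('oB, 'aB, 'cB, 'oA, 'aA, 'cA) psfun"
    and LB :: "('oC, 'aC, 'cC, 'oB, 'aB, 'cB) psfun"
    and LC :: "('oC, 'aC, 'cC, 'oH, 'aH, 'cH) psfun"
    and E :: "('oH, 'aH, 'cH, 'oA, 'aA, 'cA) psfun"
    and A :: "('oA, 'aA, 'cA, 'oB, 'aB, 'cB) psfun"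
    and B :: "('oB, 'aB, 'cB, 'oC, 'aC, 'cC) psfun"
    and C :: "('oH, 'aH, 'cH, 'oC, 'aC, 'cC) psfun"
  assumes "two_category \<AA>" and "two_category \<BB>" and "two_category \<CC>" and "two_category \<HH>"
    and "pseudofunctor \<HH> \<AA> E"
    and "biadjunction \<BB> \<AA> LA A \<eta>A \<epsilon>A sA tA"
    and "biadjunction \<CC> \<BB> LB B \<eta>B \<epsilon>B sB tB"
    and "biadjunction \<CC> \<HH> LC C \<eta>C \<epsilon>C sC tC"
    and "pseudonaturally_equivalent \<CC> \<AA> (comp_psf \<AA> E LC) (comp_psf \<AA> LA LB)"
    and "idempotent_pseudomonad \<BB> (comp_psf \<BB> A LA) \<eta>A"
    and "idempotent_pseudomonad \<CC> (comp_psf \<CC> B LB) \<eta>B"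
    and "idempotent_pseudomonad \<CC> (comp_psf \<CC> C LC) \<eta>C"
    and "pseudomonadic \<BB> \<AA> A \<eta>A"
    and "pseudomonadic \<CC> \<BB> B \<eta>B"
    and "pseudomonadic \<CC> \<HH> C \<eta>C"
  shows "(\<exists>R. pseudofunctor \<AA> \<HH> R \<and> right_biadjoint \<HH> \<AA> E R \<and> local_equivalence \<AA> \<HH> R) \<and>
    (\<forall>X a. pseudoalgebra \<CC> \<eta>B X a \<and> admits_pseudoalgebra \<BB> \<eta>A (f0 LB X) \<longrightarrow>
       admits_pseudoalgebra \<CC> \<eta>C X)"
proof -
  obtain \<sigma> where \<sigma>: "pseudonatural_equivalence \<CC> \<AA> (comp_psf \<AA> E LC) (comp_psf \<AA> LA LB) \<sigma>"
    using assms(9) unfolding pseudonaturally_equivalent_def by blast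
  interpret lifting_square \<AA> \<BB> \<CC> \<HH> LA A \<eta>A \<epsilon>A sA tA LB B \<eta>B \<epsilon>B sB tB LC C \<eta>C \<epsilon>C sC tC E \<sigma>
    using assms \<sigma> by (intro lifting_square.intro lifting_square_axioms.intro biadj.intro)
  \<comment> \<open>The second conjunct is \<open>unit_C_equivalence\<close> at \<open>X\<close>:
    the pseudoalgebra provides the condition on the unit of \<open>B\<close> at \<open>X\<close>,
    and its premise on \<open>LB X\<close> the one on the unit of \<open>A\<close>.\<close>
  show ?thesis
    using right_biadjoint_exists unit_C_equivalence
    unfolding pseudoalgebra_def admits_pseudoalgebra_def by blast
qed

end
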